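(* Let $N\in\mathbb{N}$ be an odd square-free number, let $r_\delta\in\mathbb{N}_0$ for $\delta\mid N$, not all zero, and let $k=2\sum_{\delta\mid N}r_\delta>0$. Let $C_{2N}(z)\in S_{2k}(\Gamma_0(2N))$ be the cuspidal part of $\prod_{\delta\mid N}g^{8r_\delta}(\delta z)\in M_{2k}(\Gamma_0(2N))$. Then $$\begin{aligned}\prod_{\delta\mid N}\varphi^{8r_\delta}(\delta z)={}&\sum_{d\mid N}\left(\sum_{c\mid N}\frac{(-1)^{\omega(d)+\omega(c)}}{\prod_{p\mid 2N}(p^{2k}-1)}\left(\frac{2N\gcd(c,d)}{c}\right)^{2k}\prod_{\delta\mid N}\left(\frac{\gcd(c,\delta)}{\delta}\right)^{4r_\delta}\right)E_{2k}(2dz)\\&+\sum_{d\mid N}\left(\sum_{c\mid N}\frac{(-1)^{\omega(d)+\omega(2c)}}{\prod_{p\mid 2N}(p^{2k}-1)}\left(\frac{N\gcd(c,d)}{c}\right)^{2k}\prod_{\delta\mid N}\left(\frac{\gcd(c,\delta)}{\delta}\right)^{4r_\delta}\right)E_{2k}(dz+1/2)\\&+C_{2N}(z+1/2).\end{aligned}$$ Consequently, for every integer $n>0$, $$\begin{aligned}N(1^{8r_1},\ldots,\delta^{8r_\delta},\ldots,N^{8r_N};n)={}&\frac{4k}{B_{2k}}\sum_{d\mid N}\left(\sum_{c\mid N}\frac{(-1)^{\omega(d)+\omega(c)+1}}{\prod_{p\mid 2N}(p^{2k}-1)}\left(\frac{2N\gcd(c,d)}{c}\right)^{2k}\prod_{\delta\mid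 N}\left(\frac{\gcd(c,\delta)}{\delta}\right)^{4r_\delta}\right)\sigma_{2k-1}\!\left(\frac{n}{2d}\right)\\&+\frac{(-1)^n4k}{B_{2k}}\sum_{d\mid N}\left(\sum_{c\mid N}\frac{(-1)^{\omega(d)+\omega(c)}}{\prod_{p\mid 2N}(p^{2k}-1)}\left(\frac{N\gcd(c,d)}{c}\right)^{2k}\prod_{\delta\mid N}\left(\frac{\gcd(c,\delta)}{\delta}\right)^{4r_\delta}\right)\sigma_{2k-1}\!\left(\frac{n}{d}\right)\\&+(-1)^n[n]C_{2N}(z).\end{aligned}$$
   Context: Throughout, $z$ lies in the upper half plane, $q=e^{2\pi i z}$, $p$ denotes primes, and all divisors are positive. $\mathbb{N}_0$ is the set of non-negative integers. $M_w(\Gamma_0(M))$ is the space of modular forms of weight $w$ for $\Gamma_0(M)$, with $M_w(\Gamma_0(M))=E_w(\Gamma_0(M))\oplus S_w(\Gamma_0(M))$ its decomposition into Eisenstein forms and cusp forms; for $M$ square-free and $k>1$, $E_{2k}(\Gamma_0(M))$ is spanned by the functions $E_{2k}(dz)$, $d\mid M$. The cuspidal part of $f\in M_w(\Gamma_0(M))$ is its component in $S_w(\Gamma_0(M))$ under this decomposition. $\omega(d)$ is the number of distinct prime divisors of $d$. $\sigma_j(n)=\sum_{1\le d\mid n}d^j$ for $n\in\mathbb{N}$, with $\sigma_j(n)=0$ if $n\notin\mathbb{N}$. The Bernoulli numbers are defined by $\frac{x}{e^x-1}=\sum_{n\ge0}B_nx^n/n!$, and $E_{2k}(z)=1-\frac{4k}{B_{2k}}\sum_{n\ge1}\sigma_{2k-1}(n)q^n$.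 $[n]f(z)$ denotes the coefficient of $q^n$ in the Fourier expansion of $f$ at $\infty$. $\eta(z)=e^{\pi iz/12}\prod_{n\ge1}(1-e^{2\pi inz})$ is the Dedekind eta function, $g(z)=\frac{\eta^2(z)}{\eta(2z)}$, and $\varphi(z)=\sum_{n=-\infty}^{\infty}q^{n^2}$. One has $\prod_{\delta\mid N}g^{8r_\delta}(\delta z)\in M_{2k}(\Gamma_0(2N))$. $N(1^{8r_1},\ldots,\delta^{8r_\delta},\ldots,N^{8r_N};n)$ (with $\delta$ running over the divisors of $N$) denotes the number of representations of $n$ by the quadratic form $\sum_{\delta\mid N}\sum_{j=1}^{8r_\delta}\delta x_{\delta,j}^2$, i.e. the number of integer tuples $(x_{\delta,j})$ at which the form takes the value $n$ (exponents are notational); equivalently $\sum_{n\ge0}N(1^{8r_1},\ldots,N^{8r_N};n)q^n=\prod_{\delta\mid N}\varphi^{8r_\delta}(\delta z)$. *)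

theory Defs
  imports
    "HOL-Computational_Algebra.Computational_Algebra"
    "HOL-Complex_Analysis.Complex_Analysis"
begin

section \<open>Arithmetic functions\<close>

definition omega :: "nat \<Rightarrow> nat" where
  "omega n = card (prime_factors n)"

text \<open>The argument is real because divisor sums are taken at quotients such as \<open>n / (2 * d)\<close>;
  the value is 0 unless the argument is a positive integer.\<close>

definition divisor_sigma :: "nat \<Rightarrow> real \<Rightarrow> nat" where
  "divisor_sigma j x = (if \<exists>n::nat. n > 0 \<and> x = real n
                then \<Sum>d | d dvd nat \<lfloor>x\<rfloor>. d ^ j else 0)"

definition bernoulli :: "nat \<Rightarrow> real" where
  "bernoulli n = fact n * fps_nth (fps_X / (fps_exp 1 - 1)) n"

text \<open>\<open>rep_number N e n\<close> counts the representations of \<open>n\<close> by the diagonal quadratic form in which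
  each divisor \<open>\<delta>\<close> of \<open>N\<close> is the coefficient of \<open>e \<delta>\<close> squares. For \<open>N > 0\<close> the set counted is
  finite.\<close>

definition rep_number :: "nat \<Rightarrow> (nat \<Rightarrow> nat) \<Rightarrow> nat \<Rightarrow> nat" where
  "rep_number N e n =
     (let I = (SIGMA \<delta>:{\<delta>. \<delta> dvd N}. {1..e \<delta>})
      in card {x \<in> I \<rightarrow>\<^sub>E (UNIV :: int set). (\<Sum>(\<delta>, j)\<in>I. int \<delta> * x (\<delta>, j) ^ 2) = int n})"

section \<open>Functions on the upper half plane\<close>

text \<open>Functions on the upper half plane are represented by functions on \<^typ>\<open>complex\<close>; their values
  at points with non-positive imaginary part carry no meaning.\<close>

definition upper_half_plane :: "complex set" where
  "upper_half_plane = {z. Im z > 0}"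

definition eta :: "complex \<Rightarrow> complex" where
  "eta z = exp (of_real pi * \<i> * z / 12) * (\<Prod>n. 1 - exp (2 * of_real pi * \<i> * of_nat (Suc n) * z))"

definition g_fun :: "complex \<Rightarrow> complex" where
  "g_fun z = eta z ^ 2 / eta (2 * z)"

definition phi :: "complex \<Rightarrow> complex" where
  "phi z = (\<Sum>\<^sub>\<infinity>n::int. exp (2 * of_real pi * \<i> * z) ^ nat (n ^ 2))"

text \<open>\<open>eisenstein_series k\<close> has weight \<open>2 * k\<close>.\<close>

definition eisenstein_series :: "nat \<Rightarrow> complex \<Rightarrow> complex" where
  "eisenstein_series k z =
     1 - of_nat (4 * k) / of_real (bernoulli (2 * k)) *
       (\<Sum>n. of_nat (divisor_sigma (2 * k - 1) (real (Suc n))) * exp (2 * of_real pi * \<i> * z) ^ Suc n)"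

text \<open>The coefficient of \<open>q ^ n\<close> in the expansion at infinity of a function that is given on the
  upper half plane by a convergent power series in \<open>q\<close>.\<close>

definition fourier_coeff :: "(complex \<Rightarrow> complex) \<Rightarrow> nat \<Rightarrow> complex" where
  "fourier_coeff f =
     (THE a. \<forall>z\<in>upper_half_plane. (\<lambda>n. a n * exp (2 * of_real pi * \<i> * z) ^ n) sums f z)"

section \<open>Modular forms\<close>

text \<open>The quadruple \<open>(a, b, c, d)\<close> is the matrix with rows \<open>(a, b)\<close> and \<open>(c, d)\<close>.\<close>

definition SL2Z :: "(int \<times> int \<times> int \<times> int) set" where
  "SL2Z = {(a, b, c, d). a * d - b * c = 1}"

definition Gamma0 :: "nat \<Rightarrow> (int \<times> int \<times> int \<times> int) set" where
  "Gamma0 M = {(a, b, c, d). (a, b, c, d) \<in> SL2Z \<and> int M dvd c}"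

definition slash :: "nat \<Rightarrow> int \<times> int \<times> int \<times> int \<Rightarrow> (complex \<Rightarrow> complex) \<Rightarrow> complex \<Rightarrow> complex" where
  "slash w = (\<lambda>(a, b, c, d) f z.
     f ((of_int a * z + of_int b) / (of_int c * z + of_int d)) / (of_int c * z + of_int d) ^ w)"

definition at_i_infinity :: "complex filter" where
  "at_i_infinity = filtercomap Im at_top"

text \<open>Letting \<open>\<gamma>\<close> run over the whole modular group expresses the condition at infinity at every
  cusp.\<close>

definition modular_forms :: "nat \<Rightarrow> nat \<Rightarrow> (complex \<Rightarrow> complex) set" where
  "modular_forms w M = {f.
     f holomorphic_on upper_half_plane \<and>
     (\<forall>\<gamma>\<in>Gamma0 M. \<forall>z\<in>upper_half_plane. slash w \<gamma> f z = f z) \<and>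
     (\<forall>\<gamma>\<in>SL2Z. Bfun (slash w \<gamma> f) at_i_infinity)}"

definition cusp_forms :: "nat \<Rightarrow> nat \<Rightarrow> (complex \<Rightarrow> complex) set" where
  "cusp_forms w M = {f \<in> modular_forms w M.
     \<forall>\<gamma>\<in>SL2Z. (slash w \<gamma> f \<longlongrightarrow> 0) at_i_infinity}"

text \<open>The Eisenstein forms of weight \<open>2 * k\<close> for \<open>Gamma0 M\<close>. This description as a span is valid
  for square-free \<open>M\<close> and \<open>k > 1\<close> only.\<close>

definition eisenstein_forms :: "nat \<Rightarrow> nat \<Rightarrow> (complex \<Rightarrow> complex) set" where
  "eisenstein_forms k M = {f. \<exists>a. \<forall>z\<in>upper_half_plane.
     f z = (\<Sum>d | d dvd M. a d * eisenstein_series k (of_nat d * z))}"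

text \<open>\<open>C\<close> is the component in the cusp forms of the form \<open>f\<close> of weight \<open>2 * k\<close>. The values of \<open>C\<close>
  off the upper half plane are fixed to be 0, so that \<open>C\<close> is unique as a function on
  \<^typ>\<open>complex\<close>.\<close>

definition is_cuspidal_part ::
    "nat \<Rightarrow> nat \<Rightarrow> (complex \<Rightarrow> complex) \<Rightarrow> (complex \<Rightarrow> complex) \<Rightarrow> bool" where
  "is_cuspidal_part k M f C \<longleftrightarrow>
     f \<in> modular_forms (2 * k) M \<and>
     C \<in> cusp_forms (2 * k) M \<and>
     (\<lambda>z. f z - C z) \<in> eisenstein_forms k M \<and>
     (\<forall>z. z \<notin> upper_half_plane \<longrightarrow> C z = 0)"

definition cuspidal_part :: "nat \<Rightarrow> nat \<Rightarrow> (complex \<Rightarrow> complex) \<Rightarrow> complex \<Rightarrow> complex" where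
  "cuspidal_part k M f = (THE C. is_cuspidal_part k M f C)"

end

theory Submission
  imports Defs "HOL-Probability.Probability"
begin

text \<open>The theta function \<open>phi\<close> satisfies \<open>phi (- 1 / (4 * z)) = csqrt (- 2 * \<i> * z) * phi z\<close> (Poisson
  summation for the Gaussian on the imaginary axis, then analytic continuation), and
  \<open>g_fun z = phi (z + 1/2)\<close> is Gauss's product identity, the limit of a finite \<open>q\<close>-binomial identity.
  Since \<open>Gamma0 2\<close> is generated by \<open>- 1\<close>, \<open>z + 1\<close> and \<open>z / (2 * z + 1)\<close>, the eighth power of \<open>g_fun\<close> is a
  modular form of weight 4 for \<open>Gamma0 2\<close>; it tends to 1 at the cusps with even denominator and to
  0 at the others. The series \<open>E\<^sub>2\<^sub>k\<close> is a normalised lattice sum, by the Lipschitz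
  formula obtained from the reflection formula for the polygamma functions.

  Hence at a cusp of denominator \<open>c\<close> the value of the product of the \<open>g_fun (\<delta> * z) ^ (8 * r \<delta>)\<close> and that of
  \<open>E\<^sub>2\<^sub>k (d * z)\<close>, which is \<open>(gcd c d / d) ^ (2 * k)\<close>, are both known. The matrix of the latter
  is a Kronecker product over the primes dividing the level, so it is inverted explicitly. The inverse
  gives the coefficients of the Eisenstein part, and its existence shows that the cuspidal
  part is unique. The shift by \<open>1/2\<close> turns \<open>g_fun\<close> into \<open>phi\<close>, and comparing
  \<open>q\<close>-expansions yields the representation numbers.\<close>

section \<open>Expansions at infinity\<close>

text \<open>The exponent 8 comes from the multiplier: an inversion of \<open>phi\<close> contributes
  \<open>csqrt (- 2 * \<i> * z)\<close>, and only its eighth power is the fourth power of a linear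
  form up to a positive constant. Each factor then has weight 4 and the product weight
  \<open>2 * k\<close>; \<open>k\<close> is even and positive, hence at least 2, the range in which
  the lattice sums converge absolutely. The cuspidal part is a definite description, so a candidate
  must be exhibited and shown to be unique. The candidate is the product minus a combination of the
  \<open>E (d * z)\<close> with the same limit at every cusp. The prime 2 stands apart in finding
  this combination: the product vanishes at the cusps of odd denominator, so over 2 the prescribed
  values are 0 and 1, and the solution has \<open>- 1\<close> at \<open>E (d * z)\<close> and
  \<open>2 ^ (2 * k)\<close> at \<open>E (2 * d * z)\<close>, both over
  \<open>2 ^ (2 * k) - 1\<close>. Hence the sign and the power of 2 by which the two sums in the
  theorem differ. All \<open>d\<close> and \<open>\<delta>\<close> dividing \<open>N\<close> are
  odd, so the shift by 1/2 moves \<open>2 * d * z\<close> by an integer and \<open>d * z\<close> by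
  1/2 modulo integers.\<close>

abbreviation nome :: "complex \<Rightarrow> complex" where
  "nome z \<equiv> exp (2 * of_real pi * \<i> * z)"

lemma norm_nome_less_one: "z \<in> upper_half_plane \<Longrightarrow> norm (nome z) < 1"
  by (simp add: upper_half_plane_def)

lemma nome_of_nat_mult: "nome (of_nat n * z) = nome z ^ n"
  unfolding exp_of_nat_mult[symmetric] by (simp add: mult_ac)

lemma nome_surj:
  assumes "w \<noteq> 0" "norm w < 1"
  obtains z where "z \<in> upper_half_plane" "nome z = w"
proof
  show "nome (Ln w / (2 * of_real pi * \<i>)) = w"
    using assms(1) by simp
  have "Im (Ln w / (2 * of_real pi * \<i>)) = - Re (Ln w) / (2 * pi)"
    by (subst Im_divide) (simp add: field_simps power2_eq_square)
  then show "Ln w / (2 * of_real pi * \<i>) \<in> upper_half_plane"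
    using assms by (simp add: upper_half_plane_def divide_neg_pos)
qed

lemma open_upper_half_plane: "open upper_half_plane"
  unfolding upper_half_plane_def by (rule open_halfspace_Im_gt)

lemma convex_upper_half_plane: "convex upper_half_plane"
  unfolding upper_half_plane_def by (rule convex_halfspace_Im_gt)

lemma eventually_upper_half_plane: "\<forall>\<^sub>F z in at_i_infinity. z \<in> upper_half_plane"
  unfolding at_i_infinity_def upper_half_plane_def eventually_filtercomap
  by (auto intro!: exI[of _ "\<lambda>y. y > 0"] eventually_gt_at_top)

lemma filterlim_Im_at_i_infinity: "filterlim Im at_top at_i_infinity"
  unfolding at_i_infinity_def by (rule filterlim_filtercomap)

text \<open>Limits are unique only along a proper filter; comparing values at the cusps rests on
  this.\<close>

lemma at_i_infinity_neq_bot [simp]: "at_i_infinity \<noteq> bot"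
proof -
  have "surj Im" by (rule surjI[of Im "Complex 0"]) simp
  then show ?thesis unfolding at_i_infinity_def
    by (subst filtercomap_neq_bot_surj) auto
qed

lemma filterlim_at_i_infinity_affine:
  assumes "r > 0"
  shows "filterlim (\<lambda>z. of_real r * z + of_real b) at_i_infinity at_i_infinity"
  unfolding at_i_infinity_def filterlim_filtercomap_iff comp_def
proof -
  have "filterlim (\<lambda>x. r * Im x) at_top (filtercomap Im at_top)"
    using assms by (intro filterlim_tendsto_pos_mult_at_top[OF tendsto_const])
      (auto intro: filterlim_filtercomap)
  then show "filterlim (\<lambda>x. Im (of_real r * x + of_real b)) at_top (filtercomap Im at_top)"
    by simp
qed

lemma nome_tendsto_0: "(nome \<longlongrightarrow> 0) at_i_infinity"
proof (rule Lim_null_comparison)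
  show "\<forall>\<^sub>F z in at_i_infinity. norm (nome z) \<le> exp (- (2 * pi * Im z))"
    by simp
  have "filterlim (\<lambda>z. 2 * pi * Im z) at_top at_i_infinity"
    by (intro filterlim_tendsto_pos_mult_at_top[OF tendsto_const] filterlim_Im_at_i_infinity) auto
  then show "((\<lambda>z. exp (- (2 * pi * Im z))) \<longlongrightarrow> 0) at_i_infinity"
    by (rule filterlim_compose[OF exp_at_bot filterlim_compose[OF filterlim_uminus_at_bot_at_top]])
qed

text \<open>\<open>nome\<close> maps the half plane onto the punctured unit disc, so an expansion in
  \<open>nome z\<close> is a power series on the whole disc, the centre being harmless. Holomorphy,
  the limit at infinity and uniqueness of the coefficients are all read off from
  \<open>F\<close>.\<close>

lemma power_series_from_nome_series:
  assumes "\<And>z. z \<in> upper_half_plane \<Longrightarrow> (\<lambda>n. a n * nome z ^ n) sums f z"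
  shows "\<exists>F. (\<forall>w\<in>ball 0 1. (\<lambda>n. a n * w ^ n) sums F w) \<and> (\<forall>z\<in>upper_half_plane. f z = F (nome z))"
proof (intro exI conjI ballI)
  fix w :: complex assume "w \<in> ball 0 1"
  show "(\<lambda>n. a n * w ^ n) sums (\<Sum>n. a n * w ^ n)"
  proof (cases "w = 0")
    case False
    with \<open>w \<in> ball 0 1\<close> obtain z where "z \<in> upper_half_plane" "nome z = w"
      using nome_surj[of w] by auto
    then have "summable (\<lambda>n. a n * w ^ n)" using assms[of z] sums_summable by blast
    then show ?thesis by (rule summable_sums)
  qed (simp add: summable_sums)
next
  show "f z = (\<Sum>n. a n * nome z ^ n)" if "z \<in> upper_half_plane" for z
    using sums_unique[OF assms[OF that]] .
qed

lemma nome_series_holomorphic: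
  assumes "\<And>z. z \<in> upper_half_plane \<Longrightarrow> (\<lambda>n. a n * nome z ^ n) sums f z"
  shows "f holomorphic_on upper_half_plane"
proof -
  obtain F where F: "\<And>w. w \<in> ball 0 1 \<Longrightarrow> (\<lambda>n. a n * w ^ n) sums F w"
    "\<And>z. z \<in> upper_half_plane \<Longrightarrow> f z = F (nome z)"
    using power_series_from_nome_series[OF assms] by blast
  have "F holomorphic_on ball 0 1"
    using F(1) by (intro power_series_holomorphic[where a = a]) auto
  then have "(F \<circ> nome) holomorphic_on upper_half_plane"
    by (rule holomorphic_on_compose_gen[rotated])
      (auto intro!: holomorphic_intros norm_nome_less_one simp del: norm_exp_eq_Re)
  then show ?thesis by (rule holomorphic_transform) (simp add: F(2))
qed

lemma nome_series_tendsto: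
  assumes "\<And>z. z \<in> upper_half_plane \<Longrightarrow> (\<lambda>n. a n * nome z ^ n) sums f z"
  shows "(f \<longlongrightarrow> a 0) at_i_infinity"
proof -
  obtain F where F: "\<And>w. w \<in> ball 0 1 \<Longrightarrow> (\<lambda>n. a n * w ^ n) sums F w"
    "\<And>z. z \<in> upper_half_plane \<Longrightarrow> f z = F (nome z)"
    using power_series_from_nome_series[OF assms] by blast
  have "F holomorphic_on ball 0 1"
    using F(1) by (intro power_series_holomorphic[where a = a]) auto
  then have "isCont F 0"
    by (intro continuous_on_interior[of "ball 0 1"] holomorphic_on_imp_continuous_on) auto
  then have "((\<lambda>z. F (nome z)) \<longlongrightarrow> F 0) at_i_infinity"
    by (rule isCont_tendsto_compose[OF _ nome_tendsto_0])
  moreover have "F 0 = a 0"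
    using sums_unique2[OF F(1)[of 0] powser_sums_zero[of a]] by simp
  ultimately have "((\<lambda>z. F (nome z)) \<longlongrightarrow> a 0) at_i_infinity" by simp
  moreover have "\<forall>\<^sub>F z in at_i_infinity. F (nome z) = f z"
    using eventually_upper_half_plane by eventually_elim (simp add: F(2))
  ultimately show ?thesis
    by (rule Lim_transform_eventually)
qed

lemma nome_series_unique:
  assumes "\<And>z. z \<in> upper_half_plane \<Longrightarrow> (\<lambda>n. a n * nome z ^ n) sums f z"
    and "\<And>z. z \<in> upper_half_plane \<Longrightarrow> (\<lambda>n. b n * nome z ^ n) sums f z"
  shows "a = b"
proof -
  have "(\<lambda>n. (a n - b n) * nome z ^ n) sums 0" if "z \<in> upper_half_plane" for z
    using sums_diff[OF assms(1)[OF that] assms(2)[OF that]] by (simp add: left_diff_distrib)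
  from power_series_from_nome_series[of "\<lambda>n. a n - b n" "\<lambda>_. 0", OF this]
  obtain F where "(\<forall>w\<in>ball 0 1. (\<lambda>n. (a n - b n) * w ^ n) sums F w)
      \<and> (\<forall>z\<in>upper_half_plane. 0 = F (nome z))" ..
  then have F: "w \<in> ball 0 1 \<Longrightarrow> (\<lambda>n. (a n - b n) * w ^ n) sums F w"
    "z \<in> upper_half_plane \<Longrightarrow> F (nome z) = 0" for w z by simp_all
  have sums_0: "(\<lambda>n. (a n - b n) * w ^ n) sums 0" if w: "norm w < 1" "w \<noteq> 0" for w
  proof -
    obtain z where "z \<in> upper_half_plane" "nome z = w"
      by (rule nome_surj[OF w(2,1)])
    then show ?thesis using F(1)[of w] F(2)[of z] w by simp
  qed
  \<comment> \<open>Vanishing is known only on the punctured disc, since 0 is not a value of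
    \<open>nome\<close>; the constant coefficient is recovered as a limit.\<close>
  have "(\<lambda>_ :: complex. 0) \<midarrow>0\<rightarrow> a 0 - b 0"
    using powser_limit_0_strong[of 1 "\<lambda>n. a n - b n" "\<lambda>_. 0"] sums_0 by auto
  then have 0: "a 0 - b 0 = 0"
    by (rule LIM_const_eq[symmetric])
  have "a n - b n = 0" for n
  proof (rule ccontr)
    \<comment> \<open>A nonzero coefficient of positive index would make the centre an isolated zero
      of the zero function.\<close>
    assume n: "a n - b n \<noteq> 0"
    with 0 have "n > 0" by (cases n) auto
    show False
    proof (rule powser_0_nonzero[where r = 1 and \<xi> = 0 and a = "\<lambda>n. a n - b n" and f = "\<lambda>_. 0" and m = n])
      show "(\<lambda>n. (a n - b n) * (w - 0) ^ n) sums 0" if "norm (w - 0) < 1" for w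
        using sums_0[of w] powser_sums_zero[of "\<lambda>n. a n - b n"] 0 that by (cases "w = 0") auto
      show False if "s > 0" "\<And>z. z \<in> cball (0 :: complex) s - {0} \<Longrightarrow> (0 :: complex) \<noteq> 0" for s
        using that(2)[of "of_real s"] that(1) by simp
    qed (use n \<open>n > 0\<close> in auto)
  qed
  then show ?thesis by (simp add: fun_eq_iff)
qed

lemma fourier_coeff_eq:
  assumes "\<And>z. z \<in> upper_half_plane \<Longrightarrow> (\<lambda>n. a n * nome z ^ n) sums f z"
  shows "fourier_coeff f = a"
  unfolding fourier_coeff_def
  using assms by (intro the_equality) (auto intro!: nome_series_unique)

text \<open>Absolute convergence allows the integers to be split into 0 and two halves, which agree
  after \<open>n \<mapsto> - n\<close>.\<close>

lemma has_sum_int_even: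
  fixes f :: "int \<Rightarrow> 'a :: banach"
  assumes "summable (\<lambda>n. norm (f (int n)))" and "\<And>n. f (- n) = f n"
  shows "(f has_sum (f 0 + 2 *\<^sub>R (\<Sum>n. f (int (Suc n))))) UNIV"
proof -
  have "summable (\<lambda>n. norm (f (int (Suc n))))"
    using assms(1) summable_Suc_iff[of "\<lambda>n. norm (f (int n))"] by simp
  from norm_summable_imp_has_sum[OF this summable_sums[OF summable_norm_cancel[OF this]]]
  have *: "((\<lambda>n. f (int (Suc n))) has_sum (\<Sum>n. f (int (Suc n)))) UNIV" .
  have "(f has_sum (\<Sum>n. f (int (Suc n)))) {0<..} \<longleftrightarrow> ((\<lambda>n. f (int (Suc n))) has_sum (\<Sum>n. f (int (Suc n)))) UNIV"
    by (rule has_sum_reindex_bij_witness[of _ "\<lambda>n. int (Suc n)" "\<lambda>m. nat m - 1"]) auto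
  with * have 1: "(f has_sum (\<Sum>n. f (int (Suc n)))) {0<..}" by blast
  have "(f has_sum (\<Sum>n. f (int (Suc n)))) {..<0} \<longleftrightarrow> (f has_sum (\<Sum>n. f (int (Suc n)))) {0<..}"
    by (rule has_sum_reindex_bij_witness[of _ uminus uminus]) (auto simp: assms(2))
  with 1 have 2: "(f has_sum (\<Sum>n. f (int (Suc n)))) {..<0}" by blast
  have 3: "(f has_sum f 0) {0}" by (simp add: has_sum_finite_iff)
  have "(f has_sum (f 0 + (\<Sum>n. f (int (Suc n))))) ({0} \<union> {0<..})"
    by (rule has_sum_Un_disjoint[OF 3 1]) auto
  moreover have "({0} \<union> {0<..}) \<inter> {..<0} = ({} :: int set)" by auto
  ultimately have "(f has_sum (f 0 + (\<Sum>n. f (int (Suc n))) + (\<Sum>n. f (int (Suc n))))) ({0} \<union> {0<..} \<union> {..<0})"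
    by (rule has_sum_Un_disjoint[OF _ 2])
  moreover have "{0} \<union> {0<..} \<union> {..<0} = (UNIV :: int set)" by auto
  ultimately show ?thesis by (simp add: scaleR_2 add.assoc)
qed

section \<open>Poisson summation for the Gaussian\<close>

text \<open>Symmetry about 1/2 makes \<open>f\<close> a continuous function \<open>F\<close> of
  \<open>cos (2 * pi * x)\<close>. By hypothesis \<open>f\<close> is orthogonal to all polynomials
  in this cosine, and by Weierstrass these approximate \<open>F\<close> uniformly, so the integral
  of \<open>f ^ 2\<close> vanishes.\<close>

lemma cosine_coefficients_zero_imp_zero:
  fixes f :: "real \<Rightarrow> real"
  assumes cont: "continuous_on {0..1} f"
    and sym: "\<And>x. x \<in> {0..1} \<Longrightarrow> f (1 - x) = f x"
    and coeff: "\<And>n::int. integral {0..1} (\<lambda>x. f x * cos (2 * pi * of_int n * x)) = 0"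
    and x: "x \<in> {0..1}"
  shows "f x = 0"
proof -
  \<comment> \<open>By the product-to-sum formula a factor \<open>cos (2 * pi * x)\<close> averages
    the frequencies \<open>n + 1\<close> and \<open>n - 1\<close>.\<close>
  have powers: "integral {0..1} (\<lambda>x. f x * cos (2 * pi * x) ^ m * cos (2 * pi * of_int n * x)) = 0"
    for m :: nat and n :: int
  proof (induction m arbitrary: n)
    case 0
    then show ?case using coeff by simp
  next
    case (Suc m)
    let ?h = "\<lambda>n x. f x * cos (2 * pi * x) ^ m * cos (2 * pi * of_int n * x)"
    have int: "?h n integrable_on {0..1}" for n :: int
      by (intro integrable_continuous_real continuous_intros cont)
    have eq: "f x * cos (2 * pi * x) ^ Suc m * cos (2 * pi * of_int n * x)
        = (1/2) * (?h (n + 1) x + ?h (n - 1) x)" for x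
    proof -
      have "cos (2 * pi * of_int (n + 1) * x) + cos (2 * pi * of_int (n - 1) * x)
          = 2 * (cos (2 * pi * x) * cos (2 * pi * of_int n * x))"
        by (simp add: algebra_simps cos_add cos_diff)
      then have "?h (n + 1) x + ?h (n - 1) x
          = f x * cos (2 * pi * x) ^ m * (2 * (cos (2 * pi * x) * cos (2 * pi * of_int n * x)))"
        by (simp only: distrib_left[symmetric])
      then show ?thesis by simp
    qed
    show ?case
      unfolding eq using int Suc
      by (subst integral_mult_right, subst integral_add) (simp_all only: add_0 mult_zero_right)
  qed
  have poly: "integral {0..1} (\<lambda>x. f x * p (cos (2 * pi * x))) = 0"
    if "real_polynomial_function p" for p :: "real \<Rightarrow> real"
  proof -
    obtain a n where p: "p = (\<lambda>x. \<Sum>i\<le>n. a i * x ^ i)"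
      using \<open>real_polynomial_function p\<close> by (auto simp: real_polynomial_function_iff_sum)
    have "(\<lambda>x. f x * p (cos (2 * pi * x))) = (\<lambda>x. \<Sum>i\<le>n. a i * (f x * cos (2 * pi * x) ^ i))"
      by (auto simp: p sum_distrib_left algebra_simps)
    moreover have "(\<lambda>x. a i * (f x * cos (2 * pi * x) ^ i)) integrable_on {0..1}" for i
      by (intro integrable_continuous_real continuous_intros cont)
    ultimately show ?thesis
      using powers[of _ 0] by (simp add: integral_sum)
  qed
  define F where "F y = f (arccos y / (2 * pi))" for y
  have "continuous_on {-1..1} F"
    unfolding F_def
    by (rule continuous_on_compose2[OF cont])
      (auto intro!: continuous_intros simp: divide_simps arccos_lbound,
        (smt (verit) arccos_ubound pi_gt_zero)+)
  \<comment> \<open>\<open>arccos\<close> inverts the cosine only for \<open>x \<le> 1 / 2\<close>;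
    the other half is reached by the symmetry.\<close>
  have fF: "f x = F (cos (2 * pi * x))" if "x \<in> {0..1}" for x
  proof (cases "x \<le> 1 / 2")
    case True
    then have "arccos (cos (2 * pi * x)) = 2 * pi * x"
      using that by (intro arccos_cos) auto
    then show ?thesis by (simp add: F_def)
  next
    case False
    have "cos (2 * pi * x) = cos (2 * pi * (1 - x))"
      by (simp add: algebra_simps cos_diff)
    moreover have "arccos (cos (2 * pi * (1 - x))) = 2 * pi * (1 - x)"
      using that False by (intro arccos_cos) auto
    ultimately show ?thesis using sym that by (simp add: F_def)
  qed
  define J where "J = integral {0..1} (\<lambda>x. \<bar>f x\<bar>)"
  have J: "J \<ge> 0" unfolding J_def
    by (intro integral_nonneg integrable_continuous_real continuous_intros cont) auto
  have I: "integral {0..1} (\<lambda>x. f x ^ 2) \<le> e * J" if "e > 0" for e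
  proof -
    obtain p where p: "real_polynomial_function p" "\<And>y. y \<in> {-1..1} \<Longrightarrow> \<bar>F y - p y\<bar> < e"
      using Stone_Weierstrass_real_polynomial_function[OF _ \<open>continuous_on {-1..1} F\<close> \<open>e > 0\<close>]
      by auto
    have pc: "continuous_on A p" for A
      using p(1) by (simp add: continuous_on_polymonial_function real_polynomial_function_eq)
    have ci: "(\<lambda>x. f x * p (cos (2 * pi * x))) integrable_on {0..1}"
      by (intro integrable_continuous_real continuous_intros cont continuous_on_compose2[OF pc]) auto
    have ci2: "(\<lambda>x. f x ^ 2) integrable_on {0..1}"
      by (intro integrable_continuous_real continuous_intros cont)
    \<comment> \<open>Orthogonality to the polynomial allows one factor of \<open>f ^ 2\<close> to
      be replaced by the approximation error.\<close>
    have "integral {0..1} (\<lambda>x. f x ^ 2)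
        = integral {0..1} (\<lambda>x. f x ^ 2 - f x * p (cos (2 * pi * x)))"
      using ci ci2 poly[OF p(1)] by (subst integral_diff) auto
    also have "\<dots> \<le> integral {0..1} (\<lambda>x. e * \<bar>f x\<bar>)"
    proof (rule integral_le)
      show "(\<lambda>x. (f x)\<^sup>2 - f x * p (cos (2 * pi * x))) integrable_on {0..1}"
        using ci ci2 by (rule integrable_diff[rotated])
      show "(\<lambda>x. e * \<bar>f x\<bar>) integrable_on {0..1}"
        by (intro integrable_continuous_real continuous_intros cont)
      fix x :: real assume x: "x \<in> {0..1}"
      have "(f x)\<^sup>2 - f x * p (cos (2 * pi * x)) = f x * (F (cos (2 * pi * x)) - p (cos (2 * pi * x)))"
        using fF[OF x] by (simp add: power2_eq_square algebra_simps)
      also have "\<dots> \<le> \<bar>f x\<bar> * \<bar>F (cos (2 * pi * x)) - p (cos (2 * pi * x))\<bar>"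
        by (metis abs_ge_self abs_mult)
      also have "\<dots> \<le> \<bar>f x\<bar> * e"
        by (intro mult_left_mono less_imp_le[OF p(2)]) auto
      finally show "(f x)\<^sup>2 - f x * p (cos (2 * pi * x)) \<le> e * \<bar>f x\<bar>" by (simp add: mult.commute)
    qed
    also have "\<dots> = e * J" by (simp add: J_def)
    finally show ?thesis .
  qed
  have "integral {0..1} (\<lambda>x. f x ^ 2) \<le> 0"
  proof (rule field_le_epsilon)
    fix e :: real assume "e > 0"
    \<comment> \<open>Dividing by \<open>J + 1\<close> also covers \<open>J = 0\<close>.\<close>
    have "integral {0..1} (\<lambda>x. f x ^ 2) \<le> e / (J + 1) * J"
      using J \<open>e > 0\<close> by (intro I) auto
    also have "\<dots> \<le> e" using J \<open>e > 0\<close> by (simp add: divide_simps)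
    finally show "integral {0..1} (\<lambda>x. f x ^ 2) \<le> 0 + e" by simp
  qed
  moreover have "integral {0..1} (\<lambda>x. f x ^ 2) \<ge> 0"
    by (intro integral_nonneg integrable_continuous_real continuous_intros cont) auto
  ultimately have "integral {0..1} (\<lambda>x. f x ^ 2) = 0" by simp
  then have "\<forall>x\<in>{0..1}. f x ^ 2 = 0"
    by (subst (asm) integral_eq_0_iff) (auto intro!: continuous_intros cont)
  then show ?thesis using x by auto
qed

text \<open>This is the real part of the characteristic function of the standard normal
  distribution, after rescaling the variable.\<close>

lemma gaussian_cosine_integral:
  fixes t s :: real
  assumes t: "t > 0"
  shows "integrable lborel (\<lambda>x. exp (- pi * t * x\<^sup>2) * cos (2 * pi * s * x))" (is ?int)
    and "(LBINT x. exp (- pi * t * x\<^sup>2) * cos (2 * pi * s * x)) = exp (- pi * s\<^sup>2 / t) / sqrt t"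
      (is ?eq)
proof -
  \<comment> \<open>With this \<open>a\<close>, \<open>(a * x)\<^sup>2 / 2\<close> equals
    \<open>pi * t * x\<^sup>2\<close>.\<close>
  define a where "a = sqrt (2 * pi * t)"
  have a: "a > 0" and a2: "a ^ 2 = 2 * pi * t" using t by (auto simp: a_def)
  define h where "h x = std_normal_density x * cos ((2 * pi * s / a) * x)" for x
  have Re_iexp: "Re (r *\<^sub>R iexp y) = r * cos y" for r y
    by (simp add: Re_exp)
  have h_int: "integrable lborel h"
    unfolding h_def
    by (rule Bochner_Integration.integrable_bound[of _ std_normal_density])
      (auto simp: abs_mult intro!: mult_left_le)
  have "complex_of_real (exp (- (2 * pi * s / a)\<^sup>2 / 2))
      = (CLINT x|std_normal_distribution. iexp ((2 * pi * s / a) * x))"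
    using fun_cong[OF char_std_normal_distribution, of "2 * pi * s / a"] unfolding char_def by (rule sym)
  also have "\<dots> = (CLBINT x. std_normal_density x *\<^sub>R iexp ((2 * pi * s / a) * x))"
    by (subst integral_density) auto
  finally have "exp (- (2 * pi * s / a)\<^sup>2 / 2)
      = Re (CLBINT x. std_normal_density x *\<^sub>R iexp ((2 * pi * s / a) * x))"
    by (metis Re_complex_of_real)
  also have "\<dots> = (LBINT x. Re (std_normal_density x *\<^sub>R iexp ((2 * pi * s / a) * x)))"
  proof (rule integral_Re[symmetric])
    show "complex_integrable lborel (\<lambda>x. std_normal_density x *\<^sub>R iexp ((2 * pi * s / a) * x))"
      by (rule Bochner_Integration.integrable_bound[of _ std_normal_density])
        (auto simp: norm_mult)
  qed
  also have "\<dots> = (LBINT x. h x)"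
    unfolding Re_iexp h_def ..
  finally have 1: "(LBINT x. h x) = exp (- (2 * pi * s / a)\<^sup>2 / 2)" by simp
  have 2: "h (a * x) = (exp (- pi * t * x\<^sup>2) * cos (2 * pi * s * x)) / sqrt (2 * pi)" for x
    using a by (simp add: h_def std_normal_density_def power_mult_distrib a2 mult.assoc)
  have "integrable lborel (\<lambda>x. h (a * x))"
    using lborel_integrable_real_affine[OF h_int, of a 0] a by simp
  then have "integrable lborel (\<lambda>x. sqrt (2 * pi) * h (a * x))" by simp
  then show ?int by (simp add: 2)
  have "(LBINT x. h x) = \<bar>a\<bar> *\<^sub>R (LBINT x. h (a * x))"
    using lborel_integral_real_affine[of a h 0] a by simp
  also have "\<dots> = a / sqrt (2 * pi) * (LBINT x. exp (- pi * t * x\<^sup>2) * cos (2 * pi * s * x))"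
    using a by (simp add: 2)
  also have "a / sqrt (2 * pi) = sqrt t"
    by (simp add: a_def real_sqrt_mult)
  finally have "sqrt t * (LBINT x. exp (- pi * t * x\<^sup>2) * cos (2 * pi * s * x))
      = exp (- (2 * pi * s / a)\<^sup>2 / 2)" using 1 by simp
  moreover have "(2 * pi * s / a)\<^sup>2 / 2 = pi * s\<^sup>2 / t"
    unfolding power_divide a2 using t by (simp add: power2_eq_square)
  ultimately show ?eq using t by (simp add: field_simps)
qed

text \<open>The Weierstrass test gives uniform convergence of the partial sums, hence continuity and
  integration term by term. Both sides of the Poisson formula go through it.\<close>

lemma continuous_sums_integral_M_test:
  fixes u :: "nat \<Rightarrow> real \<Rightarrow> real"
  assumes "\<And>n. continuous_on {a..b} (u n)" "\<And>n x. x \<in> {a..b} \<Longrightarrow> \<bar>u n x\<bar> \<le> M n" "summable M"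
  shows "continuous_on {a..b} (\<lambda>x. \<Sum>n. u n x)"
    and "(\<lambda>n. integral {a..b} (u n)) sums integral {a..b} (\<lambda>x. \<Sum>n. u n x)"
proof -
  have lim: "uniform_limit {a..b} (\<lambda>n x. \<Sum>i<n. u i x) (\<lambda>x. \<Sum>i. u i x) sequentially"
    using assms(2,3) by (intro Weierstrass_m_test[where M = M]) auto
  have cont: "continuous_on {a..b} (\<lambda>x. \<Sum>i<n. u i x)" for n
    by (intro continuous_intros assms)
  show "continuous_on {a..b} (\<lambda>x. \<Sum>n. u n x)"
    by (rule uniform_limit_theorem[OF _ lim]) (auto simp: cont)
  obtain I J where IJ: "\<And>n. ((\<lambda>x. \<Sum>i<n. u i x) has_integral I n) {a..b}"
      "((\<lambda>x. \<Sum>i. u i x) has_integral J) {a..b}" "I \<longlonglongrightarrow> J"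
    by (rule uniform_limit_integral[OF lim]) (auto simp: cont)
  have "I n = (\<Sum>i<n. integral {a..b} (u i))" for n
    using integral_unique[OF IJ(1)[of n]]
    by (subst (asm) integral_sum) (auto intro!: integrable_continuous_real assms)
  then have "(\<lambda>n. \<Sum>i<n. integral {a..b} (u i)) \<longlonglongrightarrow> J"
    using IJ(3) by presburger
  moreover have "J = integral {a..b} (\<lambda>x. \<Sum>n. u n x)"
    using integral_unique[OF IJ(2)] by simp
  ultimately show "(\<lambda>n. integral {a..b} (u n)) sums integral {a..b} (\<lambda>x. \<Sum>n. u n x)"
    by (simp add: sums_def)
qed

lemma integral_cos_unit_interval:
  "integral {0..1} (\<lambda>x. cos (2 * pi * of_int n * x)) = (if n = 0 then 1 else 0 :: real)"
proof (cases "n = 0")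
  case False
  have "((\<lambda>x. cos (2 * pi * of_int n * x)) has_integral
      (sin (2 * pi * of_int n * 1) / (2 * pi * of_int n) - sin (2 * pi * of_int n * 0) / (2 * pi * of_int n))) {0..1}"
    using False
    by (intro fundamental_theorem_of_calculus)
      (auto intro!: derivative_eq_intros simp flip: has_real_derivative_iff_has_vector_derivative)
  moreover have "sin (2 * pi * of_int n * 1) = 0"
    by (metis mult.commute mult.right_neutral sin_int_2pin)
  ultimately show ?thesis using False by (simp add: integral_unique)
qed auto

lemma integral_cos_cos_unit_interval:
  fixes a b :: nat
  assumes "a > 0"
  shows "integral {0..1} (\<lambda>x. cos (2 * pi * real a * x) * cos (2 * pi * real b * x))
      = (if a = b then 1 / 2 else 0)"
proof -
  have "cos (2 * pi * real a * x) * cos (2 * pi * real b * x)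
      = (1/2) * (cos (2 * pi * of_int (int a + int b) * x) + cos (2 * pi * of_int (int a - int b) * x))" for x
    by (simp add: cos_add cos_diff distrib_left distrib_right left_diff_distrib right_diff_distrib)
  then have "integral {0..1} (\<lambda>x. cos (2 * pi * real a * x) * cos (2 * pi * real b * x))
     = (1/2) * (integral {0..1} (\<lambda>x. cos (2 * pi * of_int (int a + int b) * x))
       + integral {0..1} (\<lambda>x. cos (2 * pi * of_int (int a - int b) * x)))"
    by (simp only: integral_mult_right)
      (subst integral_add, auto intro!: integrable_continuous_real continuous_intros)
  also have "\<dots> = (if a = b then 1 / 2 else 0)"
    using assms by (simp only: integral_cos_unit_interval) auto
  finally show ?thesis .
qed

lemma summable_gaussian:
  fixes t :: real
  assumes "t > 0"
  shows "summable (\<lambda>n. exp (- pi * t * (real n)\<^sup>2))"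
proof (rule summable_comparison_test)
  have "exp (- pi * t) < 1" using assms by simp
  then show "summable (\<lambda>n. exp (- pi * t) ^ n)" by (intro summable_geometric) simp
  have "norm (exp (- pi * t * (real n)\<^sup>2)) \<le> exp (- pi * t) ^ n" for n
  proof -
    have "real n \<le> (real n)\<^sup>2" by (cases "n = 0") (auto simp: power2_eq_square)
    then have "pi * t * real n \<le> pi * t * (real n)\<^sup>2" using assms by (intro mult_left_mono) auto
    then show ?thesis by (simp add: mult_ac flip: exp_of_nat_mult)
  qed
  then show "\<exists>N. \<forall>n\<ge>N. norm (exp (- pi * t * (real n)\<^sup>2)) \<le> exp (- pi * t) ^ n" by blast
qed

text \<open>Dominated convergence turns the integral over the line into a limit over
  \<open>{- n..n}\<close>, the form in which the partial sums of the periodised Gaussian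
  arrive.\<close>

lemma integral_gaussian_cosine_symmetric_limit:
  fixes t s :: real
  assumes t: "t > 0"
  shows "(\<lambda>n. integral {- real n..real n} (\<lambda>x. exp (- pi * t * x\<^sup>2) * cos (2 * pi * s * x)))
     \<longlonglongrightarrow> exp (- pi * s\<^sup>2 / t) / sqrt t"
proof -
  define f where "f x = exp (- pi * t * x\<^sup>2) * cos (2 * pi * s * x)" for x
  have int: "integrable lborel f" and eq: "(LBINT x. f x) = exp (- pi * s\<^sup>2 / t) / sqrt t"
    using gaussian_cosine_integral[OF t, of s] unfolding f_def[abs_def] by blast+
  have "(\<lambda>n. LBINT x. indicator {- real n..real n} x *\<^sub>R f x) \<longlonglongrightarrow> (LBINT x. f x)"
  proof (rule integral_dominated_convergence[where w = "\<lambda>x. \<bar>f x\<bar>"])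
    show "AE x in lborel. (\<lambda>n. indicat_real {- real n..real n} x *\<^sub>R f x) \<longlonglongrightarrow> f x"
    proof (rule AE_I2, rule tendsto_eventually)
      fix x :: real
      show "\<forall>\<^sub>F n in sequentially. indicat_real {- real n..real n} x *\<^sub>R f x = f x"
        using eventually_ge_at_top[of "nat \<lceil>\<bar>x\<bar>\<rceil>"]
      proof eventually_elim
        case (elim n)
        then have "\<bar>x\<bar> \<le> real n" by linarith
        then show ?case by (auto simp: indicator_def)
      qed
    qed
  qed (use int in \<open>auto simp: indicator_def\<close>)
  moreover have "(LBINT x. indicator {- real n..real n} x *\<^sub>R f x) = integral {- real n..real n} f" for n
  proof -
    have "set_integrable lborel {- real n..real n} f"
      unfolding set_integrable_def using int by (intro integrable_mult_indicator) auto
    then show ?thesis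
      using set_borel_integral_eq_integral(2)[of "{- real n..real n}" f]
      by (simp add: set_lebesgue_integral_def)
  qed
  ultimately have "(\<lambda>n. integral {- real n..real n} f) \<longlonglongrightarrow> exp (- pi * s\<^sup>2 / t) / sqrt t"
    using eq by simp
  then show ?thesis unfolding f_def[abs_def] .
qed

text \<open>Both sides are continuous, symmetric under \<open>x \<mapsto> 1 - x\<close>, and have
  the same cosine coefficients: on the left the integrals over the unit interval unfold to an
  integral over the line, on the right they are explicit.\<close>

lemma gaussian_poisson_summation:
  fixes t x :: real
  assumes t: "t > 0" and x: "x \<in> {0..1}"
  shows "(\<Sum>n. exp (- pi * t * (x + real n)\<^sup>2) + exp (- pi * t * (x - 1 - real n)\<^sup>2))
     = (1 + 2 * (\<Sum>n. exp (- pi * (real (Suc n))\<^sup>2 / t) * cos (2 * pi * real (Suc n) * x))) / sqrt t"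
proof -
  define G where "G y = exp (- pi * t * y\<^sup>2)" for y :: real
  \<comment> \<open>The translates by \<open>n\<close> and by \<open>- 1 - n\<close> are paired:
    \<open>x \<mapsto> 1 - x\<close> exchanges them, and the first \<open>n\<close> pairs together
    cover exactly \<open>{- n..n}\<close>.\<close>
  define u where "u n x = G (x + real n) + G (x - 1 - real n)" for n x
  define v where "v n x = exp (- pi * (real (Suc n))\<^sup>2 / t) * cos (2 * pi * real (Suc n) * x)" for n x
  define F where "F x = (\<Sum>n. u n x)" for x
  define S where "S x = (1 + 2 * (\<Sum>n. v n x)) / sqrt t" for x
  have G_even: "G (- y) = G y" for y by (simp add: G_def)
  have G_cont: "continuous_on A G" for A
    unfolding G_def by (intro continuous_intros)
  have u_cont: "continuous_on A (u n)" for A n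
    unfolding u_def G_def by (intro continuous_intros)
  have v_cont: "continuous_on A (v n)" for A n
    unfolding v_def by (intro continuous_intros)
  define M where "M n = 2 * exp (- pi * t * (real n)\<^sup>2)" for n
  define M' where "M' n = exp (- pi * (1 / t) * (real (Suc n))\<^sup>2)" for n
  have M: "summable M" unfolding M_def using summable_gaussian[OF t] by (intro summable_mult)
  have "summable (\<lambda>n. exp (- pi * (1 / t) * (real n)\<^sup>2))" using t by (intro summable_gaussian) simp
  then have M': "summable M'" unfolding M'_def by (subst summable_Suc_iff)
  \<comment> \<open>For \<open>x\<close> in the unit interval both arguments have absolute value at
    least \<open>n\<close>.\<close>
  have uM: "\<bar>u n x\<bar> \<le> M n" if "x \<in> {0..1}" for n x
  proof -
    have "G y \<le> exp (- pi * t * (real n)\<^sup>2)" if "\<bar>y\<bar> \<ge> real n" for y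
      using that t unfolding G_def by (simp add: abs_le_square_iff[symmetric])
    from this[of "x + real n"] this[of "x - 1 - real n"] \<open>x \<in> {0..1}\<close>
    have "G (x + real n) + G (x - 1 - real n) \<le> 2 * exp (- pi * t * (real n)\<^sup>2)" by auto
    moreover have "G y \<ge> 0" for y by (simp add: G_def)
    ultimately show ?thesis by (simp add: u_def M_def)
  qed
  have vM: "\<bar>v n x\<bar> \<le> M' n" for n x
    unfolding v_def M'_def by (auto simp: abs_mult intro!: mult_left_le)
  have F_cont: "continuous_on {0..1} F"
    unfolding F_def by (rule continuous_sums_integral_M_test(1)[OF u_cont uM M])
  have S_cont: "continuous_on {0..1} S"
    unfolding S_def using t
    by (intro continuous_intros continuous_sums_integral_M_test(1)[OF v_cont vM M']) auto
  have F_sym: "F (1 - x) = F x" for x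
  proof -
    have "G (1 - x + real n) = G (x - 1 - real n)" "G (1 - x - 1 - real n) = G (x + real n)" for n
      using G_even[of "x - 1 - real n"] G_even[of "x + real n"] by (simp_all add: algebra_simps)
    then show ?thesis by (simp add: F_def u_def add.commute)
  qed
  have S_sym: "S (1 - x) = S x" for x
  proof -
    have "cos (2 * pi * real (Suc n) * (1 - x)) = cos (2 * pi * real (Suc n) * x)" for n
      using cos_int_2pin[of "int (Suc n)"] sin_int_2pin[of "int (Suc n)"]
      by (simp add: right_diff_distrib cos_diff del: cos_int_2pin sin_int_2pin of_nat_Suc)
    then show ?thesis by (simp add: S_def v_def)
  qed
  have F_coeff: "integral {0..1} (\<lambda>x. F x * cos (2 * pi * real m * x)) = exp (- pi * (real m)\<^sup>2 / t) / sqrt t"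
    for m :: nat
  proof -
    let ?c = "\<lambda>x. cos (2 * pi * real m * x)"
    have "(\<lambda>n. integral {0..1} (\<lambda>x. u n x * ?c x)) sums integral {0..1} (\<lambda>x. \<Sum>n. u n x * ?c x)"
    proof (rule continuous_sums_integral_M_test(2)[OF _ _ M])
      show "continuous_on {0..1} (\<lambda>x. u n x * ?c x)" for n by (intro continuous_intros u_cont)
      show "\<bar>u n x * ?c x\<bar> \<le> M n" if "x \<in> {0..1}" for n x
      proof -
        have "\<bar>u n x * ?c x\<bar> \<le> \<bar>u n x\<bar>" by (auto simp: abs_mult intro!: mult_left_le)
        then show ?thesis using uM[OF that] by (rule order.trans)
      qed
    qed
    moreover have "(\<Sum>n. u n x * ?c x) = F x * ?c x" if "x \<in> {0..1}" for x
    proof -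
      have "summable (\<lambda>n. u n x)"
        using uM[OF that] by (intro summable_comparison_test'[OF M, of 0]) auto
      then show ?thesis unfolding F_def by (rule suminf_mult2[symmetric])
    qed
    ultimately have *: "(\<lambda>n. integral {0..1} (\<lambda>x. u n x * ?c x)) sums integral {0..1} (\<lambda>x. F x * ?c x)"
      using integral_cong[of "{0..1}" "\<lambda>x. \<Sum>n. u n x * ?c x" "\<lambda>x. F x * ?c x"] by simp
    let ?h = "\<lambda>x. G x * ?c x"
    have h_int: "?h integrable_on {a..b}" for a b
      by (intro integrable_continuous_real continuous_intros G_cont)
    have cos_shift: "?c (x + of_int j) = ?c x" for x j
    proof -
      have "?c (x + of_int j) = cos (2 * pi * real m * x + 2 * pi * of_int (int m * j))"
        by (simp add: distrib_left mult_ac)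
      also have "\<dots> = ?c x"
        using cos_int_2pin[of "int m * j"] sin_int_2pin[of "int m * j"]
        by (simp add: cos_add del: cos_int_2pin sin_int_2pin of_int_mult)
      finally show ?thesis .
    qed
    have shift: "integral {of_int j..of_int j + 1} ?h = integral {0..1} (\<lambda>x. G (x + of_int j) * ?c x)" for j
      using integral_shift_real_ivl[of "of_int j" "of_int j" "of_int j + 1" ?h] cos_shift by simp
    \<comment> \<open>The cosine has period 1, so each further pair adds one unit interval at either
      end.\<close>
    have "(\<Sum>i<n. integral {0..1} (\<lambda>x. u i x * ?c x)) = integral {- real n..real n} ?h" for n
    proof (induction n)
      case (Suc n)
      have "integral {0..1} (\<lambda>x. u n x * ?c x)
          = integral {0..1} (\<lambda>x. G (x + of_int (int n)) * ?c x)
            + integral {0..1} (\<lambda>x. G (x + of_int (- 1 - int n)) * ?c x)"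
        unfolding u_def distrib_right
        by (subst integral_add)
          (auto intro!: integrable_continuous_real continuous_intros continuous_on_compose2[OF G_cont]
             simp: algebra_simps)
      also have "\<dots> = integral {real n..real n + 1} ?h + integral {- 1 - real n..- real n} ?h"
        using shift[of "int n"] shift[of "- 1 - int n"] by simp
      finally have "(\<Sum>i<Suc n. integral {0..1} (\<lambda>x. u i x * ?c x))
         = integral {- 1 - real n..- real n} ?h + integral {- real n..real n} ?h + integral {real n..real n + 1} ?h"
        using Suc by simp
      also have "integral {- 1 - real n..- real n} ?h + integral {- real n..real n} ?h = integral {- 1 - real n..real n} ?h"
        by (rule Henstock_Kurzweil_Integration.integral_combine) (auto simp: h_int)
      also have "integral {- 1 - real n..real n} ?h + integral {real n..real n + 1} ?h = integral {- 1 - real n..real n + 1} ?h"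
        by (rule Henstock_Kurzweil_Integration.integral_combine) (auto simp: h_int)
      finally show ?case by (simp add: add.commute)
    qed simp
    with * have "(\<lambda>n. integral {- real n..real n} ?h) \<longlonglongrightarrow> integral {0..1} (\<lambda>x. F x * ?c x)"
      by (simp add: sums_def)
    moreover have "(\<lambda>n. integral {- real n..real n} ?h) \<longlonglongrightarrow> exp (- pi * (real m)\<^sup>2 / t) / sqrt t"
      unfolding G_def by (rule integral_gaussian_cosine_symmetric_limit[OF t])
    ultimately show ?thesis by (rule LIMSEQ_unique)
  qed
  have S_coeff: "integral {0..1} (\<lambda>x. S x * cos (2 * pi * real m * x)) = exp (- pi * (real m)\<^sup>2 / t) / sqrt t"
    for m :: nat
  proof -
    let ?c = "\<lambda>x. cos (2 * pi * real m * x)"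
    have le: "\<bar>v n x * ?c x\<bar> \<le> M' n" for n x
    proof -
      have "\<bar>v n x * ?c x\<bar> \<le> \<bar>v n x\<bar>" by (auto simp: abs_mult intro!: mult_left_le)
      then show ?thesis using vM by (rule order.trans)
    qed
    have vc_cont: "continuous_on A (\<lambda>x. v n x * ?c x)" for A n by (intro continuous_intros v_cont)
    note * = continuous_sums_integral_M_test[OF vc_cont le M', of 0 1]
    \<comment> \<open>\<open>v n\<close> has frequency \<open>Suc n\<close>, so only
      \<open>n = m - 1\<close> contributes; for \<open>m = 0\<close> none does, and the coefficient
      comes from the constant 1 in \<open>S\<close>.\<close>
    have v_eq: "integral {0..1} (\<lambda>x. v n x * ?c x)
        = (if n = m - 1 \<and> m > 0 then exp (- pi * (real m)\<^sup>2 / t) / 2 else 0)" for n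
      using integral_cos_cos_unit_interval[of "Suc n" m]
      by (auto simp: v_def mult.assoc simp del: of_nat_Suc split: if_splits)
    have "(\<lambda>n. integral {0..1} (\<lambda>x. v n x * ?c x)) sums (if m > 0 then exp (- pi * (real m)\<^sup>2 / t) / 2 else 0)"
      unfolding v_eq
      using sums_If_finite[of "\<lambda>n. n = m - 1 \<and> m > 0" "\<lambda>_. exp (- pi * (real m)\<^sup>2 / t) / 2"]
      by (cases "m = 0") auto
    with *(2) have int_v: "integral {0..1} (\<lambda>x. \<Sum>n. v n x * ?c x)
        = (if m > 0 then exp (- pi * (real m)\<^sup>2 / t) / 2 else 0)"
      by (rule sums_unique2)
    have "summable (\<lambda>n. v n x)" for x
      using vM by (intro summable_comparison_test'[OF M', of 0]) auto
    then have suminf_vc: "(\<Sum>n. v n x * ?c x) = (\<Sum>n. v n x) * ?c x" for x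
      by (rule suminf_mult2[symmetric])
    have "S x * ?c x = (1 / sqrt t) * (?c x + 2 * (\<Sum>n. v n x * ?c x))" for x
      unfolding S_def suminf_vc by (simp add: distrib_right)
    then have "integral {0..1} (\<lambda>x. S x * ?c x)
        = (1 / sqrt t) * (integral {0..1} ?c + 2 * integral {0..1} (\<lambda>x. \<Sum>n. v n x * ?c x))"
      by (simp only: integral_mult_right, subst integral_add)
        (auto intro!: integrable_continuous_real continuous_intros *(1))
    also have "\<dots> = exp (- pi * (real m)\<^sup>2 / t) / sqrt t"
      using integral_cos_unit_interval[of "int m"] int_v by (simp split: if_splits)
    finally show ?thesis .
  qed
  have "F x - S x = 0"
  proof (rule cosine_coefficients_zero_imp_zero[OF _ _ _ x])
    show "continuous_on {0..1} (\<lambda>x. F x - S x)" by (intro continuous_intros F_cont S_cont)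
    show "F (1 - x) - S (1 - x) = F x - S x" for x by (simp add: F_sym S_sym)
    fix n :: int
    have "cos (2 * pi * of_int n * x) = cos (2 * pi * real (nat \<bar>n\<bar>) * x)" for x
      by (cases "n \<ge> 0") auto
    then show "integral {0..1} (\<lambda>x. (F x - S x) * cos (2 * pi * of_int n * x)) = 0"
      using F_coeff[of "nat \<bar>n\<bar>"] S_coeff[of "nat \<bar>n\<bar>"]
      by (simp only: left_diff_distrib, subst integral_diff)
        (auto intro!: integrable_continuous_real continuous_intros F_cont S_cont)
  qed
  then show ?thesis by (simp add: F_def S_def u_def v_def G_def)
qed

section \<open>The theta function\<close>

lemma summable_power_square:
  fixes w :: "'a :: {real_normed_div_algebra}"
  assumes "norm w < 1"
  shows "summable (\<lambda>n. norm (w ^ (n\<^sup>2)))"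
proof (rule summable_comparison_test)
  have "norm w ^ n\<^sup>2 \<le> norm w ^ n" for n
    using assms by (intro power_decreasing) (auto simp: power2_eq_square)
  then show "\<exists>N. \<forall>n\<ge>N. norm (norm (w ^ n\<^sup>2)) \<le> norm w ^ n" by (simp add: norm_power)
  show "summable (\<lambda>n. norm w ^ n)" using assms by (intro summable_geometric) auto
qed

lemma phi_has_sum:
  assumes "z \<in> upper_half_plane"
  shows "((\<lambda>n::int. nome z ^ nat (n\<^sup>2)) has_sum phi z) UNIV"
    and "phi z = 1 + 2 * (\<Sum>n. nome z ^ (Suc n)\<^sup>2)"
proof -
  have [simp]: "nat ((int m)\<^sup>2) = m\<^sup>2" for m
    by (simp add: nat_power_eq)
  have "summable (\<lambda>n. norm (nome z ^ nat ((int n)\<^sup>2)))"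
    using summable_power_square[OF norm_nome_less_one[OF assms]] by simp
  from has_sum_int_even[OF this]
  have *: "((\<lambda>n::int. nome z ^ nat (n\<^sup>2)) has_sum (1 + 2 *\<^sub>R (\<Sum>n. nome z ^ nat ((int (Suc n))\<^sup>2)))) UNIV"
    by simp
  then have "phi z = 1 + 2 *\<^sub>R (\<Sum>n. nome z ^ nat ((int (Suc n))\<^sup>2))"
    unfolding phi_def by (rule infsumI)
  with * show "((\<lambda>n::int. nome z ^ nat (n\<^sup>2)) has_sum phi z) UNIV"
    "phi z = 1 + 2 * (\<Sum>n. nome z ^ (Suc n)\<^sup>2)"
    by (simp_all add: scaleR_conv_of_real del: of_nat_Suc)
qed

definition phi_coeff :: "nat \<Rightarrow> complex" where
  "phi_coeff m = (if m = 0 then 1 else if is_square m then 2 else 0)"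

text \<open>Here all exponents occur, as the general facts about series in \<open>nome\<close>
  require; the sum over the squares is a strictly increasing reindexing of it.\<close>

lemma phi_sums:
  assumes "z \<in> upper_half_plane"
  shows "(\<lambda>m. phi_coeff m * nome z ^ m) sums phi z"
proof -
  let ?c = "\<lambda>m. if m > 0 \<and> is_square m then nome z ^ m else 0"
  have "summable (\<lambda>n. norm (nome z ^ (Suc n)\<^sup>2))"
    using summable_power_square[OF norm_nome_less_one[OF assms]] by (subst summable_Suc_iff)
  then have "(\<lambda>n. nome z ^ (Suc n)\<^sup>2) sums (\<Sum>n. nome z ^ (Suc n)\<^sup>2)"
    by (rule summable_sums[OF summable_norm_cancel])
  then have "(\<lambda>n. ?c ((Suc n)\<^sup>2)) sums (\<Sum>n. nome z ^ (Suc n)\<^sup>2)"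
    by (simp del: of_nat_Suc)
  moreover have "strict_mono (\<lambda>n. (Suc n)\<^sup>2)"
    by (auto simp: strict_mono_def power_strict_mono)
  moreover have "?c m = 0" if "m \<notin> range (\<lambda>n. (Suc n)\<^sup>2)" for m
  proof -
    have "\<not> (m > 0 \<and> is_square m)"
    proof
      assume "m > 0 \<and> is_square m"
      then obtain k where "m = k\<^sup>2" "k > 0" by (auto elim!: is_nth_powerE)
      then have "m = (Suc (k - 1))\<^sup>2" by simp
      with that show False by blast
    qed
    then show ?thesis by simp
  qed
  ultimately have "?c sums (\<Sum>n. nome z ^ (Suc n)\<^sup>2)"
    using sums_mono_reindex[of "\<lambda>n. (Suc n)\<^sup>2" ?c] by blast
  then have "(\<lambda>m. 2 * ?c m) sums (2 * (\<Sum>n. nome z ^ (Suc n)\<^sup>2))"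
    by (rule sums_mult)
  from sums_add[OF sums_single[of 0 "\<lambda>_. 1"] this]
  have "(\<lambda>m. (if m = 0 then 1 else 0) + 2 * ?c m) sums phi z"
    by (simp add: phi_has_sum(2)[OF assms] del: power_Suc)
  moreover have "(if m = 0 then 1 else 0) + 2 * ?c m = phi_coeff m * nome z ^ m" for m
    by (auto simp: phi_coeff_def)
  ultimately show ?thesis by simp
qed

lemma phi_holomorphic: "phi holomorphic_on upper_half_plane"
  using nome_series_holomorphic phi_sums by blast

lemma phi_tendsto_1: "(phi \<longlongrightarrow> 1) at_i_infinity"
  using nome_series_tendsto[OF phi_sums] by (simp add: phi_coeff_def)

lemma phi_plus_1: "phi (z + 1) = phi z"
proof -
  have "nome (z + 1) = nome z" by (simp add: distrib_left exp_add)
  then show ?thesis by (simp add: phi_def)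
qed

lemma nome_plus_half: "nome (z + 1/2) = - nome z"
proof -
  have "2 * of_real pi * \<i> * (z + 1/2) = 2 * of_real pi * \<i> * z + of_real pi * \<i>"
    by (simp add: algebra_simps)
  then show ?thesis by (simp add: exp_add)
qed

text \<open>Only the even squares survive in \<open>phi z + phi (z + 1/2)\<close>.\<close>

lemma phi_plus_half:
  assumes "z \<in> upper_half_plane"
  shows "phi (z + 1/2) = 2 * phi (4 * z) - phi z"
proof -
  have z: "z + 1/2 \<in> upper_half_plane" "4 * z \<in> upper_half_plane"
    using assms by (auto simp: upper_half_plane_def)
  let ?q = "nome z"
  have q4: "nome (4 * z) = ?q ^ 4"
    using nome_of_nat_mult[of 4 z] by simp
  have "((\<lambda>n::int. (nome z ^ nat (n\<^sup>2) + nome (z + 1/2) ^ nat (n\<^sup>2)) / 2) has_sum ((phi z + phi (z + 1/2)) / 2)) UNIV"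
    by (intro has_sum_divide_const has_sum_add phi_has_sum assms z)
  moreover have "((\<lambda>n::int. (nome z ^ nat (n\<^sup>2) + nome (z + 1/2) ^ nat (n\<^sup>2)) / 2) has_sum S) UNIV
     \<longleftrightarrow> ((\<lambda>n::int. nome (4 * z) ^ nat (n\<^sup>2)) has_sum S) UNIV" for S
  proof -
    have *: "(nome z ^ nat (n\<^sup>2) + nome (z + 1/2) ^ nat (n\<^sup>2)) / 2
        = (if even n then nome z ^ nat (n\<^sup>2) else 0)" for n :: int
      unfolding nome_plus_half by (auto simp: power_minus' even_nat_iff)
    have "((\<lambda>n::int. (nome z ^ nat (n\<^sup>2) + nome (z + 1/2) ^ nat (n\<^sup>2)) / 2) has_sum S) UNIV
      \<longleftrightarrow> ((\<lambda>n::int. nome z ^ nat (n\<^sup>2)) has_sum S) {n. even n}"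
      unfolding * by (rule has_sum_cong_neutral) auto
    also have "\<dots> \<longleftrightarrow> ((\<lambda>n::int. nome (4 * z) ^ nat (n\<^sup>2)) has_sum S) UNIV"
    proof (rule has_sum_reindex_bij_witness[of _ "\<lambda>n. 2 * n" "\<lambda>n. n div 2"])
      fix a :: int assume "a \<in> {n. even n}"
      then obtain b where "a = 2 * b" by (auto elim: evenE)
      then show "nome (4 * z) ^ nat ((a div 2)\<^sup>2) = nome z ^ nat (a\<^sup>2)"
        unfolding q4 by (simp add: power_mult_distrib nat_mult_distrib power_mult)
    qed auto
    finally show ?thesis .
  qed
  ultimately have "((\<lambda>n::int. nome (4 * z) ^ nat (n\<^sup>2)) has_sum ((phi z + phi (z + 1/2)) / 2)) UNIV"
    by blast
  with phi_has_sum(1)[OF z(2)] have "phi (4 * z) = (phi z + phi (z + 1/2)) / 2"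
    using has_sum_unique by blast
  then show ?thesis by (simp add: field_simps)
qed

text \<open>Poisson summation at \<open>x = 0\<close>. The nome of \<open>\<i> * s / 2\<close> is
  \<open>exp (- pi * s)\<close>, and the two sides belong to \<open>s = 1 / t\<close> and
  \<open>s = t\<close>.\<close>

lemma phi_transform_imaginary_axis:
  assumes "t > 0"
  shows "phi (\<i> / of_real (2 * t)) = of_real (sqrt t) * phi (\<i> * of_real (t / 2))"
proof -
  have q: "nome (\<i> * of_real y) ^ m = of_real (exp (- (2 * pi * y) * real m))" for y m
  proof -
    have "nome (\<i> * of_real y) = of_real (exp (- (2 * pi * y)))"
      by (simp add: exp_of_real[symmetric] mult_ac)
    then show ?thesis by (simp only: mult.commute[of _ "real m"] exp_of_nat_mult of_real_power)
  qed
  have phi: "phi (\<i> * of_real (s / 2)) = of_real (1 + 2 * (\<Sum>n. exp (- pi * s * (real (Suc n))\<^sup>2)))"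
    if "s > 0" for s
  proof -
    have s: "summable (\<lambda>n. exp (- pi * s * (real (Suc n))\<^sup>2))"
      using summable_gaussian[OF that] by (subst summable_Suc_iff)
    have "phi (\<i> * of_real (s / 2)) = 1 + 2 * (\<Sum>n. nome (\<i> * of_real (s / 2)) ^ (Suc n)\<^sup>2)"
      using that by (intro phi_has_sum) (simp add: upper_half_plane_def)
    also have "(\<Sum>n. nome (\<i> * of_real (s / 2)) ^ (Suc n)\<^sup>2)
        = (\<Sum>n. of_real (exp (- pi * s * (real (Suc n))\<^sup>2)))"
      unfolding q by (simp add: mult_ac del: of_nat_Suc)
    also have "\<dots> = of_real (\<Sum>n. exp (- pi * s * (real (Suc n))\<^sup>2))"
      by (rule suminf_of_real[OF s, symmetric])
    finally show ?thesis by simp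
  qed
  define e where "e n = exp (- pi * t * (real n)\<^sup>2)" for n
  have e: "summable e" using summable_gaussian[OF assms] by (simp add: e_def[abs_def])
  \<comment> \<open>At \<open>x = 0\<close> the paired translates are \<open>n\<close> and
    \<open>- 1 - n\<close>, so summing the pairs counts 0 once and every positive index
    twice.\<close>
  have "(\<Sum>n. e n + e (Suc n))
     = (1 + 2 * (\<Sum>n. exp (- pi * (1 / t) * (real (Suc n))\<^sup>2))) / sqrt t"
  proof -
    have "(0 - 1 - real n)\<^sup>2 = (real (Suc n))\<^sup>2" for n
      by (simp add: power2_eq_square algebra_simps)
    then show ?thesis
      using gaussian_poisson_summation[OF assms, of 0] by (simp add: e_def del: of_nat_Suc)
  qed
  moreover have "(\<Sum>n. e n + e (Suc n)) = 1 + 2 * (\<Sum>n. e (Suc n))"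
  proof -
    have "summable (\<lambda>n. e (Suc n))" using e by (subst summable_Suc_iff)
    with e have "(\<Sum>n. e n + e (Suc n)) = suminf e + (\<Sum>n. e (Suc n))"
      by (intro suminf_add[symmetric])
    moreover have "e 0 = 1" by (simp add: e_def)
    ultimately show ?thesis using suminf_split_head[OF e] by simp
  qed
  ultimately have *: "1 + 2 * (\<Sum>n. exp (- pi * (1 / t) * (real (Suc n))\<^sup>2)) = sqrt t * (1 + 2 * (\<Sum>n. e (Suc n)))"
    using assms by (simp only: eq_divide_eq) (simp add: mult.commute)
  have "\<i> / of_real (2 * t) = \<i> * of_real ((1 / t) / 2)" by simp
  also have "phi \<dots> = of_real (1 + 2 * (\<Sum>n. exp (- pi * (1 / t) * (real (Suc n))\<^sup>2)))"
    using assms by (intro phi) simp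
  also have "\<dots> = of_real (sqrt t) * phi (\<i> * of_real (t / 2))"
    unfolding * phi[OF assms] e_def by (rule of_real_mult)
  finally show ?thesis .
qed

lemma upper_half_plane_minus_inverse:
  "z \<in> upper_half_plane \<Longrightarrow> - 1 / z \<in> upper_half_plane"
proof -
  assume "z \<in> upper_half_plane"
  then have "Im z > 0" by (simp add: upper_half_plane_def)
  then have "(Re z)\<^sup>2 + (Im z)\<^sup>2 > 0" by (simp add: sum_power2_gt_zero_iff)
  then have "Im z / ((Re z)\<^sup>2 + (Im z)\<^sup>2) > 0" using \<open>Im z > 0\<close> by simp
  then show ?thesis by (simp add: upper_half_plane_def Im_divide)
qed

text \<open>Both sides are holomorphic and agree on the imaginary axis, so the identity theorem
  applies. \<open>csqrt\<close> is holomorphic here because \<open>- 2 * \<i> * z\<close> has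
  positive real part on the half plane.\<close>

lemma phi_transform:
  assumes "z \<in> upper_half_plane"
  shows "phi (- 1 / (4 * z)) = csqrt (- 2 * \<i> * z) * phi z"
proof -
  define D where "D z = phi (- 1 / (4 * z)) - csqrt (- 2 * \<i> * z) * phi z" for z
  have "D holomorphic_on upper_half_plane"
  proof -
    have "(\<lambda>z. - 1 / (4 * z)) holomorphic_on upper_half_plane"
      by (intro holomorphic_intros) (auto simp: upper_half_plane_def)
    moreover have "(\<lambda>z. - 1 / (4 * z)) ` upper_half_plane \<subseteq> upper_half_plane"
    proof safe
      fix z assume "z \<in> upper_half_plane"
      then have "4 * z \<in> upper_half_plane" by (simp add: upper_half_plane_def)
      then show "- 1 / (4 * z) \<in> upper_half_plane" by (rule upper_half_plane_minus_inverse)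
    qed
    ultimately have "(phi \<circ> (\<lambda>z. - 1 / (4 * z))) holomorphic_on upper_half_plane"
      by (rule holomorphic_on_compose_gen[OF _ phi_holomorphic])
    moreover have "(\<lambda>z. csqrt (- 2 * \<i> * z)) holomorphic_on upper_half_plane"
      by (intro holomorphic_intros) (auto simp: upper_half_plane_def complex_nonpos_Reals_iff)
    ultimately show ?thesis
      unfolding D_def comp_def by (intro holomorphic_on_diff holomorphic_on_mult phi_holomorphic)
  qed
  then have "D z = 0"
  proof (rule analytic_continuation[where \<xi> = \<i> and U = "(\<lambda>t. \<i> * of_real t) ` {0<..}"])
    show "\<i> islimpt (\<lambda>t. \<i> * complex_of_real t) ` {0<..}"
      unfolding islimpt_approachable
    proof safe
      fix e :: real assume "e > 0"
      then have "\<i> * of_real (1 + e / 2) \<in> (\<lambda>t. \<i> * complex_of_real t) ` {0<..}" by (intro imageI) auto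
      moreover have "dist (\<i> * complex_of_real (1 + e / 2)) \<i> < e" "\<i> * complex_of_real (1 + e / 2) \<noteq> \<i>"
        using \<open>e > 0\<close> by (auto simp: dist_norm algebra_simps norm_mult complex_eq_iff)
      ultimately show "\<exists>x'\<in>(\<lambda>t. \<i> * complex_of_real t) ` {0<..}. x' \<noteq> \<i> \<and> dist x' \<i> < e" by blast
    qed
    fix w assume "w \<in> (\<lambda>t. \<i> * complex_of_real t) ` {0<..}"
    then obtain t where t: "w = \<i> * of_real t" "t > 0" by auto
    have "- 1 / (4 * w) = \<i> / of_real (2 * (2 * t))"
      using t by (simp add: field_simps)
    moreover have "csqrt (- 2 * \<i> * w) = of_real (sqrt (2 * t))"
      using t of_real_sqrt[of "2 * t"] by (simp add: algebra_simps)
    ultimately show "D w = 0"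
      using phi_transform_imaginary_axis[of "2 * t"] t by (simp add: D_def)
  qed (use assms open_upper_half_plane convex_connected[OF convex_upper_half_plane] in
      \<open>auto simp: upper_half_plane_def\<close>)
  then show ?thesis by (simp add: D_def)
qed

section \<open>Gauss's product identity\<close>

text \<open>The q-Pochhammer symbol \<open>(x; x)_m\<close>.\<close>

definition qprod :: "complex \<Rightarrow> nat \<Rightarrow> complex" where
  "qprod x m = (\<Prod>i<m. 1 - x ^ Suc i)"

lemma qprod_0 [simp]: "qprod x 0 = 1"
  and qprod_Suc: "qprod x (Suc m) = qprod x m * (1 - x ^ Suc m)"
  by (simp_all add: qprod_def)

text \<open>The Gaussian binomial coefficient with base \<open>x\<close>. The value 0 beyond the top
  index lets Pascal's rule hold for all indices.\<close>

definition qbinomial :: "complex \<Rightarrow> nat \<Rightarrow> nat \<Rightarrow> complex" where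
  "qbinomial x m a = (if a \<le> m then qprod x m / (qprod x a * qprod x (m - a)) else 0)"

context
  fixes x :: complex
  assumes x: "norm x < 1"
begin

lemma one_minus_power_nonzero: "1 - x ^ Suc m \<noteq> 0"
proof
  assume "1 - x ^ Suc m = 0"
  then have "norm x ^ Suc m = 1" by (metis eq_iff_diff_eq_0 norm_one norm_power)
  moreover have "norm x ^ Suc m < 1" using x power_decreasing[of 1 "Suc m" "norm x"] by simp
  ultimately show False by simp
qed

lemma qprod_nonzero: "qprod x m \<noteq> 0"
  unfolding qprod_def using one_minus_power_nonzero by simp

text \<open>With \<open>X = x ^ Suc a\<close> and \<open>Y = x ^ (m - a)\<close> the identity over
  the common denominator is \<open>1 - X * Y = (1 - Y) + Y * (1 - X)\<close>.\<close>

lemma qbinomial_pascal: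
  "qbinomial x (Suc m) (Suc a) = qbinomial x m (Suc a) + x ^ (m - a) * qbinomial x m a"
proof -
  consider "a > m" | "a = m" | "a < m" by linarith
  then show ?thesis
  proof cases
    case 3
    then obtain d where d: "m = Suc (a + d)" by (auto dest: less_imp_Suc_add)
    define X Y where "X = x ^ Suc a" and "Y = x ^ Suc d"
    have XY: "X * Y = x ^ Suc m" unfolding X_def Y_def d by (simp add: power_add)
    have nz: "1 - X \<noteq> 0" "1 - Y \<noteq> 0"
      unfolding X_def Y_def by (rule one_minus_power_nonzero)+
    have *: "m - a = Suc d" "m - Suc a = d" using d by simp_all
    have "qbinomial x (Suc m) (Suc a) = qprod x m * (1 - X * Y) / (qprod x a * (1 - X) * (qprod x d * (1 - Y)))"
      using 3 by (simp only: qbinomial_def qprod_Suc XY[symmetric] X_def[symmetric] Y_def[symmetric] diff_Suc_Suc *) simp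
    also have "\<dots> = qprod x m / (qprod x a * (1 - X) * qprod x d)
        + Y * (qprod x m / (qprod x a * (qprod x d * (1 - Y))))"
      using nz qprod_nonzero by (simp add: divide_simps) (simp add: algebra_simps)
    also have "\<dots> = qbinomial x m (Suc a) + x ^ (m - a) * qbinomial x m a"
      using 3 by (simp only: qbinomial_def qprod_Suc X_def[symmetric] Y_def[symmetric] *) simp
    finally show ?thesis .
  qed (auto simp: qbinomial_def qprod_nonzero)
qed

lemma qbinomial_0 [simp]: "qbinomial x m 0 = 1"
  by (simp add: qbinomial_def qprod_nonzero)

lemma qbinomial_eq_0 [simp]: "m < a \<Longrightarrow> qbinomial x m a = 0"
  by (simp add: qbinomial_def)

lemma qbinomial_symmetric: "a \<le> m \<Longrightarrow> qbinomial x m (m - a) = qbinomial x m a"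
  by (simp add: qbinomial_def mult.commute)

text \<open>Induction by Pascal's rule: the new factor moves index \<open>a\<close> to
  \<open>Suc a\<close>, and \<open>Suc a choose 2 = (a choose 2) + a\<close> supplies the power that
  completes \<open>x ^ (m - a)\<close> to \<open>x ^ m\<close>.\<close>

lemma qbinomial_theorem:
  "(\<Prod>k<m. 1 + y * x ^ k) = (\<Sum>a\<le>m. qbinomial x m a * x ^ (a choose 2) * y ^ a)"
proof (induction m)
  case (Suc m)
  let ?t = "\<lambda>m a. qbinomial x m a * x ^ (a choose 2) * y ^ a"
  have step: "?t (Suc m) (Suc a) = ?t m (Suc a) + ?t m a * (y * x ^ m)" if "a \<le> m" for a
  proof -
    have "Suc a choose 2 = (a choose 2) + a"
      by (simp add: numeral_2_eq_2)
    moreover have "x ^ (m - a) * x ^ a = x ^ m" using that by (simp flip: power_add)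
    ultimately show ?thesis
      unfolding qbinomial_pascal by (simp add: power_add algebra_simps)
  qed
  have "(\<Prod>k<Suc m. 1 + y * x ^ k) = (\<Sum>a\<le>m. ?t m a) + (\<Sum>a\<le>m. ?t m a * (y * x ^ m))"
    by (simp add: Suc distrib_left sum_distrib_right)
  also have "(\<Sum>a\<le>m. ?t m a) = (\<Sum>a\<le>Suc m. ?t m a)" by simp
  also have "\<dots> = 1 + (\<Sum>a\<le>m. ?t m (Suc a))"
    by (subst sum.atMost_Suc_shift) (simp add: numeral_2_eq_2)
  also have "\<dots> + (\<Sum>a\<le>m. ?t m a * (y * x ^ m)) = 1 + (\<Sum>a\<le>m. ?t m (Suc a) + ?t m a * (y * x ^ m))"
    by (simp add: sum.distrib add.assoc)
  also have "(\<Sum>a\<le>m. ?t m (Suc a) + ?t m a * (y * x ^ m)) = (\<Sum>a\<le>m. ?t (Suc m) (Suc a))"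
    by (rule sum.cong) (auto simp only: step atMost_iff)
  also have "1 + \<dots> = (\<Sum>a\<le>Suc m. ?t (Suc m) a)"
    by (subst sum.atMost_Suc_shift) (simp add: numeral_2_eq_2)
  finally show ?case .
qed (simp add: numeral_2_eq_2)

end

text \<open>The finite form of Gauss's identity: the \<open>q\<close>-binomial theorem for an even exponent \<open>2 * n\<close>,
  centred at the middle coefficient.\<close>

lemma finite_gauss_identity:
  assumes "norm q < 1"
  shows "(\<Prod>i<n. 1 - q ^ (2 * i + 1)) ^ 2
    = qbinomial (q\<^sup>2) (2 * n) n
      + 2 * (\<Sum>j<n. (- q) ^ (Suc j)\<^sup>2 * qbinomial (q\<^sup>2) (2 * n) (n + Suc j))"
\<comment> \<open>The argument \<open>y\<close> below contains an inverse power of \<open>q\<close>,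
  so \<open>q = 0\<close> is checked directly.\<close>
proof (cases "q = 0")
  case True
  have "qbinomial 0 m a = (if a \<le> m then 1 else 0)" for m a
    by (simp add: qbinomial_def qprod_def)
  then show ?thesis using True by (simp add: power_0_left)
next
  case False
  have x: "norm (q\<^sup>2) < 1"
    using assms by (simp add: norm_power power_less_one_iff abs_square_less_1)
  \<comment> \<open>With this \<open>y\<close> the factors \<open>1 + y * (q\<^sup>2) ^ k\<close>
    for \<open>k < 2 * n\<close> are \<open>1 - q ^ j\<close> for the odd \<open>j\<close> from
    \<open>1 - 2 * n\<close> to \<open>2 * n - 1\<close>. The exponents are symmetric about 0, so
    multiplying by \<open>q ^ n\<^sup>2\<close> gives the square of the product over the positive
    ones, up to sign.\<close>
  define y where "y = - q * inverse (q ^ (2 * n))"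
  let ?B = "qbinomial (q\<^sup>2) (2 * n)"
  \<comment> \<open>Completing the square: the exponents \<open>n * n\<close>, \<open>a * a\<close>
    and \<open>- 2 * n * a\<close> add up to the square of \<open>a - n\<close>.\<close>
  have summand: "q ^ n\<^sup>2 * ((q\<^sup>2) ^ (a choose 2) * y ^ a) = (- 1) ^ a * q ^ (nat ((int a - int n)\<^sup>2))"
    if "a \<le> 2 * n" for a
  proof -
    have "even (a * (a - 1))" by (cases a) auto
    then have "2 * (a choose 2) = a * (a - 1)" by (simp add: choose_two)
    then have "2 * (a choose 2) + a = a * a" by (cases a) auto
    then have "(q\<^sup>2) ^ (a choose 2) * q ^ a = q ^ (a * a)"
      by (simp flip: power_mult power_add)
    then have 1: "(q\<^sup>2) ^ (a choose 2) * y ^ a = (- 1) ^ a * (q ^ (a * a) * inverse (q ^ (2 * n * a)))"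
      unfolding y_def power_mult_distrib power_inverse power_mult[of q "2 * n" a]
      by (simp add: power_minus[of q] mult_ac)
    have "int (n\<^sup>2 + a * a) = (int a - int n)\<^sup>2 + int (2 * n * a)"
      by (simp add: power2_eq_square algebra_simps)
    then have "n\<^sup>2 + a * a = nat ((int a - int n)\<^sup>2) + 2 * n * a"
      by (metis (no_types, lifting) nat_int nat_int_add of_nat_0_le_iff nat_add_distrib zero_le_power2)
    then have "q ^ n\<^sup>2 * q ^ (a * a) = q ^ nat ((int a - int n)\<^sup>2) * q ^ (2 * n * a)"
      by (simp flip: power_add)
    then show ?thesis unfolding 1 using False by (simp add: field_simps)
  qed
  have "q ^ n\<^sup>2 * (\<Prod>k<2 * n. 1 + y * (q\<^sup>2) ^ k) = (\<Sum>a\<le>2 * n. ?B a * (q ^ n\<^sup>2 * ((q\<^sup>2) ^ (a choose 2) * y ^ a)))"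
    unfolding qbinomial_theorem[OF x] by (simp add: sum_distrib_left mult_ac)
  also have "\<dots> = (\<Sum>a\<le>2 * n. ?B a * ((- 1) ^ a * q ^ (nat ((int a - int n)\<^sup>2))))"
    by (rule sum.cong) (auto simp only: summand atMost_iff)
  \<comment> \<open>The index set is split into its middle and the two wings at distance
    \<open>Suc j\<close>; symmetry of the coefficients then identifies the wings.\<close>
  also have "{..2 * n} = {n} \<union> ((\<lambda>j. n + Suc j) ` {..<n} \<union> (\<lambda>j. n - Suc j) ` {..<n})"
  proof (intro equalityI subsetI)
    fix a assume "a \<in> {..2 * n}"
    then consider "a = n" | "a = n + Suc (a - n - 1)" "a - n - 1 < n" | "a = n - Suc (n - a - 1)" "n - a - 1 < n"
      by (cases a n rule: linorder_cases) auto
    then show "a \<in> {n} \<union> ((\<lambda>j. n + Suc j) ` {..<n} \<union> (\<lambda>j. n - Suc j) ` {..<n})"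
      by cases blast+
  qed auto
  also have "(\<Sum>a\<in>\<dots>. ?B a * ((- 1) ^ a * q ^ (nat ((int a - int n)\<^sup>2))))
      = ?B n * (- 1) ^ n + ((\<Sum>j<n. ?B (n + Suc j) * ((- 1) ^ (n + Suc j) * q ^ (Suc j)\<^sup>2))
        + (\<Sum>j<n. ?B (n - Suc j) * ((- 1) ^ (n - Suc j) * q ^ (Suc j)\<^sup>2)))"
  proof -
    have sq: "nat ((int (n + Suc j) - int n)\<^sup>2) = (Suc j)\<^sup>2" for j
      by (simp add: nat_power_eq nat_add_distrib)
    have sq': "nat ((int (n - Suc j) - int n)\<^sup>2) = (Suc j)\<^sup>2" if "j < n" for j
      using that power2_commute[of "int (n - Suc j)" "int n"] by (simp add: nat_power_eq of_nat_diff nat_add_distrib)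
    let ?T = "\<lambda>a. ?B a * ((- 1) ^ a * q ^ (nat ((int a - int n)\<^sup>2)))"
    have inj: "inj_on (\<lambda>j. n - Suc j) {..<n}" "inj_on (\<lambda>j. n + Suc j) {..<n}" by (auto simp: inj_on_def)
    have "sum ?T ({n} \<union> ((\<lambda>j. n + Suc j) ` {..<n} \<union> (\<lambda>j. n - Suc j) ` {..<n}))
        = ?T n + (sum ?T ((\<lambda>j. n + Suc j) ` {..<n}) + sum ?T ((\<lambda>j. n - Suc j) ` {..<n}))"
      by (subst sum.union_disjoint, simp, simp, force, subst sum.union_disjoint) auto
    also have "sum ?T ((\<lambda>j. n + Suc j) ` {..<n}) = (\<Sum>j<n. ?B (n + Suc j) * ((- 1) ^ (n + Suc j) * q ^ (Suc j)\<^sup>2))"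
      by (subst sum.reindex[OF inj(2)]) (simp only: comp_def sq)
    also have "sum ?T ((\<lambda>j. n - Suc j) ` {..<n}) = (\<Sum>j<n. ?B (n - Suc j) * ((- 1) ^ (n - Suc j) * q ^ (Suc j)\<^sup>2))"
      by (subst sum.reindex[OF inj(1)], rule sum.cong) (simp_all only: comp_def sq' lessThan_iff)
    finally show ?thesis by simp
  qed
  also have "(\<Sum>j<n. ?B (n - Suc j) * ((- 1) ^ (n - Suc j) * q ^ (Suc j)\<^sup>2))
      = (\<Sum>j<n. ?B (n + Suc j) * ((- 1) ^ (n + Suc j) * q ^ (Suc j)\<^sup>2))"
  proof (rule sum.cong)
    fix j assume "j \<in> {..<n}"
    then have "n - Suc j = 2 * n - (n + Suc j)" "n + Suc j \<le> 2 * n" by auto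
    then have "?B (n - Suc j) = ?B (n + Suc j)"
      using qbinomial_symmetric[OF x, of "n + Suc j" "2 * n"] by simp
    moreover have "(- 1 :: complex) ^ (n - Suc j) = (- 1) ^ (n + Suc j)"
      using \<open>j \<in> {..<n}\<close> by (auto simp: minus_one_power_iff)
    ultimately show "?B (n - Suc j) * ((- 1) ^ (n - Suc j) * q ^ (Suc j)\<^sup>2)
        = ?B (n + Suc j) * ((- 1) ^ (n + Suc j) * q ^ (Suc j)\<^sup>2)" by simp
  qed simp
  finally have sum_eq: "q ^ n\<^sup>2 * (\<Prod>k<2 * n. 1 + y * (q\<^sup>2) ^ k)
      = (- 1) ^ n * (?B n + 2 * (\<Sum>j<n. (- 1) ^ Suc j * q ^ (Suc j)\<^sup>2 * ?B (n + Suc j)))"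
    by (simp add: sum_distrib_left power_add algebra_simps)
  \<comment> \<open>Passing from \<open>m\<close> to \<open>Suc m\<close> adds the factors with
    exponents \<open>2 * m + 1\<close> and \<open>- (2 * m + 1)\<close>; since
    \<open>(Suc m)\<^sup>2 = m\<^sup>2 + 2 * m + 1\<close>, the extra power of \<open>q\<close>
    turns the second into minus the first.\<close>
  have "q ^ m\<^sup>2 * (\<Prod>k<2 * m. 1 - q * inverse (q ^ (2 * m)) * (q\<^sup>2) ^ k) = (- 1) ^ m * (\<Prod>i<m. 1 - q ^ (2 * i + 1)) ^ 2" for m
  proof (induction m)
    case (Suc m)
    have *: "q * inverse (q ^ (2 * Suc m)) * (q\<^sup>2) ^ Suc k = q * inverse (q ^ (2 * m)) * (q\<^sup>2) ^ k" for k
      using False by (simp add: field_simps power2_eq_square)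
    have "(\<Prod>k<2 * Suc m. 1 - q * inverse (q ^ (2 * Suc m)) * (q\<^sup>2) ^ k)
        = (1 - q * inverse (q ^ (2 * Suc m))) * (\<Prod>k<Suc (2 * m). 1 - q * inverse (q ^ (2 * m)) * (q\<^sup>2) ^ k)"
    proof -
      let ?f = "\<lambda>k. 1 - q * inverse (q ^ (2 * Suc m)) * (q\<^sup>2) ^ k"
      have "prod ?f {..<2 * Suc m} = prod ?f {..<Suc (Suc (2 * m))}" by simp
      also have "\<dots> = ?f 0 * (\<Prod>k<Suc (2 * m). ?f (Suc k))" by (rule prod.lessThan_Suc_shift)
      finally show ?thesis by (simp only: * power_0 mult_1_right)
    qed
    also have "\<dots> = (1 - q * inverse (q ^ (2 * Suc m))) * (\<Prod>k<2 * m. 1 - q * inverse (q ^ (2 * m)) * (q\<^sup>2) ^ k) * (1 - q ^ (2 * m + 1))"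
    proof -
      have "(q\<^sup>2) ^ (2 * m) = q ^ (2 * m) * q ^ (2 * m)" by (simp flip: power_mult power_add)
      then have "q * inverse (q ^ (2 * m)) * (q\<^sup>2) ^ (2 * m) = q ^ (2 * m + 1)" using False by simp
      then show ?thesis by (simp only: prod.lessThan_Suc mult.assoc)
    qed
    finally have prod_eq: "(\<Prod>k<2 * Suc m. 1 - q * inverse (q ^ (2 * Suc m)) * (q\<^sup>2) ^ k) = \<dots>" .
    have "(Suc m)\<^sup>2 = (2 * m + 1) + m\<^sup>2" by (simp add: power2_eq_square)
    then have "q ^ (Suc m)\<^sup>2 = q ^ (2 * m + 1) * q ^ m\<^sup>2" by (simp only: power_add)
    then have "q ^ (Suc m)\<^sup>2 * (\<Prod>k<2 * Suc m. 1 - q * inverse (q ^ (2 * Suc m)) * (q\<^sup>2) ^ k)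
       = (q ^ (2 * m + 1) * (1 - q * inverse (q ^ (2 * Suc m)))) * (1 - q ^ (2 * m + 1)) *
         (q ^ m\<^sup>2 * (\<Prod>k<2 * m. 1 - q * inverse (q ^ (2 * m)) * (q\<^sup>2) ^ k))"
      unfolding prod_eq by (simp only: mult_ac)
    also have "q ^ (2 * m + 1) * (1 - q * inverse (q ^ (2 * Suc m))) = - (1 - q ^ (2 * m + 1))"
      using False by (simp add: field_simps)
    finally show ?case unfolding Suc by (simp add: power2_eq_square algebra_simps)
  qed simp
  from this[of n] sum_eq have "(\<Prod>i<n. 1 - q ^ (2 * i + 1)) ^ 2
     = ?B n + 2 * (\<Sum>j<n. (- 1) ^ Suc j * q ^ (Suc j)\<^sup>2 * ?B (n + Suc j))"
    by (simp add: y_def)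
  \<comment> \<open>A number and its square have the same parity.\<close>
  moreover have "(- q) ^ (Suc j)\<^sup>2 = (- 1) ^ Suc j * q ^ (Suc j)\<^sup>2" for j
    by (subst power_minus) (simp add: minus_one_power_iff)
  ultimately show ?thesis by simp
qed

section \<open>The limit of the finite identity\<close>

lemma convergent_prod_one_minus_power:
  fixes q :: complex
  assumes "norm q < 1"
  shows "convergent_prod (\<lambda>n. 1 - q ^ Suc n)"
proof -
  have "summable (\<lambda>n. norm q ^ n)" using assms by (intro summable_geometric) auto
  then have "summable (\<lambda>n. norm q * norm q ^ n)" by (rule summable_mult)
  then have "abs_convergent_prod (\<lambda>n. 1 - q ^ Suc n)"
    by (simp add: abs_convergent_prod_conv_summable norm_mult norm_power)
  then show ?thesis by (rule abs_convergent_prod_imp_convergent_prod)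
qed

lemma qprod_LIMSEQ:
  assumes "norm q < 1"
  shows "qprod q \<longlonglongrightarrow> (\<Prod>n. 1 - q ^ Suc n)" and "(\<Prod>n. 1 - q ^ Suc n) \<noteq> 0"
proof -
  have "(\<lambda>n. \<Prod>i\<le>n. 1 - q ^ Suc i) \<longlonglongrightarrow> (\<Prod>n. 1 - q ^ Suc n)"
    by (rule convergent_prod_LIMSEQ[OF convergent_prod_one_minus_power[OF assms]])
  then have "(\<lambda>n. qprod q (Suc n)) \<longlonglongrightarrow> (\<Prod>n. 1 - q ^ Suc n)"
    by (simp only: qprod_def lessThan_Suc_atMost)
  then show "qprod q \<longlonglongrightarrow> (\<Prod>n. 1 - q ^ Suc n)"
    by (rule LIMSEQ_imp_Suc)
  show "(\<Prod>n. 1 - q ^ Suc n) \<noteq> 0"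
    by (rule prodinf_nonzero[OF convergent_prod_one_minus_power[OF assms] one_minus_power_nonzero[OF assms]])
qed

text \<open>\<open>qprod x\<close> converges to a nonzero limit, so it and its inverse are bounded
  sequences. The bound is the dominating constant for the passage to the limit under the
  sum.\<close>

lemma qbinomial_bounded:
  assumes "norm x < 1"
  shows "\<exists>K. \<forall>m a. norm (qbinomial x m a) \<le> K"
proof -
  define P where "P = (\<Prod>n. 1 - x ^ Suc n)"
  have lim: "qprod x \<longlonglongrightarrow> P" and "P \<noteq> 0" using qprod_LIMSEQ[OF assms] by (simp_all add: P_def)
  from lim obtain U where U: "\<And>m. norm (qprod x m) \<le> U"
    using convergent_imp_Bseq[OF convergentI] by (metis BseqE)
  have "(\<lambda>m. inverse (qprod x m)) \<longlonglongrightarrow> inverse P"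
    using lim \<open>P \<noteq> 0\<close> by (rule tendsto_inverse)
  then obtain V where V: "\<And>m. norm (inverse (qprod x m)) \<le> V"
    using convergent_imp_Bseq[OF convergentI] by (metis BseqE)
  have "U \<ge> 0" "V \<ge> 0" using U[of 0] V[of 0] norm_ge_zero order.trans by blast+
  show ?thesis
  proof (intro exI[of _ "U * (V * V)"] allI)
    fix m a
    have "norm (qprod x m * (inverse (qprod x a) * inverse (qprod x (m - a)))) \<le> U * (V * V)"
      unfolding norm_mult using U V \<open>U \<ge> 0\<close> \<open>V \<ge> 0\<close> by (intro mult_mono) auto
    moreover have "U * (V * V) \<ge> 0" using \<open>U \<ge> 0\<close> \<open>V \<ge> 0\<close> by simp
    ultimately show "norm (qbinomial x m a) \<le> U * (V * V)"
      by (simp add: qbinomial_def divide_inverse)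
  qed
qed

text \<open>In the finite identity the coefficient at a fixed distance from the middle tends to
  \<open>1 / P\<close>, and Tannery's theorem allows the limit inside the sum. The product of the
  odd factors tends to \<open>A / P\<close>, so its square times \<open>P\<close> is the quotient on
  the left.\<close>

lemma gauss_identity:
  fixes q :: complex
  assumes q: "norm q < 1"
  shows "(\<Prod>n. 1 - q ^ Suc n) ^ 2 / (\<Prod>n. 1 - (q\<^sup>2) ^ Suc n) = 1 + 2 * (\<Sum>n. (- q) ^ (Suc n)\<^sup>2)"
proof -
  define A P where "A = (\<Prod>n. 1 - q ^ Suc n)" and "P = (\<Prod>n. 1 - (q\<^sup>2) ^ Suc n)"
  have x: "norm (q\<^sup>2) < 1"
    using q by (simp add: norm_power power_less_one_iff abs_square_less_1)
  have A: "qprod q \<longlonglongrightarrow> A" unfolding A_def by (rule qprod_LIMSEQ[OF q])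
  have P: "qprod (q\<^sup>2) \<longlonglongrightarrow> P" "P \<noteq> 0" unfolding P_def using qprod_LIMSEQ[OF x] by auto
  define B where "B n j = qbinomial (q\<^sup>2) (2 * n) (n + j)" for n j
  have B_lim: "(\<lambda>n. B n j) \<longlonglongrightarrow> 1 / P" for j
  proof -
    have l1: "(\<lambda>n. qprod (q\<^sup>2) (2 * n)) \<longlonglongrightarrow> P"
      by (rule LIMSEQ_subseq_LIMSEQ[OF P(1), unfolded comp_def]) (simp add: strict_mono_def)
    have l2: "(\<lambda>n. qprod (q\<^sup>2) (n + j)) \<longlonglongrightarrow> P"
      by (rule LIMSEQ_ignore_initial_segment[OF P(1)])
    have l3: "(\<lambda>n. qprod (q\<^sup>2) (n - j)) \<longlonglongrightarrow> P"
      by (rule filterlim_compose[OF P(1) filterlim_minus_const_nat_at_top])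
    have "(\<lambda>n. qprod (q\<^sup>2) (2 * n) / (qprod (q\<^sup>2) (n + j) * qprod (q\<^sup>2) (n - j))) \<longlonglongrightarrow> P / (P * P)"
      using P(2) by (intro tendsto_divide tendsto_mult l1 l2 l3) auto
    moreover have "\<forall>\<^sub>F n in sequentially. qprod (q\<^sup>2) (2 * n) / (qprod (q\<^sup>2) (n + j) * qprod (q\<^sup>2) (n - j)) = B n j"
      using eventually_ge_at_top[of j]
    proof eventually_elim
      case (elim n)
      then have "2 * n - (n + j) = n - j" "n + j \<le> 2 * n" by auto
      then show ?case by (simp add: B_def qbinomial_def)
    qed
    ultimately show ?thesis using P(2) by (simp add: Lim_transform_eventually)
  qed
  obtain K where K: "norm (qbinomial (q\<^sup>2) m a) \<le> K" for m a
    using qbinomial_bounded[OF x] by blast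
  have sq: "summable (\<lambda>j. norm ((- q) ^ (Suc j)\<^sup>2))"
    using summable_power_square[of "- q"] q summable_Suc_iff[of "\<lambda>j. norm ((- q) ^ j\<^sup>2)"] by simp
  have "(\<lambda>n. \<Sum>j. (- q) ^ (Suc j)\<^sup>2 * B n (Suc j)) \<longlonglongrightarrow> (\<Sum>j. (- q) ^ (Suc j)\<^sup>2 * (1 / P))"
  proof (rule tannerys_theorem[THEN conjunct2, THEN conjunct2])
    show "(\<lambda>n. (- q) ^ (Suc j)\<^sup>2 * B n (Suc j)) \<longlonglongrightarrow> (- q) ^ (Suc j)\<^sup>2 * (1 / P)" for j
      by (intro tendsto_mult tendsto_const B_lim)
    show "summable (\<lambda>j. norm ((- q) ^ (Suc j)\<^sup>2) * K)"
      using sq by (rule summable_mult2)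
    have "norm ((- q) ^ (Suc j)\<^sup>2 * B n (Suc j)) \<le> norm ((- q) ^ (Suc j)\<^sup>2) * K" for j n
      unfolding norm_mult B_def by (intro mult_left_mono K) auto
    then show "\<forall>\<^sub>F (j, n) in sequentially \<times>\<^sub>F sequentially. norm ((- q) ^ (Suc j)\<^sup>2 * B n (Suc j)) \<le> norm ((- q) ^ (Suc j)\<^sup>2) * K"
      by (intro always_eventually) (simp del: power_Suc)
  qed simp
  \<comment> \<open>The coefficients vanish for \<open>j \<ge> n\<close>, so the finite sum may be
    viewed as a series with index set independent of \<open>n\<close>, as Tannery's theorem
    demands.\<close>
  moreover have "(\<Sum>j. (- q) ^ (Suc j)\<^sup>2 * B n (Suc j)) = (\<Sum>j<n. (- q) ^ (Suc j)\<^sup>2 * B n (Suc j))" for n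
    by (rule suminf_finite) (auto simp: B_def qbinomial_def)
  moreover have "(\<Sum>j. (- q) ^ (Suc j)\<^sup>2 * (1 / P)) = (\<Sum>j. (- q) ^ (Suc j)\<^sup>2) * (1 / P)"
    by (rule suminf_mult2[OF summable_norm_cancel[OF sq], symmetric])
  ultimately have "(\<lambda>n. \<Sum>j<n. (- q) ^ (Suc j)\<^sup>2 * B n (Suc j)) \<longlonglongrightarrow> (\<Sum>j. (- q) ^ (Suc j)\<^sup>2) * (1 / P)"
    by simp
  then have "(\<lambda>n. B n 0 + 2 * (\<Sum>j<n. (- q) ^ (Suc j)\<^sup>2 * B n (Suc j)))
      \<longlonglongrightarrow> 1 / P + 2 * ((\<Sum>j. (- q) ^ (Suc j)\<^sup>2) * (1 / P))"
    by (intro tendsto_add tendsto_mult tendsto_const B_lim)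
  also have "(\<lambda>n. B n 0 + 2 * (\<Sum>j<n. (- q) ^ (Suc j)\<^sup>2 * B n (Suc j))) = (\<lambda>n. (\<Prod>i<n. 1 - q ^ (2 * i + 1)) ^ 2)"
    using finite_gauss_identity[OF q] by (simp add: B_def del: power_Suc)
  finally have lim: "(\<lambda>n. (\<Prod>i<n. 1 - q ^ (2 * i + 1)) ^ 2) \<longlonglongrightarrow> (1 + 2 * (\<Sum>j. (- q) ^ (Suc j)\<^sup>2)) / P"
    by (simp add: add_divide_distrib)
  have "(\<Prod>i<n. 1 - q ^ (2 * i + 1)) = qprod q (2 * n) / qprod (q\<^sup>2) n" for n
  proof -
    have "qprod q (2 * n) = (\<Prod>i<n. 1 - q ^ (2 * i + 1)) * qprod (q\<^sup>2) n"
    proof (induction n)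
      case (Suc n)
      have *: "qprod q (2 * Suc n) = qprod q (2 * n) * (1 - q ^ (2 * n + 1)) * (1 - (q\<^sup>2) ^ Suc n)"
      proof -
        have "(q\<^sup>2) ^ Suc n = q ^ (2 * Suc n)" by (rule power_mult[symmetric])
        also have "2 * Suc n = Suc (2 * n + 1)" by simp
        finally have "(q\<^sup>2) ^ Suc n = q ^ Suc (2 * n + 1)" .
        then show ?thesis by (simp only: qprod_Suc mult_Suc_right add_2_eq_Suc add_Suc_right add_0_right Suc_eq_plus1[symmetric])
      qed
      show ?case unfolding * Suc qprod_Suc[of "q\<^sup>2"] prod.lessThan_Suc by (simp only: mult_ac)
    qed simp
    then show ?thesis using qprod_nonzero[OF x] by simp
  qed
  moreover have "(\<lambda>n. (qprod q (2 * n) / qprod (q\<^sup>2) n) ^ 2) \<longlonglongrightarrow> (A / P) ^ 2"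
  proof (intro tendsto_power tendsto_divide P)
    show "(\<lambda>n. qprod q (2 * n)) \<longlonglongrightarrow> A"
      by (rule LIMSEQ_subseq_LIMSEQ[OF A, unfolded comp_def]) (simp add: strict_mono_def)
  qed
  ultimately have "(A / P) ^ 2 = (1 + 2 * (\<Sum>j. (- q) ^ (Suc j)\<^sup>2)) / P"
    using lim LIMSEQ_unique by simp
  moreover have "A ^ 2 / P = (A / P) ^ 2 * P"
    using P(2) by (simp add: power2_eq_square)
  ultimately have "A ^ 2 / P = 1 + 2 * (\<Sum>j. (- q) ^ (Suc j)\<^sup>2)"
    using P(2) by simp
  then show ?thesis by (simp add: A_def P_def)
qed

text \<open>The shift by 1/2 replaces the nome by its negative, which produces the alternating signs
  of Gauss's identity; the exponential prefactors of the eta quotient cancel.\<close>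

lemma g_fun_eq_phi:
  assumes "z \<in> upper_half_plane"
  shows "g_fun z = phi (z + 1/2)"
proof -
  have z: "z + 1/2 \<in> upper_half_plane" using assms by (simp add: upper_half_plane_def)
  have e1: "exp (2 * of_real pi * \<i> * of_nat (Suc n) * z) = nome z ^ Suc n" for n
    unfolding exp_of_nat_mult[symmetric] by (simp add: mult_ac)
  have e2: "exp (2 * of_real pi * \<i> * of_nat (Suc n) * (2 * z)) = ((nome z)\<^sup>2) ^ Suc n" for n
    unfolding exp_of_nat_mult[symmetric] by (simp add: mult_ac)
  have e3: "exp (of_real pi * \<i> * z / 12) ^ 2 = exp (of_real pi * \<i> * (2 * z) / 12)"
    unfolding exp_of_nat_mult[symmetric] by simp
  have "g_fun z = (\<Prod>n. 1 - nome z ^ Suc n) ^ 2 / (\<Prod>n. 1 - ((nome z)\<^sup>2) ^ Suc n)"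
    unfolding g_fun_def eta_def e1 e2 power_mult_distrib e3 by simp
  also have "\<dots> = 1 + 2 * (\<Sum>n. (- nome z) ^ (Suc n)\<^sup>2)"
    by (rule gauss_identity[OF norm_nome_less_one[OF assms]])
  also have "\<dots> = phi (z + 1/2)"
    unfolding phi_has_sum(2)[OF z] nome_plus_half ..
  finally show ?thesis .
qed

section \<open>The action of the modular group\<close>

lemma SL2Z_mobius_upper_half_plane:
  assumes "(a, b, c, d) \<in> SL2Z" "z \<in> upper_half_plane"
  shows "(of_int a * z + of_int b) / (of_int c * z + of_int d) \<in> upper_half_plane"
    and "of_int c * z + of_int d \<noteq> (0 :: complex)"
proof -
  have det: "a * d - b * c = 1" using assms(1) by (simp add: SL2Z_def)
  have y: "Im z > 0" using assms(2) by (simp add: upper_half_plane_def)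
  show nz: "of_int c * z + of_int d \<noteq> (0 :: complex)"
    using det y by (auto simp: complex_eq_iff)
  let ?D = "(Re (of_int c * z + of_int d))\<^sup>2 + (Im (of_int c * z + of_int d))\<^sup>2"
  have D: "?D > 0" using nz by (auto simp: sum_power2_gt_zero_iff complex_eq_iff)
  have "Im ((of_int a * z + of_int b) / (of_int c * z + of_int d)) = of_int (a * d - b * c) * Im z / ?D"
    unfolding Im_divide by (simp add: algebra_simps)
  then have "Im ((of_int a * z + of_int b) / (of_int c * z + of_int d)) > 0" using D y det by simp
  then show "(of_int a * z + of_int b) / (of_int c * z + of_int d) \<in> upper_half_plane"
    by (simp add: upper_half_plane_def)
qed

text \<open>The cocycle rule: numerator and denominator for the product matrix both contain the
  factor \<open>j\<close>, which cancels in the argument and multiplies the automorphy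
  factors.\<close>

lemma slash_slash:
  assumes "(a, b, c, d) \<in> SL2Z" "(a', b', c', d') \<in> SL2Z" "z \<in> upper_half_plane"
  shows "slash w (a', b', c', d') (slash w (a, b, c, d) f) z
    = slash w (a * a' + b * c', a * b' + b * d', c * a' + d * c', c * b' + d * d') f z"
proof -
  define j where "j = of_int c' * z + of_int d'"
  define u where "u = (of_int a' * z + of_int b') / j"
  have j: "j \<noteq> 0" using SL2Z_mobius_upper_half_plane(2)[OF assms(2,3)] by (simp add: j_def)
  have ju: "j * u = of_int a' * z + of_int b'" using j by (simp add: u_def)
  have e: "of_int (x * a' + y * c') * z + of_int (x * b' + y * d') = j * (of_int x * u + of_int y)" for x y
    unfolding distrib_left mult.left_commute[of j] ju by (simp add: j_def algebra_simps)
  have "slash w (a', b', c', d') (slash w (a, b, c, d) f) z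
    = f ((of_int a * u + of_int b) / (of_int c * u + of_int d)) / (j * (of_int c * u + of_int d)) ^ w"
    by (simp add: slash_def u_def j_def power_mult_distrib)
  also have "\<dots> = slash w (a * a' + b * c', a * b' + b * d', c * a' + d * c', c * b' + d * d') f z"
    unfolding slash_def prod.case e using j by simp
  finally show ?thesis .
qed

lemma SL2Z_mult:
  assumes "(a, b, c, d) \<in> SL2Z" "(a', b', c', d') \<in> SL2Z"
  shows "(a * a' + b * c', a * b' + b * d', c * a' + d * c', c * b' + d * d') \<in> SL2Z"
proof -
  have "(a * a' + b * c') * (c * b' + d * d') - (a * b' + b * d') * (c * a' + d * c')
      = (a * d - b * c) * (a' * d' - b' * c')" by (simp add: algebra_simps)
  then show ?thesis using assms by (simp add: SL2Z_def)
qed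

lemma slash_cong:
  assumes "(a, b, c, d) \<in> SL2Z" "z \<in> upper_half_plane" "\<And>z. z \<in> upper_half_plane \<Longrightarrow> f z = g z"
  shows "slash w (a, b, c, d) f z = slash w (a, b, c, d) g z"
  using assms(3)[OF SL2Z_mobius_upper_half_plane(1)[OF assms(1,2)]] by (simp add: slash_def)

section \<open>Eisenstein series as lattice sums\<close>

text \<open>Differentiating the reflection formula of the Gamma function; the entire function
  \<open>rGamma\<close> avoids poles during the differentiation.\<close>

lemma Digamma_reflection:
  fixes z :: complex
  assumes "z \<notin> \<int>"
  shows "Digamma (1 - z) - Digamma z = of_real pi * cot (of_real pi * z)"
proof -
  have z: "z \<notin> \<int>\<^sub>\<le>\<^sub>0" "1 - z \<notin> \<int>\<^sub>\<le>\<^sub>0"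
  proof -
    show "z \<notin> \<int>\<^sub>\<le>\<^sub>0" using assms by (auto elim!: nonpos_Ints_cases)
    show "1 - z \<notin> \<int>\<^sub>\<le>\<^sub>0"
    proof
      assume "1 - z \<in> \<int>\<^sub>\<le>\<^sub>0"
      then have "1 - (1 - z) \<in> \<int>" using nonpos_Ints_Int by (intro Ints_diff) auto
      then show False using assms by simp
    qed
  qed
  have nz: "sin (of_real pi * z) \<noteq> 0" 
    using assms by (auto simp: sin_eq_0 mult.commute)
  have "((\<lambda>z. rGamma z * rGamma (1 - z)) has_field_derivative
      - rGamma z * Digamma z * rGamma (1 - z) + rGamma z * (rGamma (1 - z) * Digamma (1 - z))) (at z)"
    using z by (auto intro!: derivative_eq_intros simp: algebra_simps)
  moreover have "((\<lambda>z. rGamma z * rGamma (1 - z)) has_field_derivative cos (of_real pi * z)) (at z)"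
    unfolding rGamma_reflection_complex by (auto intro!: derivative_eq_intros)
  ultimately have "rGamma z * rGamma (1 - z) * (Digamma (1 - z) - Digamma z) = cos (of_real pi * z)"
    using DERIV_unique by (fastforce simp: algebra_simps)
  then show ?thesis
    unfolding rGamma_reflection_complex cot_def using nz by (simp add: field_simps)
qed

lemma upper_half_plane_not_Ints: "z \<in> upper_half_plane \<Longrightarrow> z \<notin> \<int>"
  by (auto simp: upper_half_plane_def Ints_def)

lemma cot_exp_eq:
  fixes z :: complex
  shows "cot z = \<i> * (exp (\<i> * z) + inverse (exp (\<i> * z))) / (exp (\<i> * z) - inverse (exp (\<i> * z)))"
proof -
  have "((a + b) / 2) / ((a - b) / (2 * \<i>)) = \<i> * (a + b) / (a - b)" for a b
    by (cases "a = b") (simp_all add: divide_simps)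
  then show ?thesis
    unfolding cot_def sin_exp_eq cos_exp_eq by (simp add: exp_minus)
qed

text \<open>With \<open>w = exp (\<i> * pi * z)\<close> the cotangent is rational in
  \<open>w ^ 2 = nome z\<close>, and what remains is the geometric series of
  \<open>nome z / (1 - nome z)\<close>.\<close>

lemma cot_nome_series:
  assumes "z \<in> upper_half_plane"
  shows "(\<lambda>n. nome z ^ Suc n) sums ((\<i> * cot (of_real pi * z) - 1) / 2)"
proof -
  let ?w = "exp (\<i> * of_real pi * z)"
  have q: "nome z = ?w\<^sup>2" unfolding exp_of_nat_mult[symmetric] by (simp add: mult_ac)
  have q1: "nome z \<noteq> 1"
    using norm_nome_less_one[OF assms] by (metis less_irrefl norm_one)
  have w: "?w * ?w \<noteq> 1" using q1 unfolding q power2_eq_square .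
  have "cot (of_real pi * z) = \<i> * (?w + inverse ?w) / (?w - inverse ?w)"
    using cot_exp_eq[of "of_real pi * z"] by (simp add: mult.assoc)
  moreover have "(\<i> * (\<i> * (?w + inverse ?w) / (?w - inverse ?w)) - 1) / 2 = ?w\<^sup>2 * (1 / (1 - ?w\<^sup>2))"
  proof -
    have "?w - inverse ?w \<noteq> 0" using w by (simp add: field_simps)
    then show ?thesis using w by (simp add: field_simps power2_eq_square)
  qed
  ultimately have "(\<i> * cot (of_real pi * z) - 1) / 2 = nome z * (1 / (1 - nome z))"
    by (simp only: q)
  moreover have "(\<lambda>n. nome z * nome z ^ n) sums (nome z * (1 / (1 - nome z)))"
    by (intro sums_mult geometric_sums norm_nome_less_one assms)
  ultimately show ?thesis by (simp only: power_Suc)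
qed

text \<open>The polylogarithm of order \<open>- n\<close>. For \<open>n = 0\<close> the term
  \<open>m = 0\<close> counts as 1, so that the value is \<open>1 / (1 - x)\<close>.\<close>

definition power_geometric :: "nat \<Rightarrow> complex \<Rightarrow> complex" where
  "power_geometric n x = (\<Sum>m. of_nat m ^ n * x ^ m)"

lemma summable_power_geometric:
  fixes x :: complex
  assumes "norm x < 1"
  shows "summable (\<lambda>m. of_nat m ^ n * x ^ m)"
  using assms
proof (induction n arbitrary: x)
  case 0
  then show ?case by (simp add: summable_geometric)
next
  case (Suc n)
  have "summable (\<lambda>m. diffs (\<lambda>m. of_nat m ^ n) m * x ^ m)"
    by (rule termdiff_converges[of _ 1]) (use Suc in auto)
  then have "summable (\<lambda>m. x * (diffs (\<lambda>m. of_nat m ^ n) m * x ^ m))"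
    by (rule summable_mult)
  then have "summable (\<lambda>m. of_nat (Suc m) ^ Suc n * x ^ Suc m)"
    by (simp add: diffs_def mult_ac del: of_nat_Suc)
  then show ?case by (subst (asm) summable_Suc_iff)
qed

text \<open>The operator \<open>x d/dx\<close> multiplies the coefficient of \<open>x ^ m\<close> by
  \<open>m\<close>, which raises \<open>n\<close> by one.\<close>

lemma power_geometric_deriv:
  assumes "norm x < 1"
  obtains D where "(power_geometric n has_field_derivative D) (at x)"
    and "x * D = power_geometric (Suc n) x"
proof
  let ?c = "\<lambda>m. of_nat m ^ n :: complex"
  obtain K where K: "norm x < K" "K < 1" using assms dense by blast
  then have nK: "norm (of_real K :: complex) < 1" using le_less_trans[OF norm_ge_zero K(1)] by simp
  show "(power_geometric n has_field_derivative (\<Sum>m. diffs ?c m * x ^ m)) (at x)"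
    unfolding power_geometric_def
    by (rule termdiffs_strong[of _ "of_real K"]) (use K nK summable_power_geometric in auto)
  have s: "summable (\<lambda>m. diffs ?c m * x ^ m)"
    by (rule termdiff_converges[of _ 1]) (use assms summable_power_geometric in auto)
  have "x * (\<Sum>m. diffs ?c m * x ^ m) = (\<Sum>m. x * (diffs ?c m * x ^ m))"
    by (rule suminf_mult[OF s, symmetric])
  also have "\<dots> = (\<Sum>m. of_nat (Suc m) ^ Suc n * x ^ Suc m)"
    by (simp add: diffs_def mult_ac del: of_nat_Suc)
  also have "\<dots> = power_geometric (Suc n) x"
    unfolding power_geometric_def
    by (subst suminf_split_head[OF summable_power_geometric[OF assms, of "Suc n"]]) simp
  finally show "x * (\<Sum>m. diffs ?c m * x ^ m) = power_geometric (Suc n) x" .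
qed

text \<open>Induction by differentiation: the chain rule through \<open>nome\<close> gives a factor
  \<open>2 * pi * \<i>\<close> and the next \<open>power_geometric\<close>, the inner derivative of
  \<open>1 - z\<close> the sign. For \<open>n = 0\<close> the constant \<open>pi * \<i>\<close>
  compensates for the term \<open>m = 0\<close> in \<open>power_geometric 0\<close>.\<close>

lemma Polygamma_reflection:
  assumes "z \<in> upper_half_plane"
  shows "(- 1) ^ n * Polygamma n (1 - z) - Polygamma n z
     = (if n = 0 then of_real pi * \<i> else 0) - (2 * of_real pi * \<i>) ^ Suc n * power_geometric n (nome z)"
  using assms
proof (induction n arbitrary: z)
  case 0
  have q: "norm (nome z) < 1" by (rule norm_nome_less_one[OF 0])
  have "power_geometric 0 (nome z) = 1 + (\<Sum>m. nome z ^ Suc m)"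
    unfolding power_geometric_def
    using suminf_split_head[OF summable_geometric[OF q]] by simp
  also have "(\<Sum>m. nome z ^ Suc m) = (\<i> * cot (of_real pi * z) - 1) / 2"
    by (rule sums_unique[OF cot_nome_series[OF 0], symmetric])
  finally have "power_geometric 0 (nome z) = 1 + (\<i> * cot (of_real pi * z) - 1) / 2" .
  then show ?case
    using Digamma_reflection[OF upper_half_plane_not_Ints[OF 0]] by (simp add: field_simps)
next
  case (Suc n)
  have z: "z \<notin> \<int>\<^sub>\<le>\<^sub>0" "1 - z \<notin> \<int>\<^sub>\<le>\<^sub>0"
    using Suc.prems by (auto simp: upper_half_plane_def elim!: nonpos_Ints_cases dest: arg_cong[of _ _ Im])
  let ?L = "\<lambda>z. (- 1) ^ n * Polygamma n (1 - z) - Polygamma n z"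
  let ?R = "\<lambda>z. (if n = 0 then of_real pi * \<i> else 0) - (2 * of_real pi * \<i>) ^ Suc n * power_geometric n (nome z)"
  obtain D where D: "(power_geometric n has_field_derivative D) (at (nome z))"
    "nome z * D = power_geometric (Suc n) (nome z)"
    by (rule power_geometric_deriv[OF norm_nome_less_one[OF Suc.prems]])
  have "((\<lambda>z. power_geometric n (nome z)) has_field_derivative D * (nome z * (2 * of_real pi * \<i>))) (at z)"
    by (rule DERIV_chain2[where f = "power_geometric n" and g = "\<lambda>z. nome z", OF D(1)]) (auto intro!: derivative_eq_intros)
  moreover have "D * (nome z * (2 * of_real pi * \<i>)) = 2 * of_real pi * \<i> * power_geometric (Suc n) (nome z)"
    unfolding D(2)[symmetric] by (simp only: mult_ac)
  ultimately have "((\<lambda>z. power_geometric n (nome z)) has_field_derivative 2 * of_real pi * \<i> * power_geometric (Suc n) (nome z)) (at z)"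
    by (simp only:)
  then have "(?R has_field_derivative 0 - (2 * of_real pi * \<i>) ^ Suc n * (2 * of_real pi * \<i> * power_geometric (Suc n) (nome z))) (at z)"
    by (intro DERIV_diff DERIV_const DERIV_cmult)
  then have R: "(?L has_field_derivative 0 - (2 * of_real pi * \<i>) ^ Suc n * (2 * of_real pi * \<i> * power_geometric (Suc n) (nome z))) (at z)"
    by (rule has_field_derivative_transform_within_open[OF _ open_upper_half_plane Suc.prems])
      (rule Suc.IH[symmetric])
  have L: "(?L has_field_derivative (- 1) ^ n * (- Polygamma (Suc n) (1 - z)) - Polygamma (Suc n) z) (at z)"
    using z by (auto intro!: derivative_eq_intros)
  show ?case using DERIV_unique[OF L R] by simp
qed

text \<open>Since \<open>w\<close> is even, the two series are the halves \<open>n \<ge> 0\<close>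
  and \<open>n < 0\<close> of the sum of \<open>(z + n) ^ (- w)\<close> over all integers, and each
  is a polygamma value.\<close>

lemma lipschitz_formula:
  assumes "z \<in> upper_half_plane" and "even w" "w > 0"
  shows "(\<Sum>k. inverse ((z + of_nat k) ^ w)) + (\<Sum>k. inverse ((1 - z + of_nat k) ^ w))
     = (2 * of_real pi * \<i>) ^ w / fact (w - 1) * power_geometric (w - 1) (nome z)"
proof -
  obtain n where n: "w = Suc n" "odd n" using assms by (cases w) auto
  then have "n \<noteq> 0" using odd_pos by blast
  have "Polygamma n x = fact n * (\<Sum>k. inverse ((x + of_nat k) ^ w))" for x :: complex
    using n \<open>n \<noteq> 0\<close> by (simp add: Polygamma_def)
  then have "- (fact n * ((\<Sum>k. inverse ((z + of_nat k) ^ w)) + (\<Sum>k. inverse ((1 - z + of_nat k) ^ w))))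
      = - ((2 * of_real pi * \<i>) ^ w * power_geometric n (nome z))"
    using Polygamma_reflection[OF assms(1), of n] n(2) \<open>n \<noteq> 0\<close> unfolding n(1) by (simp add: algebra_simps)
  then have "fact n * ((\<Sum>k. inverse ((z + of_nat k) ^ w)) + (\<Sum>k. inverse ((1 - z + of_nat k) ^ w)))
      = (2 * of_real pi * \<i>) ^ w * power_geometric n (nome z)" by (simp only: neg_equal_iff_equal)
  then show ?thesis by (simp add: n(1) field_simps)
qed

text \<open>The defining real generating series with \<open>c * x\<close> substituted for
  \<open>x\<close>; multiplied out, it can be compared with other expansions by cancelling
  \<open>fps_exp c - 1\<close>.\<close>

lemma bernoulli_complex_fps:
  fixes c :: complex
  shows "(fps_exp c - 1) * Abs_fps (\<lambda>n. of_real (bernoulli n) / fact n * c ^ n) = fps_const c * fps_X"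
proof -
  define b :: "real fps" where "b = fps_X / (fps_exp 1 - 1)"
  have "subdegree (fps_exp 1 - 1 :: real fps) = 1"
    by (rule subdegreeI) auto
  then have "(fps_exp 1 - 1 :: real fps) dvd fps_X"
    by (subst fps_dvd_iff) auto
  then have b: "(fps_exp 1 - 1) * b = fps_X"
    unfolding b_def by (rule dvd_mult_div_cancel)
  have bern: "bernoulli n / fact n = fps_nth b n" for n
    by (simp add: bernoulli_def b_def)
  show ?thesis
  proof (rule fps_ext)
    fix n
    have exp_nth: "fps_nth (fps_exp c - 1) i = of_real (fps_nth (fps_exp 1 - 1) i) * c ^ i" for i
      by (simp add: divide_inverse)
    have nth: "fps_nth (Abs_fps (\<lambda>n. of_real (bernoulli n) / fact n * c ^ n)) i = of_real (fps_nth b i) * c ^ i" for i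
      by (simp add: bern[symmetric])
    have "fps_nth ((fps_exp c - 1) * Abs_fps (\<lambda>n. of_real (bernoulli n) / fact n * c ^ n)) n
        = of_real (fps_nth ((fps_exp 1 - 1) * b) n) * c ^ n"
      unfolding fps_mult_nth exp_nth nth
      by (simp add: sum_distrib_right of_real_sum) (rule sum.cong, auto simp: mult_ac simp flip: power_add)
    also have "\<dots> = fps_nth (fps_const c * fps_X) n"
      unfolding b by (cases "n = 1") auto
    finally show "fps_nth ((fps_exp c - 1) * Abs_fps (\<lambda>n. of_real (bernoulli n) / fact n * c ^ n)) n
        = fps_nth (fps_const c * fps_X) n" .
  qed
qed

text \<open>Euler's formula, from two expansions of \<open>pi * z * cot (pi * z)\<close> at 0: one
  through the Bernoulli numbers, the other through the derivatives at 0 of a digamma difference,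
  which are polygamma values at 1 and thus zeta values.\<close>

lemma zeta_even_bernoulli:
  assumes "k > 0"
  shows "2 * (\<Sum>n. inverse (of_nat (Suc n) ^ (2 * k))) = - ((2 * of_real pi * \<i>) ^ (2 * k) * of_real (bernoulli (2 * k)) / fact (2 * k) :: complex)"
proof -
  let ?c = "2 * of_real pi * \<i> :: complex"
  \<comment> \<open>Using \<open>1 + z\<close> in place of \<open>z\<close> removes the pole at 0;
    on the punctured disc \<open>f z = pi * cot (pi * z) - 1 / z\<close>.\<close>
  define f where "f z = Digamma (1 - z) - Digamma (1 + z)" for z :: complex
  have not_int: "1 - z \<notin> \<int>\<^sub>\<le>\<^sub>0" "1 + z \<notin> \<int>\<^sub>\<le>\<^sub>0" if "z \<in> ball 0 1" for z :: complex
  proof -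
    have "Re z < 1" "Re z > - 1" using that abs_Re_le_cmod[of z] by auto
    then show "1 - z \<notin> \<int>\<^sub>\<le>\<^sub>0" "1 + z \<notin> \<int>\<^sub>\<le>\<^sub>0"
      by (auto elim!: nonpos_Ints_cases dest!: arg_cong[of _ _ Re])
  qed
  have higher: "(deriv ^^ n) f z = (- 1) ^ n * Polygamma n (1 - z) - Polygamma n (1 + z)" if "z \<in> ball 0 1" for n z
    using that
  proof (induction n arbitrary: z)
    case (Suc n)
    have "((\<lambda>z. (- 1) ^ n * Polygamma n (1 - z) - Polygamma n (1 + z)) has_field_derivative
        (- 1) ^ n * (- Polygamma (Suc n) (1 - z)) - Polygamma (Suc n) (1 + z)) (at z)"
      using not_int[OF Suc.prems] by (auto intro!: derivative_eq_intros)
    then have "((deriv ^^ n) f has_field_derivative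
        (- 1) ^ n * (- Polygamma (Suc n) (1 - z)) - Polygamma (Suc n) (1 + z)) (at z)"
      by (rule has_field_derivative_transform_within_open[OF _ open_ball Suc.prems]) (rule Suc.IH[symmetric])
    then show ?case by (simp add: DERIV_imp_deriv)
  qed (simp add: f_def)
  have "f holomorphic_on ball 0 1"
    unfolding f_def holomorphic_on_def field_differentiable_def
    using not_int by (auto intro!: exI derivative_eq_intros)
  then have "f has_fps_expansion fps_expansion f 0"
    by (intro has_fps_expansion_fps_expansion[of "ball 0 1"]) auto
  then obtain H where H: "f has_fps_expansion H" by blast
  \<comment> \<open>Away from 0 the second factor is \<open>?c * z / (exp (?c * z) - 1)\<close>; the
    denominator is cleared so that the identity includes 0.\<close>
  have "(\<lambda>z. (exp (?c * z) - 1) * (z * f z + 1 - of_real pi * \<i> * z)) has_fps_expansion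
      (fps_exp ?c - 1) * (fps_X * H + 1 - fps_const (of_real pi * \<i>) * fps_X)"
    by (intro fps_expansion_intros H)
  moreover have "\<forall>\<^sub>F z in nhds 0. (exp (?c * z) - 1) * (z * f z + 1 - of_real pi * \<i> * z) = ?c * z"
  proof -
    have "(exp (?c * z) - 1) * (z * f z + 1 - of_real pi * \<i> * z) = ?c * z" if "z \<in> ball 0 1" for z
    proof (cases "z = 0")
      case False
      have "z \<notin> \<int>" using that False by (auto elim!: Ints_cases simp: dist_norm)
      let ?w = "exp (\<i> * of_real pi * z)"
      have q: "exp (?c * z) = ?w\<^sup>2" unfolding exp_of_nat_mult[symmetric] by (simp add: mult_ac)
      have "sin (of_real pi * z) \<noteq> 0" using \<open>z \<notin> \<int>\<close> by (auto simp: sin_eq_0 mult.commute)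
      then have w: "?w - inverse ?w \<noteq> 0"
        unfolding sin_exp_eq by (auto simp: exp_minus mult_ac)
      have cot: "cot (of_real pi * z) = \<i> * (?w + inverse ?w) / (?w - inverse ?w)"
        using cot_exp_eq[of "of_real pi * z"] by (simp add: mult.assoc)
      have fz: "f z = of_real pi * cot (of_real pi * z) - 1 / z"
        using Digamma_reflection[OF \<open>z \<notin> \<int>\<close>] Digamma_plus1[OF False] by (simp add: f_def add.commute algebra_simps)
      have "z * f z + 1 = of_real pi * z * cot (of_real pi * z)"
        unfolding fz using False by (simp add: right_diff_distrib)
      moreover have "(?w\<^sup>2 - 1) * (of_real pi * z * (\<i> * (?w + inverse ?w) / (?w - inverse ?w)) - of_real pi * \<i> * z) = ?c * z"
        using w by (simp add: divide_simps) (simp add: power2_eq_square algebra_simps)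
      ultimately show ?thesis unfolding q cot[symmetric] by simp
    qed simp
    then show ?thesis by (intro eventually_nhds_in_open[THEN eventually_mono, of "ball 0 1"]) auto
  qed
  ultimately have "(\<lambda>z. ?c * z) has_fps_expansion (fps_exp ?c - 1) * (fps_X * H + 1 - fps_const (of_real pi * \<i>) * fps_X)"
    using has_fps_expansion_cong by fast
  moreover have "(\<lambda>z. ?c * z) has_fps_expansion fps_const ?c * fps_X"
    by (intro fps_expansion_intros)
  ultimately have "(fps_exp ?c - 1) * (fps_X * H + 1 - fps_const (of_real pi * \<i>) * fps_X) = fps_const ?c * fps_X"
    by (rule fps_expansion_unique_complex)
  also have "\<dots> = (fps_exp ?c - 1) * Abs_fps (\<lambda>n. of_real (bernoulli n) / fact n * ?c ^ n)"
    by (rule bernoulli_complex_fps[symmetric])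
  finally have *: "fps_X * H + 1 - fps_const (of_real pi * \<i>) * fps_X
      = Abs_fps (\<lambda>n. of_real (bernoulli n) / fact n * ?c ^ n)"
  proof (rule mult_left_cancel[THEN iffD1, rotated])
    have "fps_nth (fps_exp ?c - 1) 1 \<noteq> 0" by simp
    then show "fps_exp ?c - 1 \<noteq> 0" by (metis fps_zero_nth)
  qed
  define n where "n = 2 * k - 1"
  have n: "2 * k = Suc n" using assms by (simp add: n_def)
  then have "odd n" by presburger
  then have "n \<noteq> 0" using \<open>odd n\<close> odd_pos by blast
  \<comment> \<open>The index \<open>Suc n\<close> exceeds 1, so the constant and linear corrections
    do not enter.\<close>
  have "fps_nth H n = of_real (bernoulli (2 * k)) / fact (2 * k) * ?c ^ (2 * k)"
    using arg_cong[OF *, of "\<lambda>F. fps_nth F (Suc n)"] \<open>n \<noteq> 0\<close> unfolding n by simp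
  moreover have "fps_nth H n = (deriv ^^ n) f 0 / fact n"
    by (rule fps_nth_fps_expansion[OF H])
  moreover have "(deriv ^^ n) f 0 = - 2 * Polygamma n 1"
    using higher[of 0 n] \<open>odd n\<close> by simp
  moreover have "Polygamma n 1 = fact n * (\<Sum>j. inverse (of_nat (Suc j) ^ (2 * k)) :: complex)"
    using n \<open>odd n\<close> \<open>n \<noteq> 0\<close> by (simp add: Polygamma_def)
  ultimately have "- (2 * (\<Sum>n. inverse (of_nat (Suc n) ^ (2 * k)))) = ?c ^ (2 * k) * of_real (bernoulli (2 * k)) / fact (2 * k)"
    by (simp add: mult_ac)
  then show ?thesis by (metis minus_minus)
qed

section \<open>Convergence and modularity of the lattice sum\<close>

lemma summable_on_mult_product:
  fixes a :: "'a \<Rightarrow> real" and b :: "'b \<Rightarrow> real"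
  assumes "a summable_on A" "b summable_on B" "\<And>x. x \<in> A \<Longrightarrow> a x \<ge> 0" "\<And>y. y \<in> B \<Longrightarrow> b y \<ge> 0"
  shows "(\<lambda>(x, y). a x * b y) summable_on A \<times> B"
proof (rule summable_on_SigmaI)
  show "((\<lambda>y. case (x, y) of (x, y) \<Rightarrow> a x * b y) has_sum a x * infsum b B) B" for x
    using has_sum_cmult_right[OF has_sum_infsum[OF assms(2)], of "a x"] by simp
  show "(\<lambda>x. a x * infsum b B) summable_on A"
    by (rule summable_on_cmult_left[OF assms(1)])
qed (use assms in auto)

lemma summable_on_inverse_square_int: "(\<lambda>n::int. 1 / (1 + (real_of_int n)\<^sup>2)) summable_on UNIV"
proof -
  have "summable (\<lambda>n. inverse (real n ^ 2))" by (rule inverse_power_summable) simp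
  then have "summable (\<lambda>n. norm (1 / (1 + (real_of_int (int n))\<^sup>2)))"
  proof (rule summable_comparison_test'[of _ 1])
    fix n :: nat assume "n \<ge> 1"
    then show "norm (norm (1 / (1 + (real_of_int (int n))\<^sup>2))) \<le> inverse (real n ^ 2)"
      by (simp add: divide_simps not_less)
  qed
  from has_sum_int_even[OF this] show ?thesis by (auto simp: summable_on_def)
qed

text \<open>The imaginary part of \<open>m * z + n\<close> bounds \<open>m\<close>, and the triangle
  inequality then bounds \<open>n\<close>.\<close>

lemma lattice_norm_bound:
  assumes "z \<in> upper_half_plane"
  shows "\<exists>C>0. \<forall>m n :: int. (real_of_int m)\<^sup>2 + (real_of_int n)\<^sup>2 \<le> C * (norm (of_int m * z + of_int n))\<^sup>2"
proof -
  define y where "y = Im z"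
  have y: "y > 0" using assms by (simp add: y_def upper_half_plane_def)
  define A where "A = 1 + norm z / y"
  have A: "A \<ge> 1" using y by (simp add: A_def)
  have bound: "(real_of_int m)\<^sup>2 + (real_of_int n)\<^sup>2 \<le> (1 / y\<^sup>2 + A\<^sup>2) * (norm (of_int m * z + of_int n))\<^sup>2" for m n :: int
  proof -
  let ?N = "norm (of_int m * z + of_int n)"
  have "\<bar>real_of_int m\<bar> * y \<le> ?N"
    using abs_Im_le_cmod[of "of_int m * z + of_int n"] y by (simp add: y_def abs_mult)
  then have m: "\<bar>real_of_int m\<bar> \<le> ?N / y" using y by (simp add: field_simps)
  have "\<bar>real_of_int n\<bar> = norm ((of_int m * z + of_int n) - of_int m * z)" by simp
  also have "\<dots> \<le> ?N + norm (of_int m * z)" by (rule norm_triangle_ineq4)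
  also have "norm (of_int m * z) \<le> ?N / y * norm z"
    unfolding norm_mult norm_of_int by (intro mult_right_mono m) auto
  finally have n: "\<bar>real_of_int n\<bar> \<le> A * ?N" by (simp add: A_def algebra_simps)
  have "(real_of_int m)\<^sup>2 \<le> (?N / y)\<^sup>2" "(real_of_int n)\<^sup>2 \<le> (A * ?N)\<^sup>2"
    using power_mono[OF m, of 2] power_mono[OF n, of 2] by auto
  then show ?thesis
    by (simp add: power_divide power_mult_distrib distrib_right)
  qed
  have "1 / y\<^sup>2 + A\<^sup>2 > 0" using y by (simp add: add_pos_nonneg)
  with bound show ?thesis by blast
qed

abbreviation punctured_lattice :: "(int \<times> int) set" where
  "punctured_lattice \<equiv> UNIV - {(0, 0)}"

text \<open>Comparison with the product of two convergent one-dimensional series. Off the origin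
  \<open>s \<ge> 1\<close>, so \<open>s\<^sup>2 \<le> s ^ k\<close>; this is where
  \<open>k \<ge> 2\<close> enters.\<close>

lemma lattice_summable:
  assumes z: "z \<in> upper_half_plane" and k: "k \<ge> 2"
  shows "(\<lambda>(m, n). inverse ((of_int m * z + of_int n) ^ (2 * k))) summable_on punctured_lattice"
proof -
  obtain C where C: "C > 0"
    "\<And>m n :: int. (real_of_int m)\<^sup>2 + (real_of_int n)\<^sup>2 \<le> C * (norm (of_int m * z + of_int n))\<^sup>2"
    using lattice_norm_bound[OF z] by blast
  let ?b = "\<lambda>n. 1 / (1 + (real_of_int n)\<^sup>2)"
  have "(\<lambda>(m, n). ?b m * ?b n) summable_on UNIV \<times> UNIV"
    by (intro summable_on_mult_product summable_on_inverse_square_int) auto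
  then have "(\<lambda>x. 3 * C ^ k * (case x of (m, n) \<Rightarrow> ?b m * ?b n)) summable_on UNIV"
    by (intro summable_on_cmult_right) simp
  then have sum: "(\<lambda>x. 3 * C ^ k * (case x of (m, n) \<Rightarrow> ?b m * ?b n)) summable_on punctured_lattice"
    by (rule summable_on_subset_banach) auto
  show ?thesis
  proof (rule abs_summable_summable, rule Infinite_Sum.abs_summable_on_comparison_test'[OF sum])
    fix x :: "int \<times> int" assume "x \<in> punctured_lattice"
    then obtain m n where x: "x = (m, n)" and mn: "m = 0 \<longrightarrow> n \<noteq> 0" by (cases x) auto
    define s where "s = (real_of_int m)\<^sup>2 + (real_of_int n)\<^sup>2"
    let ?N = "norm (of_int m * z + of_int n)"
    have "m\<^sup>2 + n\<^sup>2 > 0" using mn by (auto simp: sum_power2_gt_zero_iff)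
    then have "m\<^sup>2 + n\<^sup>2 \<ge> 1" by simp
    then have "real_of_int (m\<^sup>2 + n\<^sup>2) \<ge> real_of_int 1" by (simp only: of_int_le_iff)
    then have s: "s \<ge> 1" by (simp add: s_def)
    have sN: "s \<le> C * ?N\<^sup>2" unfolding s_def by (rule C)
    \<comment> \<open>The product is \<open>1 + s + m\<^sup>2 * n\<^sup>2\<close>, and each of the
      three terms is at most \<open>s\<^sup>2\<close>.\<close>
    have "(1 + (real_of_int m)\<^sup>2) * (1 + (real_of_int n)\<^sup>2) \<le> 3 * s\<^sup>2"
    proof -
      have "(real_of_int m)\<^sup>2 * (real_of_int n)\<^sup>2 \<le> s\<^sup>2"
        unfolding s_def power2_sum[of "(real_of_int m)\<^sup>2"] by simp
      moreover have "s \<le> s\<^sup>2" using s self_le_power[of s 2] by simp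
      moreover have "1 \<le> s\<^sup>2" using s one_le_power[of s 2] by simp
      ultimately show ?thesis by (simp add: s_def algebra_simps)
    qed
    also have "s\<^sup>2 \<le> s ^ k" using s k by (intro power_increasing) auto
    also have "s ^ k \<le> (C * ?N\<^sup>2) ^ k" using s sN by (intro power_mono) auto
    finally have le: "(1 + (real_of_int m)\<^sup>2) * (1 + (real_of_int n)\<^sup>2) \<le> 3 * (C * ?N\<^sup>2) ^ k"
      by simp
    have "C * ?N\<^sup>2 \<ge> 1" using s sN by linarith
    then have "?N \<noteq> 0" by (intro notI) simp
    then have "?N > 0" by simp
    have "(C * ?N\<^sup>2) ^ k = C ^ k * ?N ^ (2 * k)" by (simp only: power_mult_distrib power_mult)
    with le have "(1 + (real_of_int m)\<^sup>2) * (1 + (real_of_int n)\<^sup>2) \<le> 3 * C ^ k * ?N ^ (2 * k)" by simp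
    moreover have "inverse M \<le> K / P" if "P \<le> K * M" "P > 0" "M > 0" for K M P :: real
      using that by (simp add: field_simps)
    moreover have "(1 + (real_of_int m)\<^sup>2) * (1 + (real_of_int n)\<^sup>2) > 0" by (simp add: add_pos_nonneg)
    moreover have "?N ^ (2 * k) > 0" using \<open>?N > 0\<close> by simp
    ultimately have "inverse (?N ^ (2 * k)) \<le> 3 * C ^ k / ((1 + (real_of_int m)\<^sup>2) * (1 + (real_of_int n)\<^sup>2))"
      by blast
    then show "norm (case x of (m, n) \<Rightarrow> inverse ((of_int m * z + of_int n) ^ (2 * k)))
       \<le> 3 * C ^ k * (case x of (m, n) \<Rightarrow> ?b m * ?b n)"
      by (simp add: x norm_inverse norm_power)
  qed
qed

definition lattice_sum :: "nat \<Rightarrow> complex \<Rightarrow> complex" where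
  "lattice_sum k z = (\<Sum>\<^sub>\<infinity>(m, n)\<in>punctured_lattice. inverse ((of_int m * z + of_int n) ^ (2 * k)))"

text \<open>A matrix of determinant 1 permutes the punctured lattice by acting on
  \<open>(m, n)\<close> from the right; the identities \<open>e\<close> show that the two reindexing
  maps are inverse to each other.\<close>

lemma lattice_sum_slash:
  assumes "(a, b, c, d) \<in> SL2Z" "z \<in> upper_half_plane"
  shows "lattice_sum k ((of_int a * z + of_int b) / (of_int c * z + of_int d))
     = (of_int c * z + of_int d) ^ (2 * k) * lattice_sum k z"
proof -
  have det: "a * d - b * c = 1" using assms(1) by (simp add: SL2Z_def)
  have nz: "of_int c * z + of_int d \<noteq> 0"
    by (rule SL2Z_mobius_upper_half_plane(2)[OF assms])
  let ?j = "of_int c * z + of_int d"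
  let ?f = "\<lambda>(m, n). inverse ((of_int m * z + of_int n) ^ (2 * k))"
  have e: "(m * a + n * c) * d - (m * b + n * d) * c = m * (a * d - b * c)"
      "(m * b + n * d) * a - (m * a + n * c) * b = n * (a * d - b * c)"
      "(m * d - n * c) * a + (n * a - m * b) * c = m * (a * d - b * c)"
      "(m * d - n * c) * b + (n * a - m * b) * d = n * (a * d - b * c)" for m n
      by (simp_all add: algebra_simps)
  have summand: "inverse ((of_int m * ((of_int a * z + of_int b) / ?j) + of_int n) ^ (2 * k))
      = ?j ^ (2 * k) * inverse ((of_int (m * a + n * c) * z + of_int (m * b + n * d)) ^ (2 * k))" for m n :: int
  proof -
    have "of_int m * ((of_int a * z + of_int b) / ?j) + of_int n
        = (of_int (m * a + n * c) * z + of_int (m * b + n * d)) / ?j"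
      using nz by (simp add: field_simps)
    then show ?thesis
      by (simp only: power_divide inverse_divide) (rule divide_inverse)
  qed
  have "lattice_sum k ((of_int a * z + of_int b) / ?j)
      = (\<Sum>\<^sub>\<infinity>(m, n)\<in>punctured_lattice. ?j ^ (2 * k) * ?f (m * a + n * c, m * b + n * d))"
    unfolding lattice_sum_def by (simp only: summand prod.case)
  also have "\<dots> = (\<Sum>\<^sub>\<infinity>x\<in>punctured_lattice. ?j ^ (2 * k) * ?f x)"
  proof (rule infsum_reindex_bij_witness[where i = "\<lambda>(m, n). (m * d - n * c, n * a - m * b)"
        and j = "\<lambda>(m, n). (m * a + n * c, m * b + n * d)"])
    fix x assume x: "x \<in> punctured_lattice"
    show 1: "(case case x of (m, n) \<Rightarrow> (m * a + n * c, m * b + n * d) of (m, n) \<Rightarrow> (m * d - n * c, n * a - m * b)) = x"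
      by (cases x) (simp add: e det)
    show 2: "(case case x of (m, n) \<Rightarrow> (m * d - n * c, n * a - m * b) of (m, n) \<Rightarrow> (m * a + n * c, m * b + n * d)) = x"
      by (cases x) (simp add: e det)
    show "(case x of (m, n) \<Rightarrow> (m * a + n * c, m * b + n * d)) \<in> punctured_lattice"
      using 1 x by (cases x) auto
    show "(case x of (m, n) \<Rightarrow> (m * d - n * c, n * a - m * b)) \<in> punctured_lattice"
      using 2 x by (cases x) auto
  qed (auto split: prod.splits)
  also have "\<dots> = ?j ^ (2 * k) * lattice_sum k z"
    unfolding lattice_sum_def by (subst infsum_cmult_right') simp
  finally show ?thesis .
qed

text \<open>The split at 0 yields exactly the two one-sided series of the Lipschitz formula.\<close>

lemma has_sum_int_split:
  fixes f :: "int \<Rightarrow> 'a :: banach"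
  assumes "f summable_on UNIV"
  shows "(f has_sum ((\<Sum>n. f (int n)) + (\<Sum>n. f (- 1 - int n)))) UNIV"
proof -
  have reidx: "(f has_sum S) {0..} \<longleftrightarrow> ((\<lambda>n. f (int n)) has_sum S) UNIV"
    "(f has_sum S) {..<0} \<longleftrightarrow> ((\<lambda>n. f (- 1 - int n)) has_sum S) UNIV" for S
    by (rule has_sum_reindex_bij_witness[of _ int nat]; simp)
      (rule has_sum_reindex_bij_witness[of _ "\<lambda>n. - 1 - int n" "\<lambda>m. nat (- 1 - m)"]; simp)
  have "f summable_on {0..}" "f summable_on {..<0}"
    using assms by (auto intro: summable_on_subset_banach)
  then obtain S T where ST: "(f has_sum S) {0..}" "(f has_sum T) {..<0}"
    by (auto simp: summable_on_def)
  then have "(f has_sum (S + T)) ({0..} \<union> {..<0})" by (rule has_sum_Un_disjoint) auto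
  moreover have "{0..} \<union> {..<0} = (UNIV :: int set)" by auto
  moreover have "S = (\<Sum>n. f (int n))" "T = (\<Sum>n. f (- 1 - int n))"
    using ST[unfolded reidx] by (auto intro: sums_unique has_sum_imp_sums)
  ultimately show ?thesis by simp
qed

text \<open>Summation by rows: row 0 gives twice the zeta value, row \<open>m > 0\<close> is the
  Lipschitz formula at \<open>m * z\<close>, and rows \<open>m\<close> and \<open>- m\<close> agree
  because the exponent is even.\<close>

lemma lattice_sum_eq:
  assumes z: "z \<in> upper_half_plane" and k: "k \<ge> 2"
  shows "lattice_sum k z = 2 * (\<Sum>n. inverse (of_nat (Suc n) ^ (2 * k)))
     + 2 * ((2 * of_real pi * \<i>) ^ (2 * k) / fact (2 * k - 1)
         * (\<Sum>m. power_geometric (2 * k - 1) (nome z ^ Suc m)))"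
    and "summable (\<lambda>m. norm (power_geometric (2 * k - 1) (nome z ^ Suc m)))"
proof -
  let ?f = "\<lambda>x :: int \<times> int. case x of (m, n) \<Rightarrow> inverse ((of_int m * z + of_int n) ^ (2 * k))"
  let ?c = "(2 * of_real pi * \<i>) ^ (2 * k) / fact (2 * k - 1) :: complex"
  \<comment> \<open>Only row 0 misses a point; the punctured lattice is thereby a dependent sum over
    the rows.\<close>
  define B :: "int \<Rightarrow> int set" where "B m = (if m = 0 then UNIV - {0} else UNIV)" for m
  have L: "punctured_lattice = Sigma UNIV B"
    by (auto simp: B_def split: if_splits)
  have sum: "?f summable_on Sigma UNIV B"
    using lattice_summable[OF z k] unfolding L by simp
  define h where "h m = (\<Sum>\<^sub>\<infinity>n\<in>B m. ?f (m, n))" for m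
  have row_summable: "(\<lambda>n. ?f (m, n)) summable_on B m" for m
    using summable_on_Sigma_banach sum summable_on_SigmaD1[of "\<lambda>m n. ?f (m, n)" UNIV B m] by simp
  have h_sum: "(h has_sum lattice_sum k z) UNIV"
    unfolding h_def lattice_sum_def L
    by (rule has_sum_SigmaD[OF has_sum_infsum[OF sum]]) (rule has_sum_infsum[OF row_summable])
  have h0: "h 0 = 2 * (\<Sum>n. inverse (of_nat (Suc n) ^ (2 * k)))"
  proof -
    let ?g = "\<lambda>n::int. inverse ((of_int n :: complex) ^ (2 * k))"
    have "summable (\<lambda>n. inverse (real n ^ (2 * k)))" using k by (intro inverse_power_summable) simp
    then have "summable (\<lambda>n. norm (?g (int n)))" by (simp add: norm_inverse norm_power)
    from has_sum_int_even[OF this]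
    have "(?g has_sum (2 * (\<Sum>n. inverse (of_nat (Suc n) ^ (2 * k))))) UNIV"
      using k by (simp add: scaleR_conv_of_real power_0_left)
    moreover have "(?g has_sum S) UNIV \<longleftrightarrow> (?g has_sum S) (UNIV - {0})" for S
      using k by (intro has_sum_cong_neutral) auto
    ultimately have "(?g has_sum (2 * (\<Sum>n. inverse (of_nat (Suc n) ^ (2 * k))))) (UNIV - {0})" by blast
    then show ?thesis unfolding h_def B_def by (simp add: infsumI)
  qed
  have h_pos: "h (int (Suc m)) = ?c * power_geometric (2 * k - 1) (nome z ^ Suc m)" for m
  proof -
    let ?z = "of_int (int (Suc m)) * z"
    have mz: "?z \<in> upper_half_plane" using z by (simp add: upper_half_plane_def)
    let ?g = "\<lambda>n::int. inverse ((?z + of_int n) ^ (2 * k))"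
    have "?g summable_on UNIV" using row_summable[of "int (Suc m)"] by (simp add: B_def)
    from has_sum_int_split[OF this]
    have "infsum ?g UNIV = (\<Sum>n. ?g (int n)) + (\<Sum>n. ?g (- 1 - int n))" by (rule infsumI)
    moreover have "?g (- 1 - int n) = inverse ((1 - ?z + of_nat n) ^ (2 * k))" for n
      using power_minus_even[of "2 * k" "?z + of_int (- 1 - int n)"] by (simp add: algebra_simps)
    ultimately have "infsum ?g UNIV = (\<Sum>n. inverse ((?z + of_nat n) ^ (2 * k))) + (\<Sum>n. inverse ((1 - ?z + of_nat n) ^ (2 * k)))"
      by (simp only: of_int_of_nat_eq)
    also have "\<dots> = ?c * power_geometric (2 * k - 1) (nome ?z)"
      using k by (intro lipschitz_formula mz) auto
    also have "nome ?z = nome z ^ Suc m"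
      unfolding exp_of_nat_mult[symmetric] by (simp add: mult_ac)
    finally show ?thesis unfolding h_def B_def by simp
  qed
  have h_even: "h (- m) = h m" for m
    unfolding h_def
  proof (rule infsum_reindex_bij_witness[where i = uminus and j = uminus])
    fix n
    show "?f (m, - n) = ?f (- m, n)"
      using power_minus_even[of "2 * k" "of_int m * z + of_int (- n)"] by simp
  qed (auto simp: B_def split: if_splits)
  have c0: "?c \<noteq> 0" by simp
  have "summable (\<lambda>n. norm (h (int n)))"
  proof -
    have "(\<lambda>m. norm (h m)) summable_on UNIV"
      using h_sum summable_on_iff_abs_summable_on_complex by (auto simp: summable_on_def)
    then have "(\<lambda>m. norm (h m)) summable_on range int" by (rule summable_on_subset_banach) auto
    then have "((\<lambda>m. norm (h m)) \<circ> int) summable_on UNIV"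
      by (subst (asm) summable_on_reindex) auto
    then show ?thesis using summable_on_imp_summable by (simp add: comp_def)
  qed
  from has_sum_int_even[OF this h_even]
  have "(h has_sum (h 0 + 2 *\<^sub>R (\<Sum>n. h (int (Suc n))))) UNIV" .
  with h_sum have eq: "lattice_sum k z = h 0 + 2 *\<^sub>R (\<Sum>n. h (int (Suc n)))" by (rule has_sum_unique)
  have s: "summable (\<lambda>n. norm (h (int (Suc n))))"
    using \<open>summable (\<lambda>n. norm (h (int n)))\<close> summable_Suc_iff[of "\<lambda>n. norm (h (int n))"] by simp
  then have "summable (\<lambda>m. inverse (norm ?c) * norm (?c * power_geometric (2 * k - 1) (nome z ^ Suc m)))"
    unfolding h_pos by (rule summable_mult)
  then show s': "summable (\<lambda>m. norm (power_geometric (2 * k - 1) (nome z ^ Suc m)))"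
    using c0 by (simp add: norm_mult norm_divide del: power_Suc)
  show "lattice_sum k z = 2 * (\<Sum>n. inverse (of_nat (Suc n) ^ (2 * k)))
     + 2 * (?c * (\<Sum>m. power_geometric (2 * k - 1) (nome z ^ Suc m)))"
    unfolding eq h0 h_pos suminf_mult[OF summable_norm_cancel[OF s']] by (simp add: scaleR_conv_of_real)
qed

text \<open>A Lambert series: the absolutely convergent double series of
  \<open>d ^ j * x ^ (m * d)\<close> is summed once by \<open>m\<close> and once by the value of
  \<open>m * d\<close>.\<close>

lemma sums_divisor_power_series:
  fixes x :: complex
  assumes x: "norm x < 1" and j: "j > 0"
  shows "(\<lambda>n. (\<Sum>d | d dvd Suc n. of_nat d ^ j) * x ^ Suc n) sums (\<Sum>m. power_geometric j (x ^ Suc m))"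
proof -
  let ?f = "\<lambda>(m, d). of_nat (Suc d) ^ j * x ^ (Suc m * Suc d)"
  have "?f summable_on UNIV \<times> UNIV"
  proof (rule abs_summable_summable)
    \<comment> \<open>With \<open>r\<^sup>2 = norm x\<close> one has
      \<open>r ^ (2 * (Suc m * Suc d)) \<le> r ^ (m + Suc d)\<close>, which separates the variables
      and leaves a product of two convergent series.\<close>
    define r where "r = sqrt (norm x)"
    have r: "0 \<le> r" "r < 1" "r\<^sup>2 = norm x" using x by (auto simp: r_def real_sqrt_lt_1_iff)
    have s1: "(\<lambda>m. r ^ m) summable_on UNIV"
      using r by (intro summable_nonneg_imp_summable_on summable_geometric) auto
    have "summable (\<lambda>d. norm (of_nat d ^ j * complex_of_real r ^ d))"
    proof -
      have "summable (\<lambda>d. of_nat d ^ j * complex_of_real r ^ d)"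
        using r by (intro summable_power_geometric) simp
      then have "summable (\<lambda>d. Re (of_nat d ^ j * complex_of_real r ^ d))" by (rule summable_Re)
      then show ?thesis using r(1) by (simp add: norm_mult norm_power flip: of_real_power)
    qed
    then have "summable (\<lambda>d. real d ^ j * r ^ d)" using r by (simp add: norm_mult norm_power)
    then have "summable (\<lambda>d. real (Suc d) ^ j * r ^ Suc d)"
      using summable_Suc_iff[of "\<lambda>d. real d ^ j * r ^ d"] by simp
    then have s2: "(\<lambda>d. real (Suc d) ^ j * r ^ Suc d) summable_on UNIV"
      using r by (intro summable_nonneg_imp_summable_on) auto
    have "(\<lambda>(m, d). r ^ m * (real (Suc d) ^ j * r ^ Suc d)) summable_on UNIV \<times> UNIV"
      by (rule summable_on_mult_product[OF s1 s2]) (use r in auto)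
    then show "(\<lambda>y. norm (?f y)) summable_on UNIV \<times> UNIV"
    proof (rule summable_on_comparison_test)
      fix y :: "nat \<times> nat"
      obtain m d where y: "y = (m, d)" by (cases y)
      have "norm x ^ (Suc m * Suc d) = r ^ (2 * (Suc m * Suc d))" by (simp only: r(3)[symmetric] power_mult)
      also have "\<dots> \<le> r ^ (m + Suc d)" using r by (intro power_decreasing) auto
      finally have "real (Suc d) ^ j * norm x ^ (Suc m * Suc d) \<le> real (Suc d) ^ j * r ^ (m + Suc d)"
        by (rule mult_left_mono) simp
      then show "norm (?f y) \<le> (case y of (m, d) \<Rightarrow> r ^ m * (real (Suc d) ^ j * r ^ Suc d))"
        by (simp add: y norm_mult norm_power power_add mult_ac del: of_nat_Suc mult_Suc mult_Suc_right)
    qed auto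
  qed
  then obtain S where S: "(?f has_sum S) (Sigma UNIV (\<lambda>_. UNIV))" by (auto simp: summable_on_def)
  have "((\<lambda>m. power_geometric j (x ^ Suc m)) has_sum S) UNIV"
  proof (rule has_sum_SigmaD[OF S])
    fix m :: nat
    have xm: "norm (x ^ Suc m) < 1"
      using x power_decreasing[of 1 "Suc m" "norm x"] by (simp add: norm_power del: power_Suc)
    note s = summable_power_geometric[OF xm, of j]
    \<comment> \<open>\<open>power_geometric\<close> starts at index 0; that term is
      \<open>0 ^ j\<close>, which vanishes because \<open>j > 0\<close>.\<close>
    have "(\<lambda>d. of_nat (Suc d) ^ j * (x ^ Suc m) ^ Suc d) sums power_geometric j (x ^ Suc m)"
      using summable_sums[OF s] j unfolding power_geometric_def by (subst sums_Suc_iff) (simp add: zero_power)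
    moreover have "summable (\<lambda>d. norm (of_nat (Suc d) ^ j * (x ^ Suc m) ^ Suc d))"
    proof -
      have "(\<lambda>d. ?f (m, d)) summable_on UNIV"
        using summable_on_SigmaD1[of "\<lambda>m d. ?f (m, d)" UNIV "\<lambda>_. UNIV" m] S
        by (auto simp: summable_on_def)
      then have "(\<lambda>d. norm (?f (m, d))) summable_on UNIV"
        by (simp only: summable_on_iff_abs_summable_on_complex)
      then show ?thesis
        using summable_on_imp_summable by (simp add: power_mult[symmetric] del: mult_Suc mult_Suc_right of_nat_Suc power_Suc)
    qed
    ultimately show "((\<lambda>d. ?f (m, d)) has_sum power_geometric j (x ^ Suc m)) UNIV"
      by (simp add: norm_summable_imp_has_sum power_mult[symmetric] del: mult_Suc mult_Suc_right of_nat_Suc power_Suc)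
  qed
  then have "(\<Sum>m. power_geometric j (x ^ Suc m)) = S"
    by (rule sums_unique[OF has_sum_imp_sums, symmetric])
  moreover have "((\<lambda>n. (\<Sum>d | d dvd Suc n. of_nat d ^ j) * x ^ Suc n) has_sum S) UNIV"
  proof (rule has_sum_SigmaD)
    \<comment> \<open>A pair \<open>(m, d)\<close> of the double series corresponds to the number
      \<open>Suc m * Suc d = Suc n\<close> with its divisor \<open>Suc d\<close>.\<close>
    let ?g = "\<lambda>(n, d). of_nat d ^ j * x ^ Suc n"
    show "(?g has_sum S) (SIGMA n:UNIV. {d. d dvd Suc n})"
    proof (rule iffD1[OF _ S], rule has_sum_reindex_bij_witness[where i = "\<lambda>(n, d). (Suc n div d - 1, d - 1)"
          and j = "\<lambda>(m, d). (Suc m * Suc d - 1, Suc d)"])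
      fix b assume "b \<in> (SIGMA n:UNIV. {d. d dvd Suc n})"
      then obtain n d where "b = (n, d)" "d dvd Suc n" by (cases b) auto
      then obtain e where b: "b = (n, d)" "Suc n = d * e" by (elim dvdE) auto
      then have "d > 0" "e > 0" by (metis mult_is_0 nat.simps(3) neq0_conv)+
      then show "(case case b of (n, d) \<Rightarrow> (Suc n div d - 1, d - 1) of (m, d) \<Rightarrow> (Suc m * Suc d - 1, Suc d)) = b"
        using b by (simp add: mult.commute[of e d] del: mult_Suc mult_Suc_right)
      show "(case b of (n, d) \<Rightarrow> (Suc n div d - 1, d - 1)) \<in> UNIV \<times> UNIV" by simp
    next
      fix a :: "nat \<times> nat"
      obtain m d where a: "a = (m, d)" by (cases a)
      have S: "Suc (Suc m * Suc d - 1) = Suc m * Suc d" by simp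
      show "(case case a of (m, d) \<Rightarrow> (Suc m * Suc d - 1, Suc d) of (n, d) \<Rightarrow> (Suc n div d - 1, d - 1)) = a"
        unfolding a prod.case S by (simp del: mult_Suc mult_Suc_right)
      show "(case a of (m, d) \<Rightarrow> (Suc m * Suc d - 1, Suc d)) \<in> (SIGMA n:UNIV. {d. d dvd Suc n})"
        unfolding a prod.case mem_Sigma_iff S by (simp del: mult_Suc mult_Suc_right)
      show "?g (case a of (m, d) \<Rightarrow> (Suc m * Suc d - 1, Suc d)) = ?f a"
        unfolding a prod.case S ..
    qed (rule refl)
    show "((\<lambda>d. ?g (n, d)) has_sum (\<Sum>d | d dvd Suc n. of_nat d ^ j) * x ^ Suc n) {d. d dvd Suc n}" for n
      by (simp add: has_sum_finite_iff sum_distrib_right)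
  qed
  ultimately show ?thesis by (simp add: has_sum_imp_sums)
qed

lemma divisor_sigma_of_nat:
  "n > 0 \<Longrightarrow> divisor_sigma j (real n) = (\<Sum>d | d dvd n. d ^ j)"
  by (auto simp: divisor_sigma_def)

lemma zeta_even_nonzero:
  assumes "k > 0"
  shows "(\<Sum>n. inverse (of_nat (Suc n) ^ (2 * k))) \<noteq> (0 :: complex)"
proof -
  have "summable (\<lambda>n. inverse (real n ^ (2 * k)))" using assms by (intro inverse_power_summable) simp
  then have s: "summable (\<lambda>n. inverse (real (Suc n) ^ (2 * k)))"
    using summable_Suc_iff[of "\<lambda>n. inverse (real n ^ (2 * k))"] by simp
  have "0 < (\<Sum>n. inverse (real (Suc n) ^ (2 * k)))" by (rule suminf_pos[OF s]) simp
  moreover have "(\<Sum>n. inverse (of_nat (Suc n) ^ (2 * k))) = complex_of_real (\<Sum>n. inverse (real (Suc n) ^ (2 * k)))"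
    unfolding suminf_of_real[OF s] by simp
  ultimately show ?thesis by (metis less_irrefl of_real_eq_0_iff)
qed

lemma bernoulli_even_nonzero:
  assumes "k > 0"
  shows "bernoulli (2 * k) \<noteq> 0"
  using zeta_even_bernoulli[OF assms] zeta_even_nonzero[OF assms] by auto

text \<open>Euler's formula turns the constant
  \<open>(2 * pi * \<i>) ^ (2 * k) / fact (2 * k - 1)\<close> from the Lipschitz formula into the
  zeta value times \<open>- 4 * k / B\<close>, the normalisation of the Eisenstein series.\<close>

lemma lattice_sum_eq_eisenstein:
  assumes z: "z \<in> upper_half_plane" and k: "k \<ge> 2"
  shows "lattice_sum k z = 2 * (\<Sum>n. inverse (of_nat (Suc n) ^ (2 * k))) * eisenstein_series k z"
proof -
  let ?c = "2 * of_real pi * \<i> :: complex"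
  let ?B = "of_real (bernoulli (2 * k)) :: complex"
  let ?Z = "\<Sum>n. inverse (of_nat (Suc n) ^ (2 * k)) :: complex"
  define D where "D = (\<Sum>m. power_geometric (2 * k - 1) (nome z ^ Suc m))"
  have "(\<lambda>n. of_nat (divisor_sigma (2 * k - 1) (real (Suc n))) * nome z ^ Suc n) sums D"
    using sums_divisor_power_series[OF norm_nome_less_one[OF z], of "2 * k - 1"] k
    unfolding D_def by (simp add: divisor_sigma_of_nat del: of_nat_Suc)
  then have E: "eisenstein_series k z = 1 - of_nat (4 * k) / ?B * D"
    unfolding eisenstein_series_def by (simp add: sums_unique[symmetric] del: of_nat_Suc power_Suc)
  have B: "?B \<noteq> 0" using bernoulli_even_nonzero[of k] k by simp
  have Z: "2 * ?Z = - (?c ^ (2 * k) * ?B / fact (2 * k))"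
    using k by (intro zeta_even_bernoulli) simp
  have "(fact (2 * k) :: complex) = of_nat (2 * k) * fact (2 * k - 1)"
    using k by (simp add: fact_reduce)
  then have "2 * ?Z * (of_nat (4 * k) / ?B * D) = - (2 * (?c ^ (2 * k) / fact (2 * k - 1) * D))"
    unfolding Z using B k by (simp add: field_simps)
  then show ?thesis
    unfolding lattice_sum_eq(1)[OF z k] E D_def[symmetric] by (simp add: right_diff_distrib)
qed

definition eisenstein_coeff :: "nat \<Rightarrow> nat \<Rightarrow> complex" where
  "eisenstein_coeff k n = (if n = 0 then 1
     else - (of_nat (4 * k) / of_real (bernoulli (2 * k))) * of_nat (divisor_sigma (2 * k - 1) (real n)))"

lemma eisenstein_series_sums:
  assumes z: "z \<in> upper_half_plane" and k: "k \<ge> 2"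
  shows "(\<lambda>n. eisenstein_coeff k n * nome z ^ n) sums eisenstein_series k z"
proof -
  let ?a = "\<lambda>n. of_nat (divisor_sigma (2 * k - 1) (real (Suc n))) * nome z ^ Suc n"
  have "summable ?a"
    using sums_divisor_power_series[OF norm_nome_less_one[OF z], of "2 * k - 1"] k
    by (simp add: divisor_sigma_of_nat sums_iff del: of_nat_Suc)
  then have "(\<lambda>n. - (of_nat (4 * k) / of_real (bernoulli (2 * k))) * ?a n) sums
      (- (of_nat (4 * k) / of_real (bernoulli (2 * k))) * suminf ?a)"
    by (intro sums_mult summable_sums)
  then have "(\<lambda>n. eisenstein_coeff k (Suc n) * nome z ^ Suc n) sums (eisenstein_series k z - 1)"
    by (simp add: eisenstein_coeff_def eisenstein_series_def mult.assoc del: of_nat_Suc power_Suc)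
  then show ?thesis
    by (subst (asm) sums_Suc_iff) (simp add: eisenstein_coeff_def)
qed

lemma eisenstein_series_slash:
  assumes "(a, b, c, d) \<in> SL2Z" "z \<in> upper_half_plane" "k \<ge> 2"
  shows "slash (2 * k) (a, b, c, d) (eisenstein_series k) z = eisenstein_series k z"
proof -
  note H = SL2Z_mobius_upper_half_plane[OF assms(1,2)]
  have "(\<Sum>n. inverse (of_nat (Suc n) ^ (2 * k))) \<noteq> (0 :: complex)"
    using assms(3) by (intro zeta_even_nonzero) simp
  then show ?thesis
    using lattice_sum_slash[OF assms(1,2), of k] H(2)
    unfolding lattice_sum_eq_eisenstein[OF assms(2,3)] lattice_sum_eq_eisenstein[OF H(1) assms(3)]
    by (simp add: slash_def field_simps)
qed

section \<open>The group of level 2\<close>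

text \<open>The Euclidean algorithm on the bottom row \<open>(c, d)\<close>: since \<open>c\<close> is even and \<open>d\<close> is odd, adding
  an even multiple of \<open>d\<close> to \<open>c\<close> or a multiple of \<open>c\<close> to \<open>d\<close> always makes \<open>\<bar>c\<bar> + \<bar>d\<bar>\<close> smaller until
  \<open>c = 0\<close>.\<close>

lemma Gamma0_2_invariant:
  assumes T: "\<And>z. z \<in> upper_half_plane \<Longrightarrow> f (z + 1) = f z"
    and V: "\<And>z. z \<in> upper_half_plane \<Longrightarrow> f (z / (2 * z + 1)) = (2 * z + 1) ^ w * f z"
    and w: "even w"
    and \<gamma>: "(a, b, c, d) \<in> SL2Z" "even c" and z: "z \<in> upper_half_plane"
  shows "slash w (a, b, c, d) f z = f z"
  using \<gamma> z
proof (induction "nat (\<bar>c\<bar> + \<bar>d\<bar>)" arbitrary: a b c d z rule: less_induct)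
  case less
  have det: "a * d - b * c = 1" using less.prems by (simp add: SL2Z_def)
  have "odd d"
  proof
    assume "even d"
    with \<open>even c\<close> have "even (a * d - b * c)" by simp
    with det show False by simp
  qed
  have T_int: "f (z + of_int n) = f z" if "z \<in> upper_half_plane" for n z
  proof -
    have nat: "f (z + of_nat n) = f z" if "z \<in> upper_half_plane" for n z
    proof (induction n)
      case (Suc n)
      have "z + of_nat n \<in> upper_half_plane" using that by (simp add: upper_half_plane_def)
      from T[OF this] Suc show ?case by (simp add: add_ac)
    qed simp
    show ?thesis
    proof (cases "n \<ge> 0")
      case True
      then show ?thesis using nat[OF that, of "nat n"] by simp
    next
      case False
      have "z + of_int n \<in> upper_half_plane" using that by (simp add: upper_half_plane_def)
      from nat[OF this, of "nat (- n)"] False show ?thesis by simp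
    qed
  qed
  have T_slash: "slash w (1, n, 0, 1) f z = f z" if "z \<in> upper_half_plane" for n z
    using T_int[OF that] by (simp add: slash_def)
  have V_pos: "slash w (1, 0, 2, 1) f z = f z" if "z \<in> upper_half_plane" for z
    using V[OF that] SL2Z_mobius_upper_half_plane(2)[of 1 0 2 1, OF _ that]
    by (simp add: slash_def SL2Z_def)
  have V_neg: "slash w (1, 0, - 2, 1) f z = f z" if "z \<in> upper_half_plane" for z
  proof -
    have "slash w (1, 0, - 2, 1) f z = slash w (1, 0, - 2, 1) (slash w (1, 0, 2, 1) f) z"
      by (rule slash_cong[OF _ that]) (simp_all add: SL2Z_def V_pos)
    also have "\<dots> = slash w (1, 0, 0, 1) f z"
      by (subst slash_slash) (simp_all add: SL2Z_def that)
    finally show ?thesis by (simp add: slash_def)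
  qed
  \<comment> \<open>Writing the matrix as its product with a generator, times the inverse of that
    generator: invariance under both of these gives invariance under the matrix.\<close>
  have reduce: "slash w (a, b, c, d) f z = f z"
    if "slash w (a * a' + b * c', a * b' + b * d', c * a' + d * c', c * b' + d * d') f = g"
      and "(d', - b', - c', a') \<in> SL2Z" "(a', b', c', d') \<in> SL2Z"
      and "\<And>z. z \<in> upper_half_plane \<Longrightarrow> g z = f z"
      and "\<And>z. z \<in> upper_half_plane \<Longrightarrow> slash w (d', - b', - c', a') f z = f z"
    for a' b' c' d' g
  proof -
    have det': "a' * d' - b' * c' = 1" using that(3) by (simp add: SL2Z_def)
    have id: "x * a' * d' - x * b' * c' = x" "x * d' * a' - x * b' * c' = x" for x
      using det' by (metis mult.assoc mult.commute mult.right_neutral right_diff_distrib)+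
    have "f z = slash w (d', - b', - c', a') f z" using that(5) less.prems(3) by simp
    also have "\<dots> = slash w (d', - b', - c', a') g z"
      by (rule slash_cong[OF that(2) less.prems(3)]) (simp add: that(4))
    also have "\<dots> = slash w (a, b, c, d) f z"
      unfolding that(1)[symmetric]
      by (subst slash_slash[OF SL2Z_mult[OF less.prems(1) that(3)] that(2) less.prems(3)])
        (rule arg_cong[where f = "\<lambda>\<gamma>. slash w \<gamma> f z"], use id[of a] id[of b] id[of c] id[of d] in \<open>simp add: algebra_simps\<close>)
    finally show ?thesis by simp
  qed
  \<comment> \<open>Equality of the absolute values is excluded by parity.\<close>
  consider "c = 0" | "c \<noteq> 0" "\<bar>c\<bar> < \<bar>d\<bar>" | "\<bar>c\<bar> > \<bar>d\<bar>"
    using \<open>odd d\<close> \<open>even c\<close> by (metis abs_eq_iff even_minus linorder_neqE_linordered_idom)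
  then show ?case
  proof cases
    case 1
    then have "a * d = 1" using det by simp
    then consider "a = 1" "d = 1" | "a = - 1" "d = - 1" using zmult_eq_1_iff by auto
    then show ?thesis
    proof cases
      case 1
      then show ?thesis using \<open>c = 0\<close> T_slash[OF less.prems(3), of b] by simp
    next
      case 2
      \<comment> \<open>The matrix is minus a translation, and minus the identity acts trivially
        because \<open>w\<close> is even.\<close>
      then show ?thesis using \<open>c = 0\<close> T_int[OF less.prems(3), of "- b"] w by (simp add: slash_def)
    qed
  next
    case 2
    define s where "s = (if (c > 0) = (d > 0) then - 1 else 1 :: int)"
    have lt: "\<bar>d + s * c\<bar> < \<bar>d\<bar>" using 2 \<open>odd d\<close> by (auto simp: s_def)
    show ?thesis
    proof (rule reduce[of 1 0 s 1, OF refl])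
      show "slash w (a * 1 + b * 0, a * s + b * 1, c * 1 + d * 0, c * s + d * 1) f z = f z"
        if "z \<in> upper_half_plane" for z
      proof (rule less.hyps)
        show "nat (\<bar>c * 1 + d * 0\<bar> + \<bar>c * s + d * 1\<bar>) < nat (\<bar>c\<bar> + \<bar>d\<bar>)"
          using lt by (simp add: mult.commute add.commute)
        show "(a * 1 + b * 0, a * s + b * 1, c * 1 + d * 0, c * s + d * 1) \<in> SL2Z"
          by (rule SL2Z_mult[OF less.prems(1)]) (simp add: SL2Z_def)
      qed (use that less.prems in auto)
      show "slash w (1, - s, - 0, 1) f z = f z" if "z \<in> upper_half_plane" for z
        using T_slash[OF that] by simp
    qed (simp_all add: SL2Z_def)
  next
    case 3
    \<comment> \<open>A multiple of 2, so that the lower left entry stays even; the sign makes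
      \<open>s * d\<close> oppose \<open>c\<close>.\<close>
    define s where "s = (if (c > 0) = (d > 0) then - 2 else 2 :: int)"
    have "d \<noteq> 0" using \<open>odd d\<close> by auto
    then have lt: "\<bar>c + s * d\<bar> < \<bar>c\<bar>" using 3 by (auto simp: s_def)
    show ?thesis
    proof (rule reduce[of 1 s 0 1, OF refl])
      show "slash w (a * 1 + b * s, a * 0 + b * 1, c * 1 + d * s, c * 0 + d * 1) f z = f z"
        if "z \<in> upper_half_plane" for z
      proof (rule less.hyps)
        show "nat (\<bar>c * 1 + d * s\<bar> + \<bar>c * 0 + d * 1\<bar>) < nat (\<bar>c\<bar> + \<bar>d\<bar>)"
          using lt by (simp add: mult.commute)
        show "(a * 1 + b * s, a * 0 + b * 1, c * 1 + d * s, c * 0 + d * 1) \<in> SL2Z"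
          by (rule SL2Z_mult[OF less.prems(1)]) (simp add: SL2Z_def)
        show "even (c * 1 + d * s)" using less.prems by (simp add: s_def)
      qed (use that in auto)
      show "slash w (1, - 0, - s, 1) f z = f z" if "z \<in> upper_half_plane" for z
        using V_pos[OF that] V_neg[OF that] by (simp add: s_def)
    qed (simp_all add: SL2Z_def)
  qed
qed

section \<open>The eighth power of \<open>g_fun\<close> at the two cusps of level 2\<close>

lemma csqrt_power_even: "csqrt z ^ (2 * n) = z ^ n"
  by (simp add: power_mult)

lemma g_fun_power_8_plus_1:
  "z \<in> upper_half_plane \<Longrightarrow> g_fun (z + 1) ^ 8 = g_fun z ^ 8"
proof -
  assume z: "z \<in> upper_half_plane"
  then have "z + 1 \<in> upper_half_plane" by (simp add: upper_half_plane_def)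
  with z show ?thesis
    using phi_plus_1[of "z + 1/2"] by (simp add: g_fun_eq_phi add_ac)
qed

text \<open>Conjugated by the shift by 1/2, the map \<open>z / (2 * z + 1)\<close> is the inversion
  \<open>- 1 / (4 * z)\<close> followed by a translation by 1, under which \<open>phi\<close> is
  known.\<close>

lemma g_fun_power_8_V:
  assumes z: "z \<in> upper_half_plane"
  shows "g_fun (z / (2 * z + 1)) ^ 8 = (2 * z + 1) ^ 4 * g_fun z ^ 8"
proof -
  have SL: "(1, 0, 2, 1) \<in> SL2Z" by (simp add: SL2Z_def)
  have nz: "2 * z + 1 \<noteq> 0" and H: "z / (2 * z + 1) \<in> upper_half_plane"
    using SL2Z_mobius_upper_half_plane[OF SL z] by simp_all
  have z2: "z + 1/2 \<in> upper_half_plane" using z by (simp add: upper_half_plane_def)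
  have "z / (2 * z + 1) + 1/2 = - 1 / (4 * (z + 1/2)) + 1"
  proof -
    have "4 * (z + 1/2) = 2 * (2 * z + 1)" by (simp add: algebra_simps)
    moreover have "(x - 1) / 2 / x + 1/2 = - 1 / (2 * x) + 1" if "x \<noteq> 0" for x :: complex
      using that by (simp add: field_simps)
    from this[OF nz] have "z / (2 * z + 1) + 1/2 = - 1 / (2 * (2 * z + 1)) + 1" by simp
    ultimately show ?thesis by simp
  qed
  then have "g_fun (z / (2 * z + 1)) = phi (- 1 / (4 * (z + 1/2)))"
    using phi_plus_1[of "- 1 / (4 * (z + 1/2))"] by (simp only: g_fun_eq_phi[OF H])
  also have "\<dots> = csqrt (- 2 * \<i> * (z + 1/2)) * g_fun z"
    by (simp only: phi_transform[OF z2] g_fun_eq_phi[OF z])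
  finally have "g_fun (z / (2 * z + 1)) ^ 8 = csqrt (- 2 * \<i> * (z + 1/2)) ^ (2 * 4) * g_fun z ^ 8"
    by (simp add: power_mult_distrib)
  also have "csqrt (- 2 * \<i> * (z + 1/2)) ^ (2 * 4) = (- \<i> * (2 * z + 1)) ^ 4"
    unfolding csqrt_power_even by (rule arg_cong[where f = "\<lambda>x. x ^ 4"]) (simp add: algebra_simps)
  also have "\<dots> = (2 * z + 1) ^ 4" by (simp only: power_mult_distrib) simp
  finally show ?thesis .
qed

lemma g_fun_power_8_Gamma0_2:
  assumes "(a, b, c, d) \<in> SL2Z" "even c" "z \<in> upper_half_plane"
  shows "slash 4 (a, b, c, d) (\<lambda>z. g_fun z ^ 8) z = g_fun z ^ 8"
  by (rule Gamma0_2_invariant[OF g_fun_power_8_plus_1 g_fun_power_8_V _ assms]) auto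

lemma g_fun_holomorphic: "g_fun holomorphic_on upper_half_plane"
proof -
  have "(phi \<circ> (\<lambda>z. z + 1/2)) holomorphic_on upper_half_plane"
    by (rule holomorphic_on_compose_gen[OF _ phi_holomorphic])
      (auto intro!: holomorphic_intros simp: upper_half_plane_def)
  then show ?thesis by (rule holomorphic_transform) (simp add: g_fun_eq_phi)
qed

lemma filterlim_at_i_infinity_divide:
  assumes "r > 0"
  shows "filterlim (\<lambda>z. z / of_real r) at_i_infinity at_i_infinity"
  using filterlim_at_i_infinity_affine[of "1 / r" 0] assms by (simp add: divide_inverse mult.commute)

lemma g_fun_tendsto_1: "(g_fun \<longlongrightarrow> 1) at_i_infinity"
proof -
  have "((\<lambda>z. phi (z + 1/2)) \<longlongrightarrow> 1) at_i_infinity"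
    using filterlim_compose[OF phi_tendsto_1 filterlim_at_i_infinity_affine[of 1 "1/2"]] by simp
  moreover have "\<forall>\<^sub>F z in at_i_infinity. phi (z + 1/2) = g_fun z"
    using eventually_upper_half_plane by eventually_elim (simp add: g_fun_eq_phi)
  ultimately show ?thesis by (rule Lim_transform_eventually)
qed

text \<open>At \<open>- 1 / z\<close>, \<open>g_fun\<close> is a combination of two values of
  \<open>phi\<close>, which the inversion carries to \<open>z / 16\<close> and \<open>z / 4\<close>.
  Their square roots differ by a factor 2, so the combination becomes a difference, and its limit at
  infinity is \<open>1 - 1\<close>.\<close>

lemma g_fun_power_8_cusp_0:
  assumes z: "z \<in> upper_half_plane"
  shows "slash 4 (0, - 1, 1, 0) (\<lambda>z. g_fun z ^ 8) z = (phi (z / 16) - phi (z / 4)) ^ 8 / 16"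
proof -
  have nz: "z \<noteq> 0" using z by (auto simp: upper_half_plane_def)
  have H: "- 1 / z \<in> upper_half_plane" by (rule upper_half_plane_minus_inverse[OF z])
  have z': "z / 16 \<in> upper_half_plane" "z / 4 \<in> upper_half_plane"
    using z by (auto simp: upper_half_plane_def)
  have e: "4 * (- 1 / z) = - 1 / (4 * (z / 16))" "- 1 / z = - 1 / (4 * (z / 4))"
    using nz by (simp_all add: field_simps)
  have sq: "csqrt (- 2 * \<i> * (z / 4)) = 2 * csqrt (- 2 * \<i> * (z / 16))"
  proof (rule csqrt_unique)
    show "(2 * csqrt (- 2 * \<i> * (z / 16)))\<^sup>2 = - 2 * \<i> * (z / 4)"
      by (simp add: power_mult_distrib)
    show "0 < Re (2 * csqrt (- 2 * \<i> * (z / 16))) \<or>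
        Re (2 * csqrt (- 2 * \<i> * (z / 16))) = 0 \<and> 0 \<le> Im (2 * csqrt (- 2 * \<i> * (z / 16)))"
      using csqrt_principal[of "- 2 * \<i> * (z / 16)"] by (simp del: csqrt.simps)
  qed
  have p: "phi (4 * (- 1 / z)) = csqrt (- 2 * \<i> * (z / 16)) * phi (z / 16)"
    "phi (- 1 / z) = csqrt (- 2 * \<i> * (z / 4)) * phi (z / 4)"
    unfolding e(1) by (rule phi_transform[OF z'(1)], subst e(2), rule phi_transform[OF z'(2)])
  have "g_fun (- 1 / z) = 2 * phi (4 * (- 1 / z)) - phi (- 1 / z)"
    by (simp only: g_fun_eq_phi[OF H] phi_plus_half[OF H])
  also have "\<dots> = csqrt (- 2 * \<i> * (z / 4)) * (phi (z / 16) - phi (z / 4))"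
    by (simp only: p sq right_diff_distrib) (simp only: mult.assoc)
  finally have "g_fun (- 1 / z) ^ 8 = csqrt (- 2 * \<i> * (z / 4)) ^ (2 * 4) * (phi (z / 16) - phi (z / 4)) ^ 8"
    by (simp add: power_mult_distrib)
  also have "csqrt (- 2 * \<i> * (z / 4)) ^ (2 * 4) = z ^ 4 / 16"
    unfolding csqrt_power_even power_mult_distrib power_divide by simp
  finally show ?thesis using nz by (simp add: slash_def)
qed

text \<open>For even \<open>c\<close> the matrix leaves the eighth power invariant, and the limit is
  that at infinity. For odd \<open>c\<close> it is reduced to the inversion, hence to the vanishing
  at the cusp 0.\<close>

lemma g_fun_power_8_cusp_limit:
  assumes \<gamma>: "(a, b, c, d) \<in> SL2Z"
  shows "(slash 4 (a, b, c, d) (\<lambda>z. g_fun z ^ 8) \<longlongrightarrow> (if even c then 1 else 0)) at_i_infinity"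
proof (cases "even c")
  case True
  have "((\<lambda>z. g_fun z ^ 8) \<longlongrightarrow> 1 ^ 8) at_i_infinity"
    by (intro tendsto_power g_fun_tendsto_1)
  moreover have "\<forall>\<^sub>F z in at_i_infinity. g_fun z ^ 8 = slash 4 (a, b, c, d) (\<lambda>z. g_fun z ^ 8) z"
    using eventually_upper_half_plane
    by eventually_elim (simp add: g_fun_power_8_Gamma0_2[OF \<gamma> True])
  ultimately show ?thesis using True by (simp add: Lim_transform_eventually)
next
  case False
  have det: "a * d - b * c = 1" using \<gamma> by (simp add: SL2Z_def)
  have S: "(0, - 1, 1, 0) \<in> SL2Z" and Td: "(1, d, 0, 1) \<in> SL2Z" and ST: "(0, - 1, 1, d) \<in> SL2Z"
    by (simp_all add: SL2Z_def)
  \<comment> \<open>\<open>\<gamma> = \<gamma>' S T\<^sup>d\<close> with \<open>\<gamma>'\<close> of lower left entry \<open>c d - d\<close>, which is even.\<close>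
  define a' b' c' d' where "a' = d * a - b" and "b' = a" and "c' = d * c - d" and "d' = c"
  have "a' * d' - b' * c' = a * d - b * c" by (simp add: a'_def b'_def c'_def d'_def algebra_simps)
  then have \<gamma>': "(a', b', c', d') \<in> SL2Z" using det by (simp add: SL2Z_def)
  have "even c'" using False by (simp add: c'_def)
  let ?f = "\<lambda>z. g_fun z ^ 8"
  have eq: "slash 4 (a, b, c, d) ?f z = (phi ((z + of_int d) / 16) - phi ((z + of_int d) / 4)) ^ 8 / 16"
    if z: "z \<in> upper_half_plane" for z
  proof -
    have zd: "z + of_int d \<in> upper_half_plane" using z by (simp add: upper_half_plane_def)
    have "slash 4 (a, b, c, d) ?f z = slash 4 (0, - 1, 1, d) (slash 4 (a', b', c', d') ?f) z"
      by (subst slash_slash[OF \<gamma>' ST z]) (simp add: a'_def b'_def c'_def d'_def algebra_simps)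
    also have "\<dots> = slash 4 (0, - 1, 1, d) ?f z"
      by (rule slash_cong[OF ST z]) (rule g_fun_power_8_Gamma0_2[OF \<gamma>' \<open>even c'\<close>])
    also have "\<dots> = slash 4 (0, - 1, 1, 0) ?f (z + of_int d)"
      by (simp add: slash_def)
    finally show ?thesis by (simp only: g_fun_power_8_cusp_0[OF zd])
  qed
  have lim: "((\<lambda>z. phi ((z + of_int d) / of_real r)) \<longlongrightarrow> 1) at_i_infinity" if "r > 0" for r
  proof -
    have "filterlim (\<lambda>z. (z + of_int d) / of_real r) at_i_infinity at_i_infinity"
      using filterlim_compose[OF filterlim_at_i_infinity_divide[OF that] filterlim_at_i_infinity_affine[of 1 "of_int d"]]
      by simp
    then show ?thesis by (rule filterlim_compose[OF phi_tendsto_1])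
  qed
  have "((\<lambda>z. (phi ((z + of_int d) / of_real 16) - phi ((z + of_int d) / of_real 4)) ^ 8 / 16) \<longlongrightarrow> (1 - 1) ^ 8 / 16) at_i_infinity"
    by (intro tendsto_intros lim) auto
  then have "((\<lambda>z. (phi ((z + of_int d) / 16) - phi ((z + of_int d) / 4)) ^ 8 / 16) \<longlongrightarrow> 0) at_i_infinity"
    by simp
  moreover have "\<forall>\<^sub>F z in at_i_infinity. (phi ((z + of_int d) / 16) - phi ((z + of_int d) / 4)) ^ 8 / 16
      = slash 4 (a, b, c, d) ?f z"
    using eventually_upper_half_plane by eventually_elim (simp only: eq)
  ultimately have "(slash 4 (a, b, c, d) ?f \<longlongrightarrow> 0) at_i_infinity"
    by (rule Lim_transform_eventually)
  then show ?thesis using False by simp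
qed

section \<open>Values at the cusps\<close>

text \<open>\<open>diag(\<delta>, 1) \<gamma>\<close> is the product of a matrix of \<open>SL2Z\<close> and the upper triangular matrix
  \<open>(A, B; 0, D)\<close>.\<close>

lemma scaled_matrix_decomposition:
  fixes \<delta> :: nat
  assumes \<gamma>: "(a, b, c, d) \<in> SL2Z" and \<delta>: "\<delta> > 0"
  obtains A B D a' b' c' d' where
    "A = gcd c (int \<delta>)" "A > 0" "D > 0" "A * D = int \<delta>" "c = A * c'" "(a', b', c', d') \<in> SL2Z"
    "int \<delta> * a = a' * A" "int \<delta> * b = a' * B + b' * D" "d = c' * B + d' * D"
proof -
  have det: "a * d - b * c = 1" using \<gamma> by (simp add: SL2Z_def)
  define A where "A = gcd c (int \<delta>)"
  have "A > 0" using \<delta> by (simp add: A_def)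
  obtain c' where c': "c = A * c'" using dvdE[of A c] by (auto simp: A_def)
  obtain D where D: "int \<delta> = A * D" using dvdE[of A "int \<delta>"] by (auto simp: A_def)
  have "D > 0" using D \<open>A > 0\<close> \<delta> by (metis of_nat_0_less_iff zero_less_mult_pos)
  \<comment> \<open>The column \<open>(D * a, c')\<close> is to be completed to a matrix of
    determinant 1, for which its entries must be coprime.\<close>
  have "coprime D c'"
  proof -
    have "A * gcd c' D = A"
      using gcd_mult_left[of A c' D] \<open>A > 0\<close> by (simp add: A_def[symmetric] c'[symmetric] D[symmetric])
    then show ?thesis using \<open>A > 0\<close> by (simp add: coprime_iff_gcd_eq_1 gcd.commute)
  qed
  moreover have "coprime a c'"
  proof (rule coprimeI)
    fix x assume "x dvd a" "x dvd c'"
    then have "x dvd a * d - b * c" unfolding c' by simp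
    then show "is_unit x" using det by simp
  qed
  ultimately have "coprime (D * a) c'" by simp
  then obtain x y where xy: "x * (D * a) + y * c' = 1"
    using bezout_int[of "D * a" c'] by (auto simp: coprime_iff_gcd_eq_1)
  \<comment> \<open>The second column consists of Bezout coefficients; \<open>B\<close> is then
    forced, being the upper right entry after multiplication by the inverse matrix.\<close>
  define a' b' d' B where "a' = D * a" and "b' = - y" and "d' = x" and "B = d' * (int \<delta> * b) - b' * d"
  have det': "a' * d' - b' * c' = 1" using xy by (simp add: a'_def b'_def d'_def algebra_simps)
  have Dd: "a' * d - c' * (int \<delta> * b) = D"
  proof -
    have "a' * d - c' * (int \<delta> * b) = D * (a * d - b * (A * c'))"
      by (simp add: a'_def D algebra_simps)
    then show ?thesis using det c' by simp
  qed
  show ?thesis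
  proof (rule that[OF A_def \<open>A > 0\<close> \<open>D > 0\<close> D[symmetric] c'])
    show "(a', b', c', d') \<in> SL2Z" using det' by (simp add: SL2Z_def)
    show "int \<delta> * a = a' * A" by (simp add: a'_def D mult_ac)
    have "a' * B + b' * (a' * d - c' * (int \<delta> * b)) = (a' * d' - b' * c') * (int \<delta> * b)"
      by (simp add: B_def algebra_simps)
    then show "int \<delta> * b = a' * B + b' * D" by (simp only: Dd det' mult_1)
    have "c' * B + d' * (a' * d - c' * (int \<delta> * b)) = (a' * d' - b' * c') * d"
      by (simp add: B_def algebra_simps)
    then show "d = c' * B + d' * D" by (simp only: Dd det' mult_1)
  qed
qed

text \<open>Both sides express the action of \<open>diag(\<delta>, 1)\<close> times the given
  matrix: at the point \<open>u\<close>, numerator and denominator for the primed matrix are those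
  of this product divided by \<open>D\<close>.\<close>

lemma slash_scale:
  fixes \<delta> :: nat and A B D :: int
  assumes "c = A * c'" "int \<delta> * a = a' * A" "int \<delta> * b = a' * B + b' * D" "d = c' * B + d' * D" "D \<noteq> 0"
  shows "slash w (a, b, c, d) (\<lambda>z. f (of_nat \<delta> * z)) z
    = slash w (a', b', c', d') f ((of_int A * z + of_int B) / of_int D) / of_int D ^ w"
proof -
  define u where "u = (of_int A * z + of_int B) / of_int D"
  have D: "(of_int D :: complex) \<noteq> 0" using assms(5) by simp
  have Du: "of_int D * u = of_int A * z + of_int B" using D by (simp add: u_def)
  have "of_int D * (of_int a' * u + of_int b') = of_int a' * (of_int D * u) + of_int (b' * D)"
    by (simp add: algebra_simps)
  also have "\<dots> = of_int (a' * A) * z + of_int (a' * B + b' * D)"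
    unfolding Du by (simp add: algebra_simps)
  also have "\<dots> = of_nat \<delta> * (of_int a * z + of_int b)"
    unfolding assms(2,3)[symmetric] by (simp add: algebra_simps)
  finally have num: "of_int a' * u + of_int b' = of_nat \<delta> * (of_int a * z + of_int b) / of_int D"
    using D by (simp add: field_simps)
  have "of_int D * (of_int c' * u + of_int d') = of_int c' * (of_int D * u) + of_int (d' * D)"
    by (simp add: algebra_simps)
  also have "\<dots> = of_int (A * c') * z + of_int (c' * B + d' * D)"
    unfolding Du by (simp add: algebra_simps)
  also have "\<dots> = of_int c * z + of_int d" unfolding assms(1,4) ..
  finally have den: "of_int c' * u + of_int d' = (of_int c * z + of_int d) / of_int D"
    using D by (simp add: field_simps)
  show ?thesis
    unfolding u_def[symmetric] slash_def prod.case num den using D by (simp add: power_divide)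
qed

text \<open>If \<open>\<delta>\<close> divides \<open>c\<close>, the triangular factor is
  \<open>diag(\<delta>, 1)\<close>, that is \<open>A = \<delta>\<close>, \<open>B = 0\<close>,
  \<open>D = 1\<close>. The invariance of \<open>f\<close> is assumed for the lower left entry
  \<open>c div \<delta>\<close> alone, so that a parity condition on it can be used.\<close>

lemma slash_scale_invariant:
  assumes \<gamma>: "(a, b, c, d) \<in> SL2Z" "int \<delta> dvd c" and "\<delta> > 0"
    and inv: "\<And>a b d z. (a, b, c div int \<delta>, d) \<in> SL2Z \<Longrightarrow> z \<in> upper_half_plane \<Longrightarrow>
      slash w (a, b, c div int \<delta>, d) f z = f z"
    and z: "z \<in> upper_half_plane"
  shows "slash w (a, b, c, d) (\<lambda>z. f (of_nat \<delta> * z)) z = f (of_nat \<delta> * z)"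
proof -
  define c' where "c' = c div int \<delta>"
  have c: "c = int \<delta> * c'" using assms(2) by (simp add: c'_def)
  have "slash w (a, b, c, d) (\<lambda>z. f (of_nat \<delta> * z)) z = slash w (a, int \<delta> * b, c', d) f (of_nat \<delta> * z)"
    using slash_scale[of c "int \<delta>" c' \<delta> a a b 0 "int \<delta> * b" 1 d d w f z] c by simp
  also have "\<dots> = f (of_nat \<delta> * z)"
    unfolding c'_def
  proof (rule inv)
    show "(a, int \<delta> * b, c div int \<delta>, d) \<in> SL2Z"
      using \<gamma>(1) unfolding c'_def[symmetric] by (simp add: SL2Z_def c mult_ac)
    show "of_nat \<delta> * z \<in> upper_half_plane" using z assms(3) by (simp add: upper_half_plane_def)
  qed
  finally show ?thesis .
qed

text \<open>The affine map by the triangular factor preserves the approach to infinity, so only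
  \<open>D ^ w\<close> changes the limit, and \<open>1 / D\<close> is \<open>A / \<delta>\<close>
  with \<open>A\<close> the gcd.\<close>

lemma slash_scale_tendsto:
  assumes \<gamma>: "(a, b, c, d) \<in> SL2Z" and \<delta>: "\<delta> > 0"
    and lim: "\<And>a b d. (a, b, c div gcd c (int \<delta>), d) \<in> SL2Z \<Longrightarrow>
      (slash w (a, b, c div gcd c (int \<delta>), d) f \<longlongrightarrow> L) at_i_infinity"
  shows "(slash w (a, b, c, d) (\<lambda>z. f (of_nat \<delta> * z)) \<longlongrightarrow> L * (of_int (gcd c (int \<delta>)) / of_nat \<delta>) ^ w) at_i_infinity"
proof -
  obtain A B D a' b' c' d' where dec: "A = gcd c (int \<delta>)" "A > 0" "D > 0" "A * D = int \<delta>" "c = A * c'"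
    "(a', b', c', d') \<in> SL2Z" "int \<delta> * a = a' * A" "int \<delta> * b = a' * B + b' * D" "d = c' * B + d' * D"
    by (rule scaled_matrix_decomposition[OF \<gamma> \<delta>])
  have c': "c div gcd c (int \<delta>) = c'" using dec(1,2,5) by (metis less_irrefl nonzero_mult_div_cancel_left)
  have "(slash w (a', b', c', d') f \<longlongrightarrow> L) at_i_infinity" using lim dec(6) unfolding c' by blast
  moreover have "filterlim (\<lambda>z. (of_int A * z + of_int B) / of_int D) at_i_infinity at_i_infinity"
    using filterlim_at_i_infinity_affine[of "real_of_int A / real_of_int D" "real_of_int B / real_of_int D"] dec(2,3)
    by (simp add: add_divide_distrib)
  ultimately have "((\<lambda>z. slash w (a', b', c', d') f ((of_int A * z + of_int B) / of_int D)) \<longlongrightarrow> L) at_i_infinity"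
    by (rule filterlim_compose)
  then have "((\<lambda>z. slash w (a', b', c', d') f ((of_int A * z + of_int B) / of_int D) / of_int D ^ w) \<longlongrightarrow> L / of_int D ^ w) at_i_infinity"
    using dec(3) by (intro tendsto_divide tendsto_const) auto
  moreover have "slash w (a, b, c, d) (\<lambda>z. f (of_nat \<delta> * z))
    = (\<lambda>z. slash w (a', b', c', d') f ((of_int A * z + of_int B) / of_int D) / of_int D ^ w)"
    by (rule ext, rule slash_scale[OF dec(5,7,8,9)]) (use dec(3) in simp)
  moreover have "of_int A / of_nat \<delta> = 1 / (of_int D :: complex)"
  proof -
    have "(of_nat \<delta> :: complex) = of_int (A * D)" unfolding dec(4) by simp
    then show ?thesis using dec(2) by simp
  qed
  ultimately show ?thesis
    unfolding dec(1)[symmetric] by (simp add: power_divide)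
qed

text \<open>A limit at every cusp implies the required boundedness; it may depend on the lower left
  entry, as it does for the eta product.\<close>

lemma modular_formsI:
  assumes "f holomorphic_on upper_half_plane"
    and "\<And>a b c d z. (a, b, c, d) \<in> SL2Z \<Longrightarrow> int M dvd c \<Longrightarrow> z \<in> upper_half_plane \<Longrightarrow> slash w (a, b, c, d) f z = f z"
    and "\<And>a b c d. (a, b, c, d) \<in> SL2Z \<Longrightarrow> (slash w (a, b, c, d) f \<longlongrightarrow> L c) at_i_infinity"
  shows "f \<in> modular_forms w M"
proof -
  have "Bfun (slash w (a, b, c, d) f) at_i_infinity" if "(a, b, c, d) \<in> SL2Z" for a b c d
  proof (rule BfunI)
    have "\<forall>\<^sub>F z in at_i_infinity. dist (slash w (a, b, c, d) f z) (L c) < 1"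
      using assms(3)[OF that] by (rule tendstoD) simp
    then show "\<forall>\<^sub>F z in at_i_infinity. norm (slash w (a, b, c, d) f z) \<le> norm (L c) + 1"
    proof eventually_elim
      case (elim z)
      then show ?case using norm_triangle_sub[of "slash w (a, b, c, d) f z" "L c"] by (simp add: dist_norm)
    qed
  qed
  then show ?thesis using assms(1,2) by (auto simp: modular_forms_def Gamma0_def)
qed

lemma slash_prod_powers:
  assumes "finite I" "w = (\<Sum>i\<in>I. v * r i)"
  shows "slash w \<gamma> (\<lambda>z. \<Prod>i\<in>I. f i z ^ r i) z = (\<Prod>i\<in>I. slash v \<gamma> (f i) z ^ r i)"
  by (cases \<gamma>) (simp add: slash_def assms(2) power_divide power_sum power_mult prod_dividef)

lemma slash_sum:
  "slash w \<gamma> (\<lambda>z. \<Sum>i\<in>I. a i * f i z) z = (\<Sum>i\<in>I. a i * slash w \<gamma> (f i) z)"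
  by (cases \<gamma>) (simp add: slash_def sum_divide_distrib)

lemma slash_diff: "slash w \<gamma> (\<lambda>z. f z - g z) z = slash w \<gamma> f z - slash w \<gamma> g z"
  by (cases \<gamma>) (simp add: slash_def diff_divide_distrib)

section \<open>The gcd matrix on the divisors of a square-free number\<close>

lemma omega_1 [simp]: "omega 1 = 0" "omega (Suc 0) = 0"
  by (simp_all add: omega_def)

lemma prime_factors_prime_mult:
  fixes p d :: nat
  assumes "prime p" "d > 0"
  shows "prime_factors (p * d) = insert p (prime_factors d)"
  using assms by (auto simp: prime_factorization_mult prime_factorization_prime prime_gt_0_nat)

lemma omega_prime_mult:
  assumes "prime p" "\<not> p dvd d" "d > 0"
  shows "omega (p * d) = Suc (omega d)"
  using assms by (simp add: omega_def prime_factors_prime_mult in_prime_factors_iff)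

lemma sum_divisors_prime_mult:
  fixes f :: "nat \<Rightarrow> 'a :: comm_monoid_add"
  assumes "prime p" "\<not> p dvd M" "M > 0"
  shows "(\<Sum>d | d dvd p * M. f d) = (\<Sum>d | d dvd M. f d + f (p * d))"
proof -
  have fin: "finite {d. d dvd M}" using assms(3) by simp
  have "p > 0" using assms(1) by (simp add: prime_gt_0_nat)
  have "{d. d dvd p * M} = {d. d dvd M} \<union> (*) p ` {d. d dvd M}"
  proof (intro equalityI subsetI)
    fix d assume d: "d \<in> {d. d dvd p * M}"
    show "d \<in> {d. d dvd M} \<union> (*) p ` {d. d dvd M}"
    proof (cases "p dvd d")
      case True
      then obtain e where "d = p * e" ..
      then show ?thesis using d \<open>p > 0\<close> by simp
    next
      case False
      then have "coprime d p" using assms(1) by (metis coprime_commute prime_imp_coprime)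
      then show ?thesis using d by (simp add: coprime_dvd_mult_right_iff)
    qed
  qed auto
  moreover have "{d. d dvd M} \<inter> (*) p ` {d. d dvd M} = {}"
    using assms(2) by (auto dest: dvd_mult_left)
  moreover have "inj_on ((*) p) {d. d dvd M}"
    using \<open>p > 0\<close> by (auto simp: inj_on_def)
  ultimately show ?thesis
    using fin by (simp add: sum.union_disjoint sum.reindex sum.distrib)
qed

lemma gcd_prime_mult_left:
  fixes p c d :: nat
  assumes "prime p" "\<not> p dvd d"
  shows "gcd (p * c) d = gcd c d" "gcd d (p * c) = gcd d c"
proof -
  have "coprime p d" using assms by (simp add: prime_imp_coprime)
  then show "gcd (p * c) d = gcd c d" by (simp add: gcd_mult_left_left_cancel coprime_commute)
  then show "gcd d (p * c) = gcd d c" by (simp add: gcd.commute)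
qed

text \<open>The matrices with entries \<open>(gcd e d / d) ^ w\<close> and
  \<open>(- 1) ^ (omega d + omega c) * (M * gcd c d / c) ^ w\<close>, indexed by the divisors of a square-free
  \<open>M\<close>, are Kronecker products over the primes dividing \<open>M\<close> of \<open>2 \<times> 2\<close> matrices that are inverse to
  each other up to the factor \<open>p ^ w - 1\<close>.\<close>

lemma sum_divisors_gcd_kernel:
  fixes M c e w :: nat
  assumes "squarefree M" "c dvd M" "e dvd M"
  shows "(\<Sum>d | d dvd M. (- 1) ^ (omega d + omega c) * (of_nat (M * gcd c d * gcd e d) / of_nat (c * d)) ^ w)
     = (if c = e then \<Prod>p\<in>prime_factors M. of_nat p ^ w - 1 else (0 :: complex))"
  using assms
proof (induction M arbitrary: c e rule: less_induct)
  case (less M)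
  define T :: "nat \<Rightarrow> nat \<Rightarrow> nat \<Rightarrow> nat \<Rightarrow> complex" where
    "T M c e d = (- 1) ^ (omega d + omega c) * (of_nat (M * gcd c d * gcd e d) / of_nat (c * d)) ^ w" for M c e d
  have "M > 0" using less.prems(1) by (cases "M = 0") auto
  show ?case
  proof (cases "M = 1")
    case True
    then show ?thesis using less.prems by simp
  next
    case False
    then obtain p where p: "prime p" "p dvd M" using prime_factor_nat by blast
    then obtain M' where M: "M = p * M'" by (auto elim: dvdE)
    have "M' > 0" "M' < M" "p > 0" using M \<open>M > 0\<close> prime_gt_1_nat[OF p(1)] by auto
    have pM': "\<not> p dvd M'"
    proof
      assume "p dvd M'"
      then have "p\<^sup>2 dvd M" by (simp add: M power2_eq_square)
      then show False using less.prems(1) p(1) by (auto simp: squarefree_def)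
    qed
    have "squarefree M'" using less.prems(1) M by (metis dvd_triv_right squarefree_mono)
    have IH: "(\<Sum>d | d dvd M'. T M' c e d) = (if c = e then \<Prod>p\<in>prime_factors M'. of_nat p ^ w - 1 else 0)"
      if "c dvd M'" "e dvd M'" for c e
      unfolding T_def by (rule less.IH[OF \<open>M' < M\<close> \<open>squarefree M'\<close> that])
    have divisor: "\<exists>c'. c' dvd M' \<and> (c = c' \<or> c = p * c')" if "c dvd M" for c
    proof (cases "p dvd c")
      case True
      then obtain c' where "c = p * c'" ..
      then show ?thesis using that M \<open>p > 0\<close> by auto
    next
      case False
      then have "coprime c p" using p(1) by (metis coprime_commute prime_imp_coprime)
      then show ?thesis using that M by (auto simp: coprime_dvd_mult_right_iff)
    qed
    have nd: "\<not> p dvd d" "d > 0" if "d dvd M'" for d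
      using that pM' \<open>M' > 0\<close> by (auto intro: dvd_trans dvd_pos_nat)
    have p0: "of_nat p \<noteq> (0 :: complex)" using \<open>p > 0\<close> by simp
    obtain c' e' where c': "c' dvd M'" "c = c' \<or> c = p * c'" and e': "e' dvd M'" "e = e' \<or> e = p * e'"
      using divisor less.prems by meson
    have pc: "p * c' \<noteq> e'" "p * e' \<noteq> c'" using nd(1)[OF c'(1)] nd(1)[OF e'(1)] dvd_triv_left by metis+
    have pf: "(\<Prod>p\<in>prime_factors M. of_nat p ^ w - 1)
        = (of_nat p ^ w - 1) * (\<Prod>p\<in>prime_factors M'. of_nat p ^ w - (1 :: complex))"
      using p(1) \<open>M' > 0\<close> pM' by (simp add: M prime_factors_prime_mult in_prime_factors_iff)
    \<comment> \<open>The local factor at \<open>p\<close>: with \<open>d\<close> and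
      \<open>p * d\<close> taken together, the signed sum is \<open>p ^ w - 1\<close> if
      \<open>p\<close> divides both or neither of \<open>c\<close> and \<open>e\<close>, and cancels
      otherwise.\<close>
    have "T M c e d + T M c e (p * d)
        = (if c = c' \<and> e = e' \<or> c = p * c' \<and> e = p * e' then of_nat p ^ w - 1 else 0) * T M' c' e' d"
      if "d dvd M'" for d
    proof -
      have nz: "d \<noteq> 0" "c' \<noteq> 0" "e' \<noteq> 0" "M' \<noteq> 0" "p \<noteq> 0" "Suc 0 \<noteq> p"
        using nd(2)[OF that] nd(2)[OF c'(1)] nd(2)[OF e'(1)] \<open>M' > 0\<close> \<open>p > 0\<close> prime_gt_1_nat[OF p(1)] by auto
      note simps = T_def M gcd_prime_mult_left[OF p(1)] nd[OF that] nd[OF c'(1)] nd[OF e'(1)]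
        omega_prime_mult[OF p(1)] gcd_mult_distrib_nat[symmetric] power_divide power_mult_distrib nz
      show ?thesis
        using c'(2) e'(2) pc
        by (elim disjE) (simp_all add: simps, (simp_all add: field_simps nz)?, (simp_all add: diff_divide_distrib)?)
    qed
    then have "(\<Sum>d | d dvd M. T M c e d)
        = (if c = c' \<and> e = e' \<or> c = p * c' \<and> e = p * e' then of_nat p ^ w - 1 else 0) * (\<Sum>d | d dvd M'. T M' c' e' d)"
      using sum_divisors_prime_mult[OF p(1) pM' \<open>M' > 0\<close>, of "T M c e"]
      by (simp add: M sum_distrib_left)
    also have "\<dots> = (if c = e then \<Prod>p\<in>prime_factors M. of_nat p ^ w - 1 else 0)"
      using c'(2) e'(2) pc \<open>p > 0\<close> prime_gt_1_nat[OF p(1)] nd(2)[OF c'(1)] unfolding IH[OF c'(1) e'(1)] pf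
      by auto
    finally show ?thesis by (simp add: T_def)
  qed
qed

section \<open>Combinations of Eisenstein series and uniqueness of the cuspidal part\<close>

lemma eisenstein_series_tendsto_1:
  assumes "k \<ge> 2"
  shows "(eisenstein_series k \<longlongrightarrow> 1) at_i_infinity"
  using nome_series_tendsto[OF eisenstein_series_sums[OF _ assms]] by (simp add: eisenstein_coeff_def)

lemma eisenstein_series_holomorphic:
  assumes "k \<ge> 2"
  shows "eisenstein_series k holomorphic_on upper_half_plane"
  using nome_series_holomorphic[OF eisenstein_series_sums[OF _ assms]] by blast

lemma holomorphic_on_upper_half_plane_scale:
  assumes "f holomorphic_on upper_half_plane" "\<delta> > 0"
  shows "(\<lambda>z. f (of_nat \<delta> * z)) holomorphic_on upper_half_plane"
proof -
  have "(f \<circ> (\<lambda>z. of_nat \<delta> * z)) holomorphic_on upper_half_plane"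
    by (rule holomorphic_on_compose_gen[OF _ assms(1)])
      (use assms(2) in \<open>auto intro!: holomorphic_intros simp: upper_half_plane_def\<close>)
  then show ?thesis by (simp add: comp_def)
qed

lemma eisenstein_series_scale_invariant:
  assumes "(a, b, c, d) \<in> SL2Z" "int M dvd c" "\<delta> dvd M" "\<delta> > 0" "z \<in> upper_half_plane" "k \<ge> 2"
  shows "slash (2 * k) (a, b, c, d) (\<lambda>z. eisenstein_series k (of_nat \<delta> * z)) z = eisenstein_series k (of_nat \<delta> * z)"
proof (rule slash_scale_invariant[OF assms(1) _ assms(4)])
  show "int \<delta> dvd c" using assms(2,3) by (meson dvd_trans int_dvd_int_iff)
qed (use assms eisenstein_series_slash in auto)

lemma eisenstein_series_scale_tendsto:
  assumes "(a, b, c, d) \<in> SL2Z" "\<delta> > 0" "k \<ge> 2"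
  shows "(slash (2 * k) (a, b, c, d) (\<lambda>z. eisenstein_series k (of_nat \<delta> * z))
    \<longlongrightarrow> (of_int (gcd c (int \<delta>)) / of_nat \<delta>) ^ (2 * k)) at_i_infinity"
proof -
  have "(slash (2 * k) (a, b, c, d) (eisenstein_series k) \<longlongrightarrow> 1) at_i_infinity"
    if "(a, b, c, d) \<in> SL2Z" for a b c d
  proof (rule Lim_transform_eventually[OF eisenstein_series_tendsto_1[OF assms(3)]])
    show "\<forall>\<^sub>F z in at_i_infinity. eisenstein_series k z = slash (2 * k) (a, b, c, d) (eisenstein_series k) z"
      using eventually_upper_half_plane
      by eventually_elim (simp add: eisenstein_series_slash[OF that _ assms(3)])
  qed
  then have "(slash (2 * k) (a, b, c, d) (\<lambda>z. eisenstein_series k (of_nat \<delta> * z))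
    \<longlongrightarrow> 1 * (of_int (gcd c (int \<delta>)) / of_nat \<delta>) ^ (2 * k)) at_i_infinity"
    by (intro slash_scale_tendsto[OF assms(1,2)])
  then show ?thesis by simp
qed

definition eisenstein_combination :: "nat \<Rightarrow> nat \<Rightarrow> (nat \<Rightarrow> complex) \<Rightarrow> complex \<Rightarrow> complex" where
  "eisenstein_combination k M a z = (\<Sum>d | d dvd M. a d * eisenstein_series k (of_nat d * z))"

context
  fixes k M :: nat
  assumes k: "k \<ge> 2" and M: "M > 0"
begin

lemma eisenstein_combination_holomorphic:
  "eisenstein_combination k M a holomorphic_on upper_half_plane"
  unfolding eisenstein_combination_def using M
  by (intro holomorphic_intros holomorphic_on_upper_half_plane_scale eisenstein_series_holomorphic k)
    (auto intro: dvd_pos_nat)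

lemma eisenstein_combination_invariant:
  assumes "(a, b, c, d) \<in> SL2Z" "int M dvd c" "z \<in> upper_half_plane"
  shows "slash (2 * k) (a, b, c, d) (eisenstein_combination k M x) z = eisenstein_combination k M x z"
  unfolding eisenstein_combination_def[abs_def] slash_sum
proof (rule sum.cong)
  fix \<delta> assume "\<delta> \<in> {d. d dvd M}"
  then have "\<delta> dvd M" "\<delta> > 0" using M by (auto intro: dvd_pos_nat)
  then show "x \<delta> * slash (2 * k) (a, b, c, d) (\<lambda>z. eisenstein_series k (of_nat \<delta> * z)) z
      = x \<delta> * eisenstein_series k (of_nat \<delta> * z)"
    by (simp only: eisenstein_series_scale_invariant[OF assms(1,2) _ _ assms(3) k])
qed simp

lemma eisenstein_combination_tendsto:
  assumes "(a, b, c, d) \<in> SL2Z"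
  shows "(slash (2 * k) (a, b, c, d) (eisenstein_combination k M x)
    \<longlongrightarrow> (\<Sum>\<delta> | \<delta> dvd M. x \<delta> * (of_int (gcd c (int \<delta>)) / of_nat \<delta>) ^ (2 * k))) at_i_infinity"
proof -
  have "slash (2 * k) (a, b, c, d) (eisenstein_combination k M x)
      = (\<lambda>z. \<Sum>\<delta> | \<delta> dvd M. x \<delta> * slash (2 * k) (a, b, c, d) (\<lambda>z. eisenstein_series k (of_nat \<delta> * z)) z)"
    unfolding eisenstein_combination_def[abs_def] slash_sum[abs_def] ..
  then show ?thesis
    using M by (simp only:) (intro tendsto_sum tendsto_mult tendsto_const eisenstein_series_scale_tendsto assms k,
      auto intro: dvd_pos_nat)
qed

lemma eisenstein_combination_cuspidal_imp_zero:
  assumes "squarefree M"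
    and lim: "\<And>a b c d. (a, b, c, d) \<in> SL2Z \<Longrightarrow> (slash (2 * k) (a, b, c, d) (eisenstein_combination k M x) \<longlongrightarrow> 0) at_i_infinity"
    and "\<delta> dvd M"
  shows "x \<delta> = 0"
proof -
  let ?w = "2 * k"
  have zero: "(\<Sum>d | d dvd M. x d * (of_nat (gcd e d) / of_nat d) ^ ?w) = 0" for e
  proof -
    \<comment> \<open>These matrices realise every denominator \<open>e\<close>, so vanishing at the
      cusps becomes one linear equation for each divisor of \<open>M\<close>.\<close>
    have SL: "(1, 0, int e, 1) \<in> SL2Z" by (simp add: SL2Z_def)
    have "(\<Sum>d | d dvd M. x d * (of_int (gcd (int e) (int d)) / of_nat d) ^ ?w) = 0"
      by (rule tendsto_unique[OF _ eisenstein_combination_tendsto[OF SL] lim[OF SL]]) simp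
    then show ?thesis by (simp add: gcd_int_int_eq)
  qed
  let ?K = "\<lambda>c e d. (- 1) ^ (omega d + omega c) * (of_nat (M * gcd c d * gcd e d) / of_nat (c * d)) ^ ?w :: complex"
  have K: "(\<Sum>e | e dvd M. ?K d \<delta> e) = (if d = \<delta> then \<Prod>p\<in>prime_factors M. of_nat p ^ ?w - 1 else 0)" if "d dvd M" for d
    by (rule sum_divisors_gcd_kernel[OF assms(1) that assms(3)])
  \<comment> \<open>Row \<open>\<delta>\<close> of the inverse matrix is applied to the system. The
    kernel \<open>?K d \<delta> e\<close> carries a sign in \<open>d\<close> as well, which the
    factor \<open>(- 1) ^ omega d\<close> in the next step undoes.\<close>
  have "0 = (\<Sum>e | e dvd M. (- 1) ^ omega e * (of_nat (M * gcd \<delta> e) / of_nat e) ^ ?w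
      * (\<Sum>d | d dvd M. x d * (of_nat (gcd e d) / of_nat d) ^ ?w))"
    by (simp only: zero mult_zero_right sum.neutral_const)
  also have "\<dots> = (\<Sum>d | d dvd M. \<Sum>e | e dvd M. x d * ((- 1) ^ omega d * ?K d \<delta> e))"
    unfolding sum_distrib_left
    by (subst sum.swap, intro sum.cong refl)
      (simp add: power_mult_distrib power_divide power_add gcd.commute mult_ac)
  also have "\<dots> = (\<Sum>d | d dvd M. if d = \<delta> then x d * ((- 1) ^ omega d * (\<Prod>p\<in>prime_factors M. of_nat p ^ ?w - 1)) else 0)"
    by (intro sum.cong refl) (auto simp only: sum_distrib_left[symmetric] K mem_Collect_eq mult_zero_right split: if_splits)
  also have "\<dots> = x \<delta> * ((- 1) ^ omega \<delta> * (\<Prod>p\<in>prime_factors M. of_nat p ^ ?w - 1))"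
    using M assms(3) by (subst sum.delta) auto
  finally have "x \<delta> * ((- 1) ^ omega \<delta> * (\<Prod>p\<in>prime_factors M. of_nat p ^ ?w - 1)) = 0" by simp
  moreover have "(\<Prod>p\<in>prime_factors M. of_nat p ^ ?w - 1) \<noteq> (0 :: complex)"
  proof -
    have "(of_nat p :: complex) ^ ?w - 1 \<noteq> 0" if "p \<in> prime_factors M" for p
    proof -
      have "p > 1" using that in_prime_factors_imp_prime prime_gt_1_nat by blast
      then have "p ^ ?w > 1" using k by (intro one_less_power) auto
      then have "of_nat (p ^ ?w) \<noteq> (of_nat 1 :: complex)" by (simp only: of_nat_eq_iff)
      then show ?thesis by simp
    qed
    then show ?thesis by (simp add: prod_zero_iff)
  qed
  ultimately show ?thesis by simp
qed

end

text \<open>The difference of two candidates is a combination of Eisenstein series that vanishes at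
  every cusp, so its coefficients are 0. Off the half plane both candidates are 0 by
  convention.\<close>

lemma cuspidal_part_unique:
  assumes k: "k \<ge> 2" and M: "squarefree M"
    and "is_cuspidal_part k M f C" "is_cuspidal_part k M f C'"
  shows "C = C'"
proof
  fix z
  have "M > 0" using M by (cases "M = 0") auto
  obtain x where x: "\<And>z. z \<in> upper_half_plane \<Longrightarrow> f z - C z = eisenstein_combination k M x z"
    using assms(3) unfolding is_cuspidal_part_def eisenstein_forms_def eisenstein_combination_def by blast
  obtain x' where x': "\<And>z. z \<in> upper_half_plane \<Longrightarrow> f z - C' z = eisenstein_combination k M x' z"
    using assms(4) unfolding is_cuspidal_part_def eisenstein_forms_def eisenstein_combination_def by blast
  have diff: "eisenstein_combination k M (\<lambda>d. x d - x' d) z = C' z - C z" if "z \<in> upper_half_plane" for z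
  proof -
    have "eisenstein_combination k M (\<lambda>d. x d - x' d) z
        = eisenstein_combination k M x z - eisenstein_combination k M x' z"
      by (simp add: eisenstein_combination_def left_diff_distrib sum_subtractf)
    then show ?thesis unfolding x[OF that, symmetric] x'[OF that, symmetric] by simp
  qed
  have "(slash (2 * k) (a, b, c, d) (eisenstein_combination k M (\<lambda>d. x d - x' d)) \<longlongrightarrow> 0) at_i_infinity"
    if SL: "(a, b, c, d) \<in> SL2Z" for a b c d
  proof (rule Lim_transform_eventually)
    have "(slash (2 * k) (a, b, c, d) C \<longlongrightarrow> 0) at_i_infinity" "(slash (2 * k) (a, b, c, d) C' \<longlongrightarrow> 0) at_i_infinity"
      using assms(3,4) SL by (auto simp: is_cuspidal_part_def cusp_forms_def)
    then show "((\<lambda>z. slash (2 * k) (a, b, c, d) C' z - slash (2 * k) (a, b, c, d) C z) \<longlongrightarrow> 0) at_i_infinity"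
      using tendsto_diff by force
    show "\<forall>\<^sub>F z in at_i_infinity. slash (2 * k) (a, b, c, d) C' z - slash (2 * k) (a, b, c, d) C z
        = slash (2 * k) (a, b, c, d) (eisenstein_combination k M (\<lambda>d. x d - x' d)) z"
      using eventually_upper_half_plane
    proof eventually_elim
      case (elim z)
      show ?case
        unfolding slash_diff[symmetric] by (rule slash_cong[OF SL elim]) (simp add: diff)
    qed
  qed
  then have "x d - x' d = 0" if "d dvd M" for d
    using eisenstein_combination_cuspidal_imp_zero[OF k \<open>M > 0\<close> M _ that, of "\<lambda>d. x d - x' d"] by blast
  then have "eisenstein_combination k M (\<lambda>d. x d - x' d) z = 0"
    by (simp add: eisenstein_combination_def)
  then show "C z = C' z"
    using diff[of z] assms(3,4) by (cases "z \<in> upper_half_plane") (auto simp: is_cuspidal_part_def)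
qed

section \<open>Representation numbers\<close>

text \<open>A finite product of absolutely convergent sums over the integers is a sum over tuples;
  \<open>Q x\<close> is the value of the quadratic form at \<open>x\<close>, and the tuples are
  regrouped by this value.\<close>

lemma prod_divisors_phi_sums:
  assumes N: "N > 0" and z: "z \<in> upper_half_plane"
  shows "(\<lambda>n. of_nat (rep_number N e n) * nome z ^ n) sums (\<Prod>\<delta> | \<delta> dvd N. phi (of_nat \<delta> * z) ^ e \<delta>)"
proof -
  define I where "I = (SIGMA \<delta>:{\<delta>. \<delta> dvd N}. {1..e \<delta>})"
  have fin: "finite I" unfolding I_def using N by (intro finite_SigmaI) auto
  have pos: "fst i > 0" if "i \<in> I" for i using that N by (auto simp: I_def dest: dvd_pos_nat)
  define f where "f i n = nome z ^ (fst i * nat (n\<^sup>2))" for i :: "nat \<times> nat" and n :: int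
  define Q where "Q x = (\<Sum>i\<in>I. fst i * nat ((x i)\<^sup>2))" for x :: "nat \<times> nat \<Rightarrow> int"
  let ?P = "I \<rightarrow>\<^sub>E (UNIV :: int set)"
  have f_eq: "f i n = nome (of_nat (fst i) * z) ^ nat (n\<^sup>2)" for i n
    by (simp only: nome_of_nat_mult f_def power_mult)
  have f_sum: "(f i has_sum phi (of_nat (fst i) * z)) UNIV" if "i \<in> I" for i
  proof -
    have "of_nat (fst i) * z \<in> upper_half_plane"
      using z pos[OF that] by (simp add: upper_half_plane_def)
    from phi_has_sum(1)[OF this] show ?thesis by (simp only: f_eq[abs_def])
  qed
  have f_abs: "(\<lambda>n. norm (f i n)) summable_on UNIV" if "i \<in> I" for i
    using f_sum[OF that] summable_on_iff_abs_summable_on_complex[of "f i" UNIV] by (auto simp: summable_on_def)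
  have "(\<lambda>x. \<Prod>i\<in>I. f i (x i)) summable_on ?P"
  proof -
    have "Infinite_Set_Sum.abs_summable_on (\<lambda>x. \<Prod>i\<in>I. f i (x i)) ?P"
      using f_abs by (intro abs_summable_on_prod_PiE fin) (auto simp: abs_summable_equivalent)
    then show ?thesis by (simp add: abs_summable_equivalent[symmetric] abs_summable_summable)
  qed
  moreover have "(\<Sum>\<^sub>\<infinity>x\<in>?P. \<Prod>i\<in>I. f i (x i)) = (\<Prod>i\<in>I. infsum (f i) UNIV)"
    by (rule infsum_prod_PiE_abs[OF fin f_abs])
  moreover have "(\<Prod>i\<in>I. infsum (f i) UNIV) = (\<Prod>\<delta> | \<delta> dvd N. phi (of_nat \<delta> * z) ^ e \<delta>)"
  proof -
    have "(\<Prod>i\<in>I. infsum (f i) UNIV) = (\<Prod>(\<delta>, j)\<in>I. phi (of_nat \<delta> * z))"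
      by (rule prod.cong) (auto simp: infsumI[OF f_sum])
    also have "\<dots> = (\<Prod>\<delta> | \<delta> dvd N. \<Prod>j\<in>{1..e \<delta>}. phi (of_nat \<delta> * z))"
      unfolding I_def using N by (intro prod.Sigma[symmetric]) auto
    finally show ?thesis by simp
  qed
  moreover have "(\<Prod>i\<in>I. f i (x i)) = nome z ^ Q x" for x
    by (simp add: f_def Q_def power_sum)
  ultimately have sum: "((\<lambda>x. nome z ^ Q x) has_sum (\<Prod>\<delta> | \<delta> dvd N. phi (of_nat \<delta> * z) ^ e \<delta>)) ?P"
    using has_sum_infsum[of "\<lambda>x. nome z ^ Q x" ?P] by simp
  define S where "S n = {x \<in> ?P. Q x = n}" for n
  \<comment> \<open>All coefficients are positive integers, so each coordinate satisfies
    \<open>\<bar>x i\<bar> \<le> (x i)\<^sup>2 \<le> n\<close>.\<close>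
  have S_fin: "finite (S n)" for n
  proof (rule finite_subset)
    show "finite (I \<rightarrow>\<^sub>E {- int n..int n})" using fin by (intro finite_PiE) auto
    show "S n \<subseteq> I \<rightarrow>\<^sub>E {- int n..int n}"
    proof
      fix x assume x: "x \<in> S n"
      have "x i \<in> {- int n..int n}" if i: "i \<in> I" for i
      proof -
        have "nat ((x i)\<^sup>2) \<le> fst i * nat ((x i)\<^sup>2)" using pos[OF i] by simp
        also have "\<dots> \<le> Q x" unfolding Q_def by (rule member_le_sum[OF i]) (auto simp: fin)
        finally have "(x i)\<^sup>2 \<le> int n" using x by (simp add: S_def nat_le_iff)
        moreover have "\<bar>x i\<bar> \<le> (x i)\<^sup>2"
          using self_le_power[of "\<bar>x i\<bar>" 2] by (cases "x i = 0") auto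
        ultimately show ?thesis by auto
      qed
      then show "x \<in> I \<rightarrow>\<^sub>E {- int n..int n}" using x by (auto simp: S_def PiE_iff)
    qed
  qed
  have S_card: "card (S n) = rep_number N e n" for n
  proof -
    have "int (Q x) = (\<Sum>(\<delta>, j)\<in>I. int \<delta> * x (\<delta>, j) ^ 2)" for x
      by (simp add: Q_def case_prod_beta)
    then have "Q x = n \<longleftrightarrow> (\<Sum>(\<delta>, j)\<in>I. int \<delta> * x (\<delta>, j) ^ 2) = int n" for x
      by (metis of_nat_eq_iff)
    then show ?thesis unfolding S_def rep_number_def Let_def I_def[symmetric] by simp
  qed
  have "((\<lambda>n. of_nat (rep_number N e n) * nome z ^ n) has_sum (\<Prod>\<delta> | \<delta> dvd N. phi (of_nat \<delta> * z) ^ e \<delta>)) UNIV"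
  proof (rule has_sum_SigmaD)
    show "((\<lambda>(n, x). nome z ^ n) has_sum (\<Prod>\<delta> | \<delta> dvd N. phi (of_nat \<delta> * z) ^ e \<delta>)) (SIGMA n:UNIV. S n)"
      by (rule iffD1[OF _ sum], rule has_sum_reindex_bij_witness[where i = snd and j = "\<lambda>x. (Q x, x)"])
        (auto simp: S_def)
    show "((\<lambda>x. case (n, x) of (n, x) \<Rightarrow> nome z ^ n) has_sum of_nat (rep_number N e n) * nome z ^ n) (S n)" for n
      by (simp add: has_sum_finite_iff S_fin S_card)
  qed
  then show ?thesis by (rule has_sum_imp_sums)
qed

section \<open>The Eisenstein part of the eta product\<close>

text \<open>The coefficients of the series at \<open>t * z\<close>. For \<open>t\<close> not
  dividing \<open>m\<close> the value is 0, because \<open>divisor_sigma\<close> vanishes at a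
  non-integral quotient.\<close>

definition scaled_eisenstein_coeff :: "nat \<Rightarrow> nat \<Rightarrow> nat \<Rightarrow> complex" where
  "scaled_eisenstein_coeff k t m = (if m = 0 then 1
     else - (of_nat (4 * k) / of_real (bernoulli (2 * k))) * of_nat (divisor_sigma (2 * k - 1) (real m / real t)))"

text \<open>Stated for any \<open>x\<close>, so that it serves both for \<open>nome z\<close> and,
  after the half shift, for \<open>- nome z\<close>.\<close>

lemma scaled_eisenstein_sums:
  assumes "(\<lambda>n. eisenstein_coeff k n * (x ^ t) ^ n) sums s" and "t > 0"
  shows "(\<lambda>m. scaled_eisenstein_coeff k t m * x ^ m) sums s"
proof -
  have "scaled_eisenstein_coeff k t m * x ^ m = 0" if "m \<notin> range ((*) t)" for m
  proof -
    have "real m / real t \<noteq> real n" for n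
    proof
      assume "real m / real t = real n"
      then have "real m = real (t * n)" using assms(2) by (simp add: field_simps)
      then have "m = t * n" by (simp only: of_nat_eq_iff)
      then show False using that by blast
    qed
    moreover have "m \<noteq> 0" using that by (metis mult_0_right rangeI)
    ultimately show ?thesis by (simp add: scaled_eisenstein_coeff_def divisor_sigma_def)
  qed
  moreover have "strict_mono ((*) t)" using assms(2) by (auto simp: strict_mono_def)
  moreover have "scaled_eisenstein_coeff k t (t * n) * x ^ (t * n) = eisenstein_coeff k n * (x ^ t) ^ n" for n
    using assms(2) by (simp add: scaled_eisenstein_coeff_def eisenstein_coeff_def power_mult)
  ultimately show ?thesis
    using sums_mono_reindex[of "(*) t" "\<lambda>m. scaled_eisenstein_coeff k t m * x ^ m" s] assms(1) by simp
qed

lemma eisenstein_series_plus_of_nat: "eisenstein_series k (z + of_nat n) = eisenstein_series k z"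
proof -
  have "nome (z + of_nat n) = nome z"
  proof -
    have "2 * of_real pi * \<i> * (z + of_nat n) = 2 * of_real pi * \<i> * z + 2 * of_real pi * \<i> * of_nat n"
      by (simp add: distrib_left)
    then show ?thesis using exp_integer_2pi[of "of_nat n"] by (simp add: exp_add mult_ac)
  qed
  then show ?thesis by (simp only: eisenstein_series_def)
qed

lemma phi_plus_of_nat: "phi (z + of_nat n) = phi z"
proof (induction n)
  case (Suc n)
  then show ?case using phi_plus_1[of "z + of_nat n"] by (simp add: add_ac)
qed simp

context
  fixes N k :: nat and r :: "nat \<Rightarrow> nat"
  assumes N: "odd N" "squarefree N"
    and r: "\<exists>\<delta>. \<delta> dvd N \<and> r \<delta> \<noteq> 0"
    and k: "k = 2 * (\<Sum>\<delta> | \<delta> dvd N. r \<delta>)"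
begin

lemma N_pos: "N > 0"
  using N(1) by (rule odd_pos)

lemma divisor_pos: "\<delta> dvd N \<Longrightarrow> \<delta> > 0"
  using N_pos by (rule dvd_pos_nat)

lemma divisor_odd: "\<delta> dvd N \<Longrightarrow> odd \<delta>"
  using N(1) by (meson dvd_trans)

lemma finite_divisors: "finite {\<delta>. \<delta> dvd N}"
  using N_pos by simp

lemma k_ge_2: "k \<ge> 2"
proof -
  obtain \<delta> where "\<delta> dvd N" "r \<delta> \<noteq> 0" using r by blast
  then have "(\<Sum>\<delta> | \<delta> dvd N. r \<delta>) \<noteq> 0" using finite_divisors by auto
  then show ?thesis using k by simp
qed

lemma squarefree_2N: "squarefree (2 * N)"
  using N by (intro squarefree_mult_coprime) (auto simp: squarefree_prime)

text \<open>The limit of the eta product at the cusps of even denominator \<open>c\<close>; it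
  depends on \<open>c\<close> only through \<open>gcd c N\<close>.\<close>

definition cusp_value :: "nat \<Rightarrow> complex" where
  "cusp_value c = (\<Prod>\<delta> | \<delta> dvd N. (of_nat (gcd c \<delta>) / of_nat \<delta>) ^ (4 * r \<delta>))"

text \<open>The inverse gcd matrix of level \<open>N\<close> applied to the vector of cusp values;
  the prime 2 enters only through the factor \<open>2 ^ (2 * k) - 1\<close> of the
  denominator.\<close>

definition weight_coeff :: "nat \<Rightarrow> complex" where
  "weight_coeff d = (\<Sum>c | c dvd N.
     (- 1) ^ (omega d + omega c) / (\<Prod>p\<in>prime_factors (2 * N). of_nat p ^ (2 * k) - 1)
     * (of_nat (N * gcd c d) / of_nat c) ^ (2 * k) * cusp_value c)"

text \<open>The Kronecker product of \<open>weight_coeff\<close> with the solution over the prime 2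
  for the values 0 at odd and 1 at even denominators. The even divisors of \<open>2 * N\<close> are
  the \<open>2 * d\<close> with \<open>d\<close> dividing \<open>N\<close>.\<close>

definition eisenstein_coeffs :: "nat \<Rightarrow> complex" where
  "eisenstein_coeffs d = (if even d then 2 ^ (2 * k) * weight_coeff (d div 2) else - weight_coeff d)"

lemma eisenstein_combination_2N:
  "eisenstein_combination k (2 * N) eisenstein_coeffs z
    = (\<Sum>d | d dvd N. weight_coeff d * (2 ^ (2 * k) * eisenstein_series k (2 * of_nat d * z) - eisenstein_series k (of_nat d * z)))"
proof -
  have "eisenstein_combination k (2 * N) eisenstein_coeffs z
    = (\<Sum>d | d dvd N. eisenstein_coeffs d * eisenstein_series k (of_nat d * z)
        + eisenstein_coeffs (2 * d) * eisenstein_series k (of_nat (2 * d) * z))"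
    unfolding eisenstein_combination_def using N N_pos by (intro sum_divisors_prime_mult) auto
  also have "\<dots> = (\<Sum>d | d dvd N. weight_coeff d * (2 ^ (2 * k) * eisenstein_series k (2 * of_nat d * z) - eisenstein_series k (of_nat d * z)))"
    by (intro sum.cong refl) (auto simp: eisenstein_coeffs_def divisor_odd algebra_simps)
  finally show ?thesis .
qed

text \<open>After interchanging the sums, the inverse relation for level \<open>N\<close> leaves
  only \<open>c = e\<close> and cancels the product over the odd primes.\<close>

lemma weight_coeff_sum:
  assumes "e dvd N"
  shows "(2 ^ (2 * k) - 1) * (\<Sum>d | d dvd N. weight_coeff d * (of_nat (gcd e d) / of_nat d) ^ (2 * k)) = cusp_value e"
proof -
  let ?w = "2 * k"
  let ?P = "\<Prod>p\<in>prime_factors N. of_nat p ^ ?w - 1 :: complex"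
  have nz: "(of_nat p :: complex) ^ ?w - 1 \<noteq> 0" if "p > 1" for p
  proof -
    have "p ^ ?w > 1" using that k_ge_2 by (intro one_less_power) auto
    then have "of_nat (p ^ ?w) \<noteq> (of_nat 1 :: complex)" by (simp only: of_nat_eq_iff)
    then show ?thesis by simp
  qed
  have "?P \<noteq> 0"
  proof -
    have "(of_nat p :: complex) ^ ?w - 1 \<noteq> 0" if "p \<in> prime_factors N" for p
      using that in_prime_factors_imp_prime prime_gt_1_nat by (intro nz) blast
    then show ?thesis by (simp add: prod_zero_iff)
  qed
  have "2 \<notin> prime_factors N" using N(1) by (auto dest: in_prime_factors_imp_dvd)
  then have P2: "(\<Prod>p\<in>prime_factors (2 * N). of_nat p ^ ?w - 1) = (2 ^ ?w - 1) * ?P"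
    using prime_factors_prime_mult[of 2 N] N_pos by simp
  let ?K = "\<lambda>c d. (- 1) ^ (omega d + omega c) * (of_nat (N * gcd c d * gcd e d) / of_nat (c * d)) ^ ?w :: complex"
  have "(\<Sum>d | d dvd N. weight_coeff d * (of_nat (gcd e d) / of_nat d) ^ ?w)
      = (\<Sum>d | d dvd N. \<Sum>c | c dvd N. cusp_value c / ((2 ^ ?w - 1) * ?P) * ?K c d)"
    unfolding weight_coeff_def P2 sum_distrib_right
    by (intro sum.cong refl) (simp add: power_mult_distrib power_divide mult_ac)
  also have "\<dots> = (\<Sum>c | c dvd N. cusp_value c / ((2 ^ ?w - 1) * ?P) * (\<Sum>d | d dvd N. ?K c d))"
    by (subst sum.swap) (simp only: sum_distrib_left)
  also have "\<dots> = (\<Sum>c | c dvd N. if c = e then cusp_value e / ((2 ^ ?w - 1) * ?P) * ?P else 0)"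
  proof (intro sum.cong refl)
    fix c assume "c \<in> {c. c dvd N}"
    then have K: "(\<Sum>d | d dvd N. ?K c d) = (if c = e then ?P else 0)"
      by (intro sum_divisors_gcd_kernel N(2) assms) simp
    show "cusp_value c / ((2 ^ ?w - 1) * ?P) * (\<Sum>d | d dvd N. ?K c d)
        = (if c = e then cusp_value e / ((2 ^ ?w - 1) * ?P) * ?P else 0)"
      unfolding K by simp
  qed
  also have "\<dots> = cusp_value e / ((2 ^ ?w - 1) * ?P) * ?P"
    using assms finite_divisors by (subst sum.delta) auto
  also have "\<dots> = cusp_value e / (2 ^ ?w - 1)" using \<open>?P \<noteq> 0\<close> by simp
  finally show ?thesis using nz[of 2] by simp
qed

text \<open>The terms for \<open>d\<close> and \<open>2 * d\<close> are taken together. For odd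
  \<open>c\<close> they cancel; for even \<open>c\<close> they leave the factor
  \<open>2 ^ (2 * k) - 1\<close>, and the system over the divisors of \<open>N\<close> applies with
  \<open>e = gcd c N\<close>.\<close>

lemma eisenstein_combination_cusp_value:
  assumes "(a, b, c, d) \<in> SL2Z"
  shows "(slash (2 * k) (a, b, c, d) (eisenstein_combination k (2 * N) eisenstein_coeffs)
    \<longlongrightarrow> (if even c then cusp_value (nat \<bar>c\<bar>) else 0)) at_i_infinity"
proof -
  let ?w = "2 * k"
  define m where "m = nat \<bar>c\<bar>"
  define e where "e = gcd m N"
  have gcd_c: "gcd c (int d) = int (gcd m d)" for d
    unfolding m_def gcd_int_def by simp
  have gcd_e: "gcd m d = gcd e d" if "d dvd N" for d
    unfolding e_def using that by (metis gcd.assoc gcd_nat.absorb2)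
  have "even c \<longleftrightarrow> even m" by (simp add: m_def even_nat_iff)
  have "(\<Sum>\<delta> | \<delta> dvd 2 * N. eisenstein_coeffs \<delta> * (of_int (gcd c (int \<delta>)) / of_nat \<delta>) ^ ?w)
    = (\<Sum>d | d dvd N. eisenstein_coeffs d * (of_int (gcd c (int d)) / of_nat d) ^ ?w
        + eisenstein_coeffs (2 * d) * (of_int (gcd c (int (2 * d))) / of_nat (2 * d)) ^ ?w)"
    using N N_pos by (intro sum_divisors_prime_mult) auto
  also have "\<dots> = (\<Sum>d | d dvd N. ((if even c then 2 ^ ?w else 1) - 1) * (weight_coeff d * (of_nat (gcd e d) / of_nat d) ^ ?w))"
  proof (intro sum.cong refl)
    fix d assume "d \<in> {d. d dvd N}"
    then have d: "d dvd N" by simp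
    have "gcd m (2 * d) = (if even m then 2 else 1) * gcd e d"
    proof (cases "even m")
      case True
      then obtain m' where m': "m = 2 * m'" ..
      have "coprime 2 d" using divisor_odd[OF d] by simp
      then have "gcd m' d = gcd m d" unfolding m' by (simp add: gcd_mult_left_left_cancel coprime_commute)
      then show ?thesis using True gcd_e[OF d] unfolding m' by (simp flip: gcd_mult_distrib_nat)
    next
      case False
      then have "coprime 2 m" by simp
      then have "gcd m (2 * d) = gcd m d" by (simp add: gcd_mult_right_left_cancel coprime_commute)
      then show ?thesis using False gcd_e[OF d] by simp
    qed
    then have g: "of_int (gcd c (int (2 * d))) = (if even c then 2 else 1) * (of_nat (gcd e d) :: complex)"
      using \<open>even c \<longleftrightarrow> even m\<close> unfolding gcd_c by simp
    have g': "of_int (gcd c (int d)) = (of_nat (gcd e d) :: complex)"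
      unfolding gcd_c gcd_e[OF d] by simp
    have co: "eisenstein_coeffs (2 * d) = 2 ^ ?w * weight_coeff d" "eisenstein_coeffs d = - weight_coeff d"
      using divisor_odd[OF d] by (simp_all add: eisenstein_coeffs_def)
    show "eisenstein_coeffs d * (of_int (gcd c (int d)) / of_nat d) ^ ?w
        + eisenstein_coeffs (2 * d) * (of_int (gcd c (int (2 * d))) / of_nat (2 * d)) ^ ?w
      = ((if even c then 2 ^ ?w else 1) - 1) * (weight_coeff d * (of_nat (gcd e d) / of_nat d) ^ ?w)"
      unfolding g g' co using divisor_pos[OF d] by (simp add: power_divide power_mult_distrib algebra_simps diff_divide_distrib)
  qed
  also have "\<dots> = (if even c then cusp_value e else 0)"
    unfolding sum_distrib_left[symmetric]
    using weight_coeff_sum[of e] by (simp add: e_def)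
  also have "cusp_value e = cusp_value m"
    unfolding cusp_value_def by (intro prod.cong refl) (simp add: gcd_e)
  finally have "(\<Sum>\<delta> | \<delta> dvd 2 * N. eisenstein_coeffs \<delta> * (of_int (gcd c (int \<delta>)) / of_nat \<delta>) ^ ?w)
      = (if even c then cusp_value (nat \<bar>c\<bar>) else 0)" by (simp add: m_def)
  then show ?thesis
    using eisenstein_combination_tendsto[OF k_ge_2 _ assms, of "2 * N" eisenstein_coeffs] N_pos by simp
qed

section \<open>The eta product and its cuspidal component\<close>

definition eta_product :: "complex \<Rightarrow> complex" where
  "eta_product z = (\<Prod>\<delta> | \<delta> dvd N. g_fun (of_nat \<delta> * z) ^ (8 * r \<delta>))"

lemma eta_product_alt: "eta_product = (\<lambda>z. \<Prod>\<delta> | \<delta> dvd N. (\<lambda>z. g_fun (of_nat \<delta> * z) ^ 8) z ^ r \<delta>)"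
  by (simp add: eta_product_def[abs_def] power_mult)

lemma slash_eta_product:
  "slash (2 * k) \<gamma> eta_product z = (\<Prod>\<delta> | \<delta> dvd N. slash 4 \<gamma> (\<lambda>z. g_fun (of_nat \<delta> * z) ^ 8) z ^ r \<delta>)"
  unfolding eta_product_alt
  by (rule slash_prod_powers[OF finite_divisors]) (simp add: k sum_distrib_left)

lemma eta_product_holomorphic: "eta_product holomorphic_on upper_half_plane"
  unfolding eta_product_def[abs_def]
  by (intro holomorphic_intros holomorphic_on_upper_half_plane_scale g_fun_holomorphic) (auto intro: divisor_pos)

lemma eta_product_invariant:
  assumes "(a, b, c, d) \<in> SL2Z" "int (2 * N) dvd c" "z \<in> upper_half_plane"
  shows "slash (2 * k) (a, b, c, d) eta_product z = eta_product z"
  unfolding slash_eta_product unfolding eta_product_alt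
proof (rule prod.cong)
  fix \<delta> assume "\<delta> \<in> {\<delta>. \<delta> dvd N}"
  then have \<delta>: "\<delta> dvd N" by simp
  then have "2 * \<delta> dvd 2 * N" by simp
  then have "int (2 * \<delta>) dvd c" using assms(2) by (meson dvd_trans int_dvd_int_iff)
  then obtain c' where "c = int (2 * \<delta>) * c'" by (elim dvdE)
  then have c': "c = int \<delta> * (2 * c')" by simp
  \<comment> \<open>Evenness of the quotient places the rescaled matrix in the group of level 2,
    under which the eighth power is invariant.\<close>
  then have even: "even (c div int \<delta>)" "int \<delta> dvd c" using divisor_pos[OF \<delta>] by auto
  have "slash 4 (a, b, c, d) (\<lambda>z. (\<lambda>z. g_fun z ^ 8) (of_nat \<delta> * z)) z = (\<lambda>z. g_fun z ^ 8) (of_nat \<delta> * z)"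
    by (rule slash_scale_invariant[OF assms(1) even(2) divisor_pos[OF \<delta>] _ assms(3)])
      (rule g_fun_power_8_Gamma0_2[OF _ even(1)])
  then show "slash 4 (a, b, c, d) (\<lambda>z. g_fun (of_nat \<delta> * z) ^ 8) z ^ r \<delta> = (\<lambda>z. g_fun (of_nat \<delta> * z) ^ 8) z ^ r \<delta>"
    by simp
qed simp

text \<open>Every \<open>\<delta>\<close> is odd, so dividing \<open>c\<close> by its gcd with
  \<open>\<delta>\<close> preserves parity and all factors see the same kind of cusp. For odd
  \<open>c\<close> the product vanishes because some \<open>r \<delta>\<close> is nonzero.\<close>

lemma eta_product_cusp_value:
  assumes "(a, b, c, d) \<in> SL2Z"
  shows "(slash (2 * k) (a, b, c, d) eta_product
    \<longlongrightarrow> (if even c then cusp_value (nat \<bar>c\<bar>) else 0)) at_i_infinity"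
proof -
  let ?L = "\<lambda>\<delta>. (if even c then 1 else 0) * (of_int (gcd c (int \<delta>)) / of_nat \<delta>) ^ 4 :: complex"
  have "(slash 4 (a, b, c, d) (\<lambda>z. g_fun (of_nat \<delta> * z) ^ 8) \<longlongrightarrow> ?L \<delta>) at_i_infinity"
    if \<delta>: "\<delta> dvd N" for \<delta>
  proof (rule slash_scale_tendsto[OF assms divisor_pos[OF \<delta>]])
    fix a b d assume "(a, b, c div gcd c (int \<delta>), d) \<in> SL2Z"
    from g_fun_power_8_cusp_limit[OF this]
    have "(slash 4 (a, b, c div gcd c (int \<delta>), d) (\<lambda>z. g_fun z ^ 8)
        \<longlongrightarrow> (if even (c div gcd c (int \<delta>)) then 1 else 0)) at_i_infinity" .
    moreover have "even (c div gcd c (int \<delta>)) \<longleftrightarrow> even c"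
    proof -
      have "odd (gcd c (int \<delta>))"
      proof
        assume "even (gcd c (int \<delta>))"
        then have "even (int \<delta>)" using gcd_dvd2 dvd_trans by blast
        then show False using divisor_odd[OF \<delta>] by simp
      qed
      moreover have "c = gcd c (int \<delta>) * (c div gcd c (int \<delta>))" by simp
      ultimately show ?thesis by (metis even_mult_iff)
    qed
    ultimately show "(slash 4 (a, b, c div gcd c (int \<delta>), d) (\<lambda>z. g_fun z ^ 8)
        \<longlongrightarrow> (if even c then 1 else 0)) at_i_infinity" by simp
  qed
  then have "(slash (2 * k) (a, b, c, d) eta_product \<longlongrightarrow> (\<Prod>\<delta> | \<delta> dvd N. ?L \<delta> ^ r \<delta>)) at_i_infinity"
    unfolding slash_eta_product[abs_def] by (intro tendsto_prod tendsto_power) auto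
  moreover have "(\<Prod>\<delta> | \<delta> dvd N. ?L \<delta> ^ r \<delta>) = (if even c then cusp_value (nat \<bar>c\<bar>) else 0)"
  proof (cases "even c")
    case True
    have "gcd c (int \<delta>) = int (gcd (nat \<bar>c\<bar>) \<delta>)" for \<delta> unfolding gcd_int_def by simp
    then show ?thesis using True by (simp add: cusp_value_def power_mult)
  next
    case False
    obtain \<delta> where "\<delta> dvd N" "r \<delta> \<noteq> 0" using r by blast
    then show ?thesis using False finite_divisors by (auto simp: prod_zero_iff)
  qed
  ultimately show ?thesis by simp
qed

definition cusp_component :: "complex \<Rightarrow> complex" where
  "cusp_component z = (if z \<in> upper_half_plane
     then eta_product z - eisenstein_combination k (2 * N) eisenstein_coeffs z else 0)"

text \<open>The eta product and the Eisenstein combination have the same limit at every cusp, so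
  their difference vanishes at all of them.\<close>

lemma is_cuspidal_part_cusp_component: "is_cuspidal_part k (2 * N) eta_product cusp_component"
proof -
  let ?E = "eisenstein_combination k (2 * N) eisenstein_coeffs"
  have N2: "2 * N > 0" using N_pos by simp
  have slash_C: "slash (2 * k) (a, b, c, d) cusp_component z
      = slash (2 * k) (a, b, c, d) eta_product z - slash (2 * k) (a, b, c, d) ?E z"
    if "(a, b, c, d) \<in> SL2Z" "z \<in> upper_half_plane" for a b c d z
    unfolding slash_diff[symmetric] by (rule slash_cong[OF that]) (simp add: cusp_component_def)
  have lim_C: "(slash (2 * k) (a, b, c, d) cusp_component \<longlongrightarrow> 0) at_i_infinity"
    if SL: "(a, b, c, d) \<in> SL2Z" for a b c d
  proof (rule Lim_transform_eventually)
    show "((\<lambda>z. slash (2 * k) (a, b, c, d) eta_product z - slash (2 * k) (a, b, c, d) ?E z) \<longlongrightarrow> 0) at_i_infinity"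
      using tendsto_diff[OF eta_product_cusp_value[OF SL] eisenstein_combination_cusp_value[OF SL]] by simp
    show "\<forall>\<^sub>F z in at_i_infinity. slash (2 * k) (a, b, c, d) eta_product z - slash (2 * k) (a, b, c, d) ?E z
        = slash (2 * k) (a, b, c, d) cusp_component z"
      using eventually_upper_half_plane by eventually_elim (simp add: slash_C[OF SL])
  qed
  have "eta_product \<in> modular_forms (2 * k) (2 * N)"
    by (rule modular_formsI[OF eta_product_holomorphic eta_product_invariant eta_product_cusp_value])
  moreover have "cusp_component \<in> modular_forms (2 * k) (2 * N)"
  proof (rule modular_formsI[OF _ _ lim_C])
    have "(\<lambda>z. eta_product z - ?E z) holomorphic_on upper_half_plane"
      by (intro holomorphic_intros eta_product_holomorphic eisenstein_combination_holomorphic k_ge_2 N2)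
    then show "cusp_component holomorphic_on upper_half_plane"
      by (rule holomorphic_transform) (simp add: cusp_component_def)
    show "slash (2 * k) (a, b, c, d) cusp_component z = cusp_component z"
      if "(a, b, c, d) \<in> SL2Z" "int (2 * N) dvd c" "z \<in> upper_half_plane" for a b c d z
      using that
      by (simp only: slash_C eta_product_invariant eisenstein_combination_invariant[OF k_ge_2 N2] cusp_component_def if_True)
  qed
  ultimately show ?thesis
    unfolding is_cuspidal_part_def cusp_forms_def eisenstein_forms_def
    using lim_C by (auto simp: cusp_component_def eisenstein_combination_def)
qed

lemma cuspidal_part_eq: "cuspidal_part k (2 * N) eta_product = cusp_component"
  unfolding cuspidal_part_def
  using is_cuspidal_part_cusp_component cuspidal_part_unique[OF k_ge_2 squarefree_2N]
  by (intro the_equality) auto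

text \<open>\<open>g_fun\<close> itself shifts by a further 1/2, and
  \<open>\<delta> / 2 + 1 / 2\<close> is an integer for odd \<open>\<delta>\<close>.\<close>

lemma eta_product_plus_half:
  assumes z: "z \<in> upper_half_plane"
  shows "eta_product (z + 1/2) = (\<Prod>\<delta> | \<delta> dvd N. phi (of_nat \<delta> * z) ^ (8 * r \<delta>))"
  unfolding eta_product_def
proof (rule prod.cong)
  fix \<delta> assume "\<delta> \<in> {\<delta>. \<delta> dvd N}"
  then have \<delta>: "\<delta> dvd N" by simp
  have "odd \<delta>" "\<delta> > 0" using divisor_odd[OF \<delta>] divisor_pos[OF \<delta>] by auto
  then obtain m where m: "\<delta> = 2 * m + 1" by (elim oddE)
  have H: "of_nat \<delta> * (z + 1/2) \<in> upper_half_plane"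
    using z \<open>\<delta> > 0\<close> by (simp add: upper_half_plane_def)
  have "of_nat \<delta> * (z + 1/2) + 1/2 = of_nat \<delta> * z + of_nat (m + 1)"
    by (simp add: m algebra_simps)
  then have "g_fun (of_nat \<delta> * (z + 1/2)) = phi (of_nat \<delta> * z)"
    by (simp only: g_fun_eq_phi[OF H] phi_plus_of_nat)
  then show "g_fun (of_nat \<delta> * (z + 1/2)) ^ (8 * r \<delta>) = phi (of_nat \<delta> * z) ^ (8 * r \<delta>)" by simp
qed simp

text \<open>Under the half shift \<open>2 * d * z\<close> moves by the integer \<open>d\<close>,
  while \<open>d * z\<close> moves by \<open>d / 2\<close>, which is 1/2 modulo integers because
  \<open>d\<close> is odd.\<close>

lemma eisenstein_combination_plus_half:
  "eisenstein_combination k (2 * N) eisenstein_coeffs (z + 1/2)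
    = (\<Sum>d | d dvd N. weight_coeff d * (2 ^ (2 * k) * eisenstein_series k (2 * of_nat d * z) - eisenstein_series k (of_nat d * z + 1/2)))"
  unfolding eisenstein_combination_2N
proof (rule sum.cong)
  fix d assume "d \<in> {d. d dvd N}"
  then have "odd d" using divisor_odd by simp
  then obtain m where m: "d = 2 * m + 1" by (elim oddE)
  have "2 * of_nat d * (z + 1/2) = 2 * of_nat d * z + of_nat d"
    "of_nat d * (z + 1/2) = (of_nat d * z + 1/2) + of_nat m"
    by (simp_all add: m algebra_simps)
  then show "weight_coeff d * (2 ^ (2 * k) * eisenstein_series k (2 * of_nat d * (z + 1/2)) - eisenstein_series k (of_nat d * (z + 1/2)))
     = weight_coeff d * (2 ^ (2 * k) * eisenstein_series k (2 * of_nat d * z) - eisenstein_series k (of_nat d * z + 1/2))"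
    by (simp only: eisenstein_series_plus_of_nat)
qed simp

definition combination_coeff :: "nat \<Rightarrow> complex" where
  "combination_coeff m = (\<Sum>d | d dvd N. weight_coeff d *
     (2 ^ (2 * k) * scaled_eisenstein_coeff k (2 * d) m - (- 1) ^ m * scaled_eisenstein_coeff k d m))"

lemma eisenstein_combination_plus_half_sums:
  assumes z: "z \<in> upper_half_plane"
  shows "(\<lambda>m. combination_coeff m * nome z ^ m) sums eisenstein_combination k (2 * N) eisenstein_coeffs (z + 1/2)"
proof -
  note k2 = k_ge_2
  have "(\<lambda>m. weight_coeff d * (2 ^ (2 * k) * (scaled_eisenstein_coeff k (2 * d) m * nome z ^ m) - scaled_eisenstein_coeff k d m * (- nome z) ^ m))
      sums (weight_coeff d * (2 ^ (2 * k) * eisenstein_series k (2 * of_nat d * z) - eisenstein_series k (of_nat d * z + 1/2)))"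
    if d: "d dvd N" for d
  proof (intro sums_mult sums_diff)
    have "odd d" "d > 0" using divisor_odd[OF d] divisor_pos[OF d] by auto
    have H: "2 * of_nat d * z \<in> upper_half_plane" "of_nat d * z + 1/2 \<in> upper_half_plane"
      using z \<open>d > 0\<close> by (auto simp: upper_half_plane_def)
    have q1: "nome (2 * of_nat d * z) = nome z ^ (2 * d)"
      using nome_of_nat_mult[of "2 * d" z] by simp
    \<comment> \<open>Since \<open>d\<close> is odd, the sign from the half shift can be moved
      inside the power, which makes this a series in \<open>- nome z\<close>.\<close>
    have q2: "nome (of_nat d * z + 1/2) = (- nome z) ^ d"
      by (simp only: nome_plus_half nome_of_nat_mult power_minus_odd[OF \<open>odd d\<close>])
    show "(\<lambda>m. scaled_eisenstein_coeff k (2 * d) m * nome z ^ m) sums eisenstein_series k (2 * of_nat d * z)"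
      using eisenstein_series_sums[OF H(1) k2] \<open>d > 0\<close> unfolding q1 by (intro scaled_eisenstein_sums) auto
    show "(\<lambda>m. scaled_eisenstein_coeff k d m * (- nome z) ^ m) sums eisenstein_series k (of_nat d * z + 1/2)"
      using eisenstein_series_sums[OF H(2) k2] \<open>d > 0\<close> unfolding q2 by (intro scaled_eisenstein_sums) auto
  qed
  then have "(\<lambda>m. \<Sum>d | d dvd N. weight_coeff d * (2 ^ (2 * k) * (scaled_eisenstein_coeff k (2 * d) m * nome z ^ m) - scaled_eisenstein_coeff k d m * (- nome z) ^ m))
      sums (\<Sum>d | d dvd N. weight_coeff d * (2 ^ (2 * k) * eisenstein_series k (2 * of_nat d * z) - eisenstein_series k (of_nat d * z + 1/2)))"
    by (intro sums_sum) auto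
  moreover have "(\<Sum>d | d dvd N. weight_coeff d * (2 ^ (2 * k) * (scaled_eisenstein_coeff k (2 * d) m * nome z ^ m) - scaled_eisenstein_coeff k d m * (- nome z) ^ m))
      = combination_coeff m * nome z ^ m" for m
    unfolding combination_coeff_def sum_distrib_right power_minus[of "nome z" m]
    by (intro sum.cong refl) (simp add: algebra_simps)
  ultimately show ?thesis unfolding eisenstein_combination_plus_half by simp
qed

text \<open>At \<open>u = z - 1/2\<close> the eta product becomes the product of theta functions,
  whose coefficients are the representation numbers; \<open>nome u = - nome z\<close> accounts for
  the sign.\<close>

lemma fourier_coeff_cusp_component:
  "fourier_coeff cusp_component n
    = (- 1) ^ n * (of_nat (rep_number N (\<lambda>\<delta>. 8 * r \<delta>) n) - combination_coeff n)"
proof -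
  have "fourier_coeff cusp_component
      = (\<lambda>n. (- 1) ^ n * (of_nat (rep_number N (\<lambda>\<delta>. 8 * r \<delta>) n) - combination_coeff n))"
  proof (rule fourier_coeff_eq)
    fix z assume z: "z \<in> upper_half_plane"
    define u where "u = z - 1/2"
    have u: "u \<in> upper_half_plane" using z by (simp add: u_def upper_half_plane_def)
    have zu: "z = u + 1/2" by (simp add: u_def)
    have "(\<lambda>n. of_nat (rep_number N (\<lambda>\<delta>. 8 * r \<delta>) n) * nome u ^ n - combination_coeff n * nome u ^ n)
        sums (eta_product z - eisenstein_combination k (2 * N) eisenstein_coeffs z)"
      using prod_divisors_phi_sums[OF N_pos u, of "\<lambda>\<delta>. 8 * r \<delta>"]
      unfolding zu eta_product_plus_half[OF u]
      by (intro sums_diff eisenstein_combination_plus_half_sums u)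
    moreover have "of_nat (rep_number N (\<lambda>\<delta>. 8 * r \<delta>) n) * nome u ^ n - combination_coeff n * nome u ^ n
        = (- 1) ^ n * (of_nat (rep_number N (\<lambda>\<delta>. 8 * r \<delta>) n) - combination_coeff n) * nome z ^ n" for n
    proof -
      have "x * y ^ n - x' * y ^ n = (- 1) ^ n * (x - x') * (- y) ^ n" for x x' y :: complex
      proof -
        have "(- 1) ^ n * (- y) ^ n = y ^ n" by (simp flip: power_mult_distrib)
        then have "(- 1) ^ n * (x - x') * (- y) ^ n = (x - x') * y ^ n" by (simp only: mult_ac)
        then show ?thesis by (simp only: left_diff_distrib)
      qed
      then show ?thesis unfolding zu nome_plus_half .
    qed
    ultimately show "(\<lambda>n. (- 1) ^ n * (of_nat (rep_number N (\<lambda>\<delta>. 8 * r \<delta>) n) - combination_coeff n) * nome z ^ n)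
        sums cusp_component z"
      using z by (simp only: cusp_component_def if_True)
  qed
  then show ?thesis by simp
qed

text \<open>Identifies the three inner sums of the theorem. The sign in the last one arises because
  \<open>c\<close> is odd, so \<open>2 * c\<close> has one more prime factor.\<close>

lemma weight_coeff_scaled:
  assumes "d dvd N"
  shows "(\<Sum>c | c dvd N.
      (- 1) ^ (omega d + omega c) / (\<Prod>p\<in>prime_factors (2 * N). of_nat p ^ (2 * k) - 1)
      * (of_nat (2 * N * gcd c d) / of_nat c) ^ (2 * k) * cusp_value c) = 2 ^ (2 * k) * weight_coeff d" (is ?all)
    and "(\<Sum>c | c dvd N.
      (- 1) ^ (omega d + omega c + 1) / (\<Prod>p\<in>prime_factors (2 * N). of_nat p ^ (2 * k) - 1)
      * (of_nat (2 * N * gcd c d) / of_nat c) ^ (2 * k) * cusp_value c) = - (2 ^ (2 * k) * weight_coeff d)" (is ?signed)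
    and "(\<Sum>c | c dvd N.
      (- 1) ^ (omega d + omega (2 * c)) / (\<Prod>p\<in>prime_factors (2 * N). of_nat p ^ (2 * k) - 1)
      * (of_nat (N * gcd c d) / of_nat c) ^ (2 * k) * cusp_value c) = - weight_coeff d" (is ?half)
proof -
  have o: "omega (2 * c) = Suc (omega c)" if "c dvd N" for c
    using omega_prime_mult[of 2 c] divisor_odd[OF that] divisor_pos[OF that] by simp
  have two: "(of_nat (2 * N * gcd c d) / of_nat c :: complex) ^ (2 * k) = 2 ^ (2 * k) * (of_nat (N * gcd c d) / of_nat c) ^ (2 * k)" for c
    by (simp add: power_mult_distrib power_divide)
  show ?all and ?signed
    unfolding weight_coeff_def two sum_distrib_left sum_negf[symmetric] by (simp_all add: mult_ac)
  show ?half
    unfolding weight_coeff_def sum_negf[symmetric]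
    by (intro sum.cong refl) (simp add: o)
qed

text \<open>Positive \<open>n\<close> excludes the constant terms, so every coefficient is a divisor
  sum times \<open>- 4 * k / B\<close>; this minus is moved to the weights of the first sum and
  cancels against the one in front of the second.\<close>

lemma combination_coeff_eq:
  assumes "n > 0"
  shows "combination_coeff n
    = of_nat (4 * k) / of_real (bernoulli (2 * k)) *
        (\<Sum>d | d dvd N. - (2 ^ (2 * k) * weight_coeff d) * of_nat (divisor_sigma (2 * k - 1) (real n / real (2 * d))))
      + (- 1) ^ n * of_nat (4 * k) / of_real (bernoulli (2 * k)) *
        (\<Sum>d | d dvd N. weight_coeff d * of_nat (divisor_sigma (2 * k - 1) (real n / real d)))"
proof -
  have "n \<noteq> 0" using assms by simp
  moreover have "w * (t * (- (p / q) * x) - s * (- (p / q) * y)) = p / q * (- (t * w) * x) + s * p / q * (w * y)"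
    for w t p q x y s :: complex
    by (simp add: algebra_simps)
  ultimately show ?thesis
    unfolding combination_coeff_def scaled_eisenstein_coeff_def sum_distrib_left sum.distrib[symmetric]
    by (simp only: if_False)
qed

end

theorem theorem5p2:
  fixes N k :: nat and r :: "nat \<Rightarrow> nat" and G C :: "complex \<Rightarrow> complex"
  assumes "odd N" and "squarefree N"
    and "\<exists>\<delta>. \<delta> dvd N \<and> r \<delta> \<noteq> 0"
    and "k = 2 * (\<Sum>\<delta> | \<delta> dvd N. r \<delta>)"
    and "G = (\<lambda>z. \<Prod>\<delta> | \<delta> dvd N. g_fun (of_nat \<delta> * z) ^ (8 * r \<delta>))"
    and "C = cuspidal_part k (2 * N) G"
  shows "is_cuspidal_part k (2 * N) G C \<and>
    (\<forall>z\<in>upper_half_plane.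
      (\<Prod>\<delta> | \<delta> dvd N. phi (of_nat \<delta> * z) ^ (8 * r \<delta>)) =
        (\<Sum>d | d dvd N.
           (\<Sum>c | c dvd N.
              (- 1) ^ (omega d + omega c) / (\<Prod>p\<in>prime_factors (2 * N). of_nat p ^ (2 * k) - 1)
              * (of_nat (2 * N * gcd c d) / of_nat c) ^ (2 * k)
              * (\<Prod>\<delta> | \<delta> dvd N. (of_nat (gcd c \<delta>) / of_nat \<delta>) ^ (4 * r \<delta>)))
           * eisenstein_series k (2 * of_nat d * z))
      + (\<Sum>d | d dvd N.
           (\<Sum>c | c dvd N.
              (- 1) ^ (omega d + omega (2 * c)) / (\<Prod>p\<in>prime_factors (2 * N). of_nat p ^ (2 * k) - 1)
              * (of_nat (N * gcd c d) / of_nat c) ^ (2 * k)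
              * (\<Prod>\<delta> | \<delta> dvd N. (of_nat (gcd c \<delta>) / of_nat \<delta>) ^ (4 * r \<delta>)))
           * eisenstein_series k (of_nat d * z + 1 / 2))
      + C (z + 1 / 2)) \<and>
    (\<forall>n::nat. n > 0 \<longrightarrow>
      of_nat (rep_number N (\<lambda>\<delta>. 8 * r \<delta>) n) =
        of_nat (4 * k) / of_real (bernoulli (2 * k)) *
        (\<Sum>d | d dvd N.
           (\<Sum>c | c dvd N.
              (- 1) ^ (omega d + omega c + 1) / (\<Prod>p\<in>prime_factors (2 * N). of_nat p ^ (2 * k) - 1)
              * (of_nat (2 * N * gcd c d) / of_nat c) ^ (2 * k)
              * (\<Prod>\<delta> | \<delta> dvd N. (of_nat (gcd c \<delta>) / of_nat \<delta>) ^ (4 * r \<delta>)))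
           * of_nat (divisor_sigma (2 * k - 1) (real n / real (2 * d))))
      + (- 1) ^ n * of_nat (4 * k) / of_real (bernoulli (2 * k)) *
        (\<Sum>d | d dvd N.
           (\<Sum>c | c dvd N.
              (- 1) ^ (omega d + omega c) / (\<Prod>p\<in>prime_factors (2 * N). of_nat p ^ (2 * k) - 1)
              * (of_nat (N * gcd c d) / of_nat c) ^ (2 * k)
              * (\<Prod>\<delta> | \<delta> dvd N. (of_nat (gcd c \<delta>) / of_nat \<delta>) ^ (4 * r \<delta>)))
           * of_nat (divisor_sigma (2 * k - 1) (real n / real d)))
      + (- 1) ^ n * fourier_coeff C n)"
proof -
  note ctxt = assms(1-4)
  have G: "G = eta_product N r" unfolding assms(5) by (simp add: eta_product_def[OF ctxt] fun_eq_iff)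
  have C: "C = cusp_component N k r" unfolding assms(6) G by (rule cuspidal_part_eq[OF ctxt])
  note scaled = weight_coeff_scaled[OF ctxt, unfolded cusp_value_def[OF ctxt]]
  show ?thesis
    (is "_ \<and> (\<forall>z\<in>_. _ z = ?A z + ?B z + _ z) \<and> (\<forall>n. _ n \<longrightarrow> _ n = ?P n + ?Q n + _ n)")
  proof (intro conjI ballI allI impI)
    show "is_cuspidal_part k (2 * N) G C"
      unfolding G C by (rule is_cuspidal_part_cusp_component[OF ctxt])
  next
    fix z assume z: "z \<in> upper_half_plane"
    have z2: "z + 1 / 2 \<in> upper_half_plane" using z by (simp add: upper_half_plane_def)
    have "?A z + ?B z = eisenstein_combination k (2 * N) (eisenstein_coeffs N k r) (z + 1 / 2)"
      unfolding eisenstein_combination_plus_half[OF ctxt] sum.distrib[symmetric]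
      by (intro sum.cong refl) (simp only: scaled mem_Collect_eq, simp add: algebra_simps)
    then show "(\<Prod>\<delta> | \<delta> dvd N. phi (of_nat \<delta> * z) ^ (8 * r \<delta>)) = ?A z + ?B z + C (z + 1 / 2)"
      using z2 unfolding C eta_product_plus_half[OF ctxt z, symmetric] cusp_component_def[OF ctxt] by simp
  next
    fix n :: nat assume n: "n > 0"
    have "?P n + ?Q n = combination_coeff N k r n"
      unfolding combination_coeff_eq[OF ctxt n] weight_coeff_def[OF ctxt] cusp_value_def[OF ctxt, symmetric]
      by (intro arg_cong2[where f = "(+)"] arg_cong2[where f = "(*)"] sum.cong refl)
        (simp only: weight_coeff_scaled[OF ctxt] weight_coeff_def[OF ctxt, symmetric] mem_Collect_eq)
    \<comment> \<open>The coefficient formula for the cuspidal component is solved for the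
      representation number; the two signs \<open>(- 1) ^ n\<close> multiply to 1.\<close>
    then show "of_nat (rep_number N (\<lambda>\<delta>. 8 * r \<delta>) n) = ?P n + ?Q n + (- 1) ^ n * fourier_coeff C n"
      unfolding C fourier_coeff_cusp_component[OF ctxt] by (simp flip: mult.assoc power_mult_distrib)
  qed
qed

end
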